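(* Let $d\ge 2$ and let $\Omega_0,\Omega_1\subset\mathbb{R}^d$ be non-empty open convex sets, $\Omega_0\neq\mathbb{R}^d$, with $\operatorname{cl}\Omega_1\subset\Omega_0$, satisfying the strict convexity condition and the cone condition. Let $\Omega=\operatorname{cl}\Omega_0\setminus\Omega_1$ and $\Omega^*=\operatorname{cl}\Omega_0\setminus\operatorname{cl}\Omega_1$. Let $f\colon\partial\Omega_0\to\mathbb{R}$ be locally bounded, lower semi-continuous and bounded from below. Then $$\boldsymbol{B}^{\circ}_{\Omega,f}(x)=\mathfrak{B}_{\Omega^*,f}(x),\qquad x\in\Omega^*.$$
   Context: Strict convexity condition: the boundaries $\partial\Omega_0$ and $\partial\Omega_1$ contain no (non-degenerate) line segments. Cone condition: any ray lying inside $\Omega_0$ has a translate that lies entirely inside $\Omega_1$. Averages: $\langle\varphi\rangle_E=\frac1{|E|}\int_E\varphi$ for measurable $E$ with $0<|E|<\infty$. $\mathbb{T}$ is the circle of unit length with arc length measure; a function $\varphi$ on $\mathbb{T}$ is identified with a $1$-periodic function $\varphi_{\mathrm{per}}$ on $\mathbb{R}$. Let $\boldsymbol{A}^\circ$ be the class of summable $\varphi\colon\mathbb{T}\to\partial\Omega_0$ for which there exists an open set $\hat\Omega_1$ with $\operatorname{cl}\Omega_1\subset\hat\Omega_1$ and $\operatorname{cl}\hat\Omega_1\subset\Omega_0$ such that $\langle\varphi_{\mathrm{per}}\rangle_J\notin\hat\Omega_1$ for every (bounded, non-degenerate) interval $J\subset\mathbb{R}$ (of any length). Define $$\boldsymbol{B}^\circ_{\Omega,f}(x)=\sup\{\langle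 f(\varphi)\rangle_{\mathbb{T}}\;:\;\varphi\in\boldsymbol{A}^\circ,\ \langle\varphi\rangle_{\mathbb{T}}=x\},\qquad x\in\Omega^*$$ (it may take the value $+\infty$). For $\omega\subset\mathbb{R}^d$, a function $G\colon\omega\to\mathbb{R}\cup\{+\infty\}$ is locally concave if its restriction to every segment contained in $\omega$ is concave. The fixed boundary $\partial_{\mathrm{fixed}}\omega$ is the set of $x\in\omega$ that do not lie in the (relative) interior of any segment contained in $\omega$; for $\omega=\Omega$ or $\omega=\Omega^*$ it equals $\partial\Omega_0$. For $f\colon\partial_{\mathrm{fixed}}\omega\to\mathbb{R}$, $\Lambda_{\omega,f}$ is the class of locally concave $G$ on $\omega$ with $G\ge f$ on $\partial_{\mathrm{fixed}}\omega$, and $\mathfrak{B}_{\omega,f}(x)=\inf\{G(x): G\in\Lambda_{\omega,f}\}$, $x\in\omega$. *)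

theory Defs
  imports "HOL-Analysis.Analysis"
begin

section \<open>The two convex sets\<close>

definition no_segments :: "'a::real_vector set \<Rightarrow> bool" where
  "no_segments S \<longleftrightarrow> (\<forall>a b. a \<noteq> b \<longrightarrow> \<not> closed_segment a b \<subseteq> S)"

definition ray :: "'a::real_vector \<Rightarrow> 'a \<Rightarrow> 'a set" where
  "ray p v = {p + t *\<^sub>R v | t. 0 \<le> t}"

definition cone_condition :: "'a::real_vector set \<Rightarrow> 'a set \<Rightarrow> bool" where
  "cone_condition \<Omega>\<^sub>0 \<Omega>\<^sub>1 \<longleftrightarrow>
    (\<forall>p v. v \<noteq> 0 \<longrightarrow> ray p v \<subseteq> \<Omega>\<^sub>0 \<longrightarrow> (\<exists>w. (+) w ` ray p v \<subseteq> \<Omega>\<^sub>1))"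

section \<open>Boundary data\<close>

definition locally_bounded_on :: "'a::topological_space set \<Rightarrow> ('a \<Rightarrow> real) \<Rightarrow> bool" where
  "locally_bounded_on S f \<longleftrightarrow> (\<forall>x\<in>S. \<exists>U. open U \<and> x \<in> U \<and> bounded (f ` (U \<inter> S)))"

definition lower_semicontinuous_on :: "'a::topological_space set \<Rightarrow> ('a \<Rightarrow> real) \<Rightarrow> bool" where
  "lower_semicontinuous_on S f \<longleftrightarrow>
    (\<forall>x\<in>S. \<forall>c < f x. \<forall>\<^sub>F y in at x within S. c < f y)"

section \<open>Averages and the Bellman function\<close>

definition average :: "real set \<Rightarrow> (real \<Rightarrow> 'a::euclidean_space) \<Rightarrow> 'a" where
  "average E \<phi> = (1 / measure lebesgue E) *\<^sub>R (LINT t:E|lebesgue. \<phi> t)"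

text \<open>
  The average of a real function whose integral may be infinite, as the integral of the
  positive part minus that of the negative part (\<open>ennreal\<close> maps negative reals to 0).
  It is meaningful for measurable functions for which one of the two parts has a finite integral,
  such as those that are bounded below on a set of finite measure.
\<close>
definition ext_average :: "real set \<Rightarrow> (real \<Rightarrow> real) \<Rightarrow> ereal" where
  "ext_average E h =
    (enn2ereal (\<integral>\<^sup>+t\<in>E. ennreal (h t) \<partial>lebesgue) - enn2ereal (\<integral>\<^sup>+t\<in>E. ennreal (- h t) \<partial>lebesgue))
      / ereal (measure lebesgue E)"

text \<open>
  A function on the circle of unit length is represented by its 1-periodic extension to the
  real line; \<open>{0..<1}\<close> is the fundamental domain representing the circle.
\<close>
abbreviation circle :: "real set" where
  "circle \<equiv> {0..<1}"

definition admissible :: "'a::euclidean_space set \<Rightarrow> 'a set \<Rightarrow> (real \<Rightarrow> 'a) set" where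
  "admissible \<Omega>\<^sub>0 \<Omega>\<^sub>1 = {\<phi>.
     (\<forall>t. \<phi> (t + 1) = \<phi> t) \<and>
     (\<forall>t. \<phi> t \<in> frontier \<Omega>\<^sub>0) \<and>
     set_integrable lebesgue circle \<phi> \<and>
     (\<exists>V. open V \<and> closure \<Omega>\<^sub>1 \<subseteq> V \<and> closure V \<subseteq> \<Omega>\<^sub>0 \<and>
        (\<forall>J. is_interval J \<and> bounded J \<and> interior J \<noteq> {} \<longrightarrow> average J \<phi> \<notin> V))}"

definition bellman :: "'a::euclidean_space set \<Rightarrow> 'a set \<Rightarrow> ('a \<Rightarrow> real) \<Rightarrow> 'a \<Rightarrow> ereal" where
  "bellman \<Omega>\<^sub>0 \<Omega>\<^sub>1 f x =
    (SUP \<phi> \<in> {\<phi> \<in> admissible \<Omega>\<^sub>0 \<Omega>\<^sub>1. average circle \<phi> = x}. ext_average circle (\<lambda>t. f (\<phi> t)))"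

section \<open>The minimal locally concave function\<close>

text \<open>Since \<open>0 * \<infinity> = 0\<close> in \<^typ>\<open>ereal\<close>, the degenerate weights 0 and 1 are harmless.\<close>
definition ereal_concave_on :: "'a::real_vector set \<Rightarrow> ('a \<Rightarrow> ereal) \<Rightarrow> bool" where
  "ereal_concave_on S G \<longleftrightarrow>
    (\<forall>x\<in>S. \<forall>y\<in>S. \<forall>u\<ge>0. \<forall>v\<ge>0. u + v = 1 \<longrightarrow>
       ereal u * G x + ereal v * G y \<le> G (u *\<^sub>R x + v *\<^sub>R y))"

definition locally_concave_on :: "'a::real_vector set \<Rightarrow> ('a \<Rightarrow> ereal) \<Rightarrow> bool" where
  "locally_concave_on \<omega> G \<longleftrightarrow>
    (\<forall>x\<in>\<omega>. G x \<noteq> - \<infinity>) \<and>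
    (\<forall>a b. closed_segment a b \<subseteq> \<omega> \<longrightarrow> ereal_concave_on (closed_segment a b) G)"

definition fixed_boundary :: "'a::real_vector set \<Rightarrow> 'a set" where
  "fixed_boundary \<omega> = {x\<in>\<omega>. \<not> (\<exists>a b. closed_segment a b \<subseteq> \<omega> \<and> x \<in> open_segment a b)}"

definition locally_concave_majorants ::
    "'a::real_vector set \<Rightarrow> ('a \<Rightarrow> real) \<Rightarrow> ('a \<Rightarrow> ereal) set" where
  "locally_concave_majorants \<omega> f =
    {G. locally_concave_on \<omega> G \<and> (\<forall>x\<in>fixed_boundary \<omega>. ereal (f x) \<le> G x)}"

definition minimal_locally_concave ::
    "'a::real_vector set \<Rightarrow> ('a \<Rightarrow> real) \<Rightarrow> 'a \<Rightarrow> ereal" where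
  "minimal_locally_concave \<omega> f x = (INF G \<in> locally_concave_majorants \<omega> f. G x)"

end

theory Submission
  imports Defs
begin

text \<open>
  Upper bound. Let \<open>\<phi>\<close> be admissible. Because the averages of \<open>\<phi>\<close> avoid a neighbourhood of
  \<open>closure \<Omega>\<^sub>1\<close>, every interval can be cut in two so that the averages over the two parts are joined by
  a segment outside \<open>closure \<Omega>\<^sub>1\<close>, and neither part is short as long as the interval is not. Iterating, a
  locally concave \<open>G\<close> satisfies \<open>G (average circle \<phi>) \<ge> \<Sum>\<^sub>i \<bar>J\<^sub>i\<bar> G (average J\<^sub>i \<phi>)\<close> for arbitrarily fine partitions.
  Lebesgue's differentiation theorem and Fatou's lemma give the claim, since strict convexity of the
  boundary and lower semicontinuity of \<open>f\<close> yield \<open>liminf G \<ge> f\<close> at every boundary point.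

  Lower bound. The supremum over functions with finitely many values satisfying a robust form of the
  averaging condition is shown to be locally concave. If \<open>c = u a + (1 - u) b\<close>, a function for
  \<open>c\<close> is obtained by placing rapidly repeated copies of the functions for \<open>a\<close> and \<open>b\<close> next to each
  other. Near the junctions one inserts two-valued functions, oscillating on a chord through \<open>a\<close>
  (or \<open>b\<close>) at ever smaller scales, whose averages from an endpoint stay close to \<open>a\<close> (or \<open>b\<close>) at all scales; an
  interval meeting both parts then has an average close to the segment from \<open>a\<close> to \<open>b\<close>. The cone
  condition enters only through the existence of a bounded chord through every point.
\<close>

section \<open>Primitives and simple functions\<close>

text \<open>Functions with admissible averages cannot simply be placed side by side: an interval
  around the junction may catch a short piece of each, whose averages are unrelated to
  \<open>a\<close> and \<open>b\<close>, and the mixture may land in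
  \<open>closure \<Omega>\<^sub>1\<close>. Two notions therefore alternate. A \<open>train\<close>
  is periodic and safe also when finitely many periods are flanked by the constant mean; a
  \<open>flat_block\<close> has averages close to its mean at every scale at both ends. Many
  compressed periods of a train between two thin chord blocks form a flat block
  (\<open>block_from_train\<close>), and two flat blocks form a train again
  (\<open>train_from_blocks\<close>). Each round costs part of the distance \<open>\<delta>\<close>
  to \<open>closure \<Omega>\<^sub>1\<close>; this is harmless, because concavity takes one round
  and \<open>\<delta>\<close> may depend on the function.

  Functions enter through primitives: averages are difference quotients, and flatness at the left
  end reads \<open>norm (A t) \<le> \<epsilon> * t\<close>. In the upper bound, a lower bound for
  \<open>f\<close> passes to \<open>G\<close> along chords; subtracting it makes all terms
  nonnegative, so that infinite values of \<open>G\<close> and Fatou's lemma can be handled in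
  \<open>ennreal\<close>.\<close>

definition primitive_on :: "real set \<Rightarrow> (real \<Rightarrow> 'a::euclidean_space) \<Rightarrow> (real \<Rightarrow> 'a) \<Rightarrow> bool" where
  "primitive_on S g G \<longleftrightarrow> (\<forall>s\<in>S. \<forall>r\<in>S. s \<le> r \<longrightarrow> (g has_integral (G r - G s)) {s..r})"

lemma primitive_onD:
  "primitive_on S g G \<Longrightarrow> s \<in> S \<Longrightarrow> r \<in> S \<Longrightarrow> s \<le> r \<Longrightarrow> (g has_integral (G r - G s)) {s..r}"
  by (auto simp: primitive_on_def)

lemma primitive_on_subset: "primitive_on S g G \<Longrightarrow> T \<subseteq> S \<Longrightarrow> primitive_on T g G"
  by (auto simp: primitive_on_def)

text \<open>The finite set \<open>F\<close> absorbs breakpoints, where a piecewise function follows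
  the neighbouring piece; \<open>c\<close> adjusts the additive constant so that primitives of
  adjacent pieces match.\<close>

lemma primitive_on_cong:
  assumes "primitive_on S g G" "is_interval S" "finite F"
    and "\<And>t. t \<in> S - F \<Longrightarrow> h t = g t" "\<And>t. t \<in> S \<Longrightarrow> H t = G t + c"
  shows "primitive_on S h H"
  unfolding primitive_on_def
proof (intro ballI impI)
  fix s r assume sr: "s \<in> S" "r \<in> S" "s \<le> r"
  then have "{s..r} \<subseteq> S" using assms(2) by (meson atLeastAtMost_iff mem_is_interval_1_I subsetI)
  then have "(h has_integral (G r - G s)) {s..r}"
    by (intro has_integral_spike_finite[OF assms(3) _ primitive_onD[OF assms(1) sr]] assms(4)) auto
  moreover have "H r - H s = G r - G s" unfolding assms(5)[OF sr(1)] assms(5)[OF sr(2)] by simp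
  ultimately show "(h has_integral (H r - H s)) {s..r}" by simp
qed

lemma primitive_on_add:
  "primitive_on S g G \<Longrightarrow> primitive_on S h H \<Longrightarrow> primitive_on S (\<lambda>t. g t + h t) (\<lambda>t. G t + H t)"
  unfolding primitive_on_def
proof (intro ballI impI)
  fix s r assume a: "\<forall>s\<in>S. \<forall>r\<in>S. s \<le> r \<longrightarrow> (g has_integral (G r - G s)) {s..r}"
    "\<forall>s\<in>S. \<forall>r\<in>S. s \<le> r \<longrightarrow> (h has_integral (H r - H s)) {s..r}" and sr: "s \<in> S" "r \<in> S" "s \<le> r"
  have "(g has_integral (G r - G s)) {s..r}" "(h has_integral (H r - H s)) {s..r}"
    using a(1)[rule_format, OF sr] a(2)[rule_format, OF sr] .
  from has_integral_add[OF this]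
  show "((\<lambda>t. g t + h t) has_integral (G r + H r - (G s + H s))) {s..r}"
    by (simp add: add_diff_add)
qed

lemma primitive_on_const: "primitive_on S (\<lambda>t. c) (\<lambda>t. t *\<^sub>R c)"
  unfolding primitive_on_def
proof (intro ballI impI)
  fix s r :: real assume "s \<le> r"
  with has_integral_const_real[of c s r] show "((\<lambda>t. c) has_integral (r *\<^sub>R c - s *\<^sub>R c)) {s..r}"
    by (simp add: scaleR_diff_left)
qed

lemma primitive_on_scaleR_left:
  assumes "primitive_on S g G" shows "primitive_on S (\<lambda>t. g t *\<^sub>R (v::'a::euclidean_space)) (\<lambda>t. G t *\<^sub>R v)"
  unfolding primitive_on_def
proof (intro ballI impI)
  fix s r assume "s \<in> S" "r \<in> S" "s \<le> r"
  from has_integral_scaleR_left[OF primitive_onD[OF assms this]]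
  show "((\<lambda>t. g t *\<^sub>R v) has_integral (G r *\<^sub>R v - G s *\<^sub>R v)) {s..r}"
    by (simp add: scaleR_diff_left)
qed

lemma primitive_on_affine:
  assumes "primitive_on S g G" "0 < m" "\<And>t. t \<in> T \<Longrightarrow> (t - k) / m \<in> S"
  shows "primitive_on T (\<lambda>t. g ((t - k) / m)) (\<lambda>t. m *\<^sub>R G ((t - k) / m))"
  unfolding primitive_on_def
proof (intro ballI impI)
  fix s r assume sr: "s \<in> T" "r \<in> T" "s \<le> r"
  let ?s = "(s-k)/m" and ?r = "(r-k)/m"
  have "(g has_integral (G ?r - G ?s)) (cbox ?s ?r)"
    using primitive_onD[OF assms(1) assms(3)[OF sr(1)] assms(3)[OF sr(2)]] sr(3) assms(2)
    by (simp add: divide_right_mono)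
  then have "((\<lambda>x. g ((1/m) *\<^sub>R x + (-k/m))) has_integral (1 / \<bar>1/m\<bar> ^ DIM(real)) *\<^sub>R (G ?r - G ?s))
     ((\<lambda>x. (1 / (1/m)) *\<^sub>R x + - ((1 / (1/m)) *\<^sub>R (-k/m))) ` cbox ?s ?r)"
    by (rule has_integral_affinity) (use assms(2) in auto)
  moreover have "((\<lambda>x. (1 / (1/m)) *\<^sub>R x + - ((1 / (1/m)) *\<^sub>R (-k/m))) ` cbox ?s ?r) = {s..r}"
    using assms(2) sr image_affinity_atLeastAtMost[of m k ?s ?r] by (auto simp: divide_right_mono)
  ultimately show "((\<lambda>t. g ((t - k) / m)) has_integral (m *\<^sub>R G ?r - m *\<^sub>R G ?s)) {s..r}"
    using assms(2) by (simp add: diff_divide_distrib scaleR_diff_right)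
qed

lemma primitive_on_reflect:
  assumes "primitive_on S g G" "\<And>t. t \<in> T \<Longrightarrow> k - t \<in> S"
  shows "primitive_on T (\<lambda>t. g (k - t)) (\<lambda>t. - G (k - t))"
  unfolding primitive_on_def
proof (intro ballI impI)
  fix s r assume sr: "s \<in> T" "r \<in> T" "s \<le> r"
  have "(g has_integral (G (k-s) - G (k-r))) (cbox (k-r) (k-s))"
    using primitive_onD[OF assms(1) assms(2)[OF sr(2)] assms(2)[OF sr(1)]] sr(3) by simp
  then have "((\<lambda>x. g ((-1) *\<^sub>R x + k)) has_integral (1 / \<bar>-1::real\<bar> ^ DIM(real)) *\<^sub>R (G (k-s) - G (k-r)))
     ((\<lambda>x. (1 / (-1)) *\<^sub>R x + - ((1 / (-1)) *\<^sub>R k)) ` cbox (k-r) (k-s))"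
    by (rule has_integral_affinity) auto
  moreover have "((\<lambda>x. (1 / (-1)) *\<^sub>R x + - ((1 / (-1)) *\<^sub>R k)) ` cbox (k-r) (k-s)) = {s..r}"
    using sr image_affinity_atLeastAtMost[of "-1" k "k-r" "k-s"] by (auto)
  ultimately show "((\<lambda>t. g (k - t)) has_integral (- G (k-r) - - G (k-s))) {s..r}"
    by simp
qed

lemma primitive_on_glue:
  assumes "primitive_on {a..b} g G" "primitive_on {b..c} g G" "a \<le> b" "b \<le> c"
  shows "primitive_on {a..c} g G"
  unfolding primitive_on_def
proof (intro ballI impI)
  fix s r assume sr: "s \<in> {a..c}" "r \<in> {a..c}" "s \<le> r"
  consider "r \<le> b" | "b \<le> s" | "s < b" "b < r" by linarith
  then show "(g has_integral (G r - G s)) {s..r}"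
  proof cases
    case 1 then show ?thesis using sr assms(1) by (auto simp: primitive_on_def)
  next
    case 2 then show ?thesis using sr assms(2) by (auto simp: primitive_on_def)
  next
    case 3
    have "(g has_integral (G b - G s)) {s..b}" "(g has_integral (G r - G b)) {b..r}"
      using sr 3 assms by (auto simp: primitive_on_def)
    from has_integral_combine[OF _ _ this] 3 show ?thesis by simp
  qed
qed

lemma primitive_on_glue3:
  assumes "primitive_on {a..b} g G" "primitive_on {b..c} g G" "primitive_on {c..d} g G" "a \<le> b" "b \<le> c" "c \<le> d"
  shows "primitive_on {a..d} g G"
  using primitive_on_glue[OF primitive_on_glue[OF assms(1,2)] assms(3)] assms(4-) by auto

lemma primitive_on_diff_eq:
  assumes "primitive_on S g G" "primitive_on S g H" "s \<in> S" "r \<in> S"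
  shows "G r - G s = H r - H s"
proof (cases "s \<le> r")
  case True then show ?thesis using assms by (meson has_integral_unique primitive_onD)
next
  case False
  then have "G s - G r = H s - H r" using assms by (meson has_integral_unique primitive_onD nle_le)
  then show ?thesis by (metis minus_diff_eq)
qed

lemma primitive_on_bounds:
  fixes g G :: "real \<Rightarrow> real"
  assumes "primitive_on S g G" "\<And>t. l \<le> g t" "\<And>t. g t \<le> u" "s \<in> S" "r \<in> S" "s \<le> r"
  shows "l * (r - s) \<le> G r - G s" "G r - G s \<le> u * (r - s)"
proof -
  have *: "(g has_integral (G r - G s)) {s..r}" using assms primitive_onD by blast
  show "l * (r - s) \<le> G r - G s"
    using has_integral_le[OF has_integral_const_real[of l s r] *] assms by (auto simp: algebra_simps)
  show "G r - G s \<le> u * (r - s)"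
    using has_integral_le[OF * has_integral_const_real[of u s r]] assms by (auto simp: algebra_simps)
qed

lemma primitive_on_norm_bound:
  assumes "primitive_on S g G" "\<And>t. norm (g t) \<le> C" "s \<in> S" "r \<in> S" "s \<le> r"
  shows "norm (G r - G s) \<le> C * (r - s)"
proof -
  have *: "(g has_integral (G r - G s)) (cbox s r)" using assms primitive_onD by fastforce
  have "0 \<le> C" using assms(2) norm_ge_zero order_trans by blast
  from has_integral_bound[OF this *] assms show ?thesis by auto
qed

text \<open>\<open>G 1 = G 0\<close> is what makes \<open>G (frac t)\<close> continuous across the
  integers. Unit intervals are treated first and then glued.\<close>

lemma primitive_on_frac:
  assumes g: "primitive_on {0..1} g G" and G: "G 1 = G 0"
  shows "primitive_on UNIV (\<lambda>t. g (frac t)) (\<lambda>t. G (frac t))"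
proof -
  have unit: "primitive_on {of_int k..of_int k + 1} (\<lambda>t. g (frac t)) (\<lambda>t. G (frac t))" for k :: int
  proof -
    have "primitive_on {of_int k..of_int k + 1} (\<lambda>t. g (t - of_int k)) (\<lambda>t. G (t - of_int k))"
      using primitive_on_affine[OF g, of 1 "{of_int k..of_int k + 1}" "of_int k"] by simp
    then show ?thesis
    proof (rule primitive_on_cong[where F = "{of_int k + 1}" and c = 0])
      show "g (frac t) = g (t - of_int k)" if "t \<in> {real_of_int k..real_of_int k + 1} - {real_of_int k + 1}" for t
      proof -
        have "frac t = t - of_int k" using that by (auto simp: frac_unique_iff)
        then show ?thesis by simp
      qed
      show "G (frac t) = G (t - of_int k) + 0" if "t \<in> {real_of_int k..real_of_int k + 1}" for t
      proof (cases "t = real_of_int k + 1")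
        case False
        then have "frac t = t - of_int k" using that by (auto simp: frac_unique_iff)
        then show ?thesis by simp
      qed (use G in \<open>auto simp: frac_def\<close>)
    qed (auto simp: is_interval_cc)
  qed
  have chain: "primitive_on {of_int k..of_int k + real n} (\<lambda>t. g (frac t)) (\<lambda>t. G (frac t))" for k :: int and n
  proof (induction n)
    case 0
    show ?case using has_integral_null by (auto simp: primitive_on_def)
  next
    case (Suc n)
    have "primitive_on {of_int k + real n..of_int k + real n + 1} (\<lambda>t. g (frac t)) (\<lambda>t. G (frac t))"
      using unit[of "k + int n"] by simp
    from primitive_on_glue[OF Suc this] show ?case by (simp add: add_ac)
  qed
  show ?thesis
    unfolding primitive_on_def
  proof (intro ballI impI)
    fix s r :: real assume "s \<le> r"
    have "s \<in> {of_int \<lfloor>s\<rfloor>..of_int \<lfloor>s\<rfloor> + real (nat (\<lceil>r\<rceil> - \<lfloor>s\<rfloor>))}"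
         "r \<in> {of_int \<lfloor>s\<rfloor>..of_int \<lfloor>s\<rfloor> + real (nat (\<lceil>r\<rceil> - \<lfloor>s\<rfloor>))}"
      using \<open>s \<le> r\<close> by (auto) linarith+
    then show "((\<lambda>t. g (frac t)) has_integral (G (frac r) - G (frac s))) {s..r}"
      using primitive_onD[OF chain] \<open>s \<le> r\<close> by blast
  qed
qed

text \<open>Translation by 1 turns \<open>G\<close> into another primitive of \<open>g\<close>, so
  the two differ by a constant, which \<open>G 1 = G 0\<close> makes zero.\<close>

lemma primitive_on_periodic:
  fixes G :: "real \<Rightarrow> 'a::euclidean_space"
  assumes "primitive_on UNIV g G" "\<And>t. g (t + 1) = g t" "G 1 = G 0"
  shows "G (t + of_int k) = G t"
proof -
  have step: "G (t + 1) = G t" for t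
  proof -
    have "primitive_on UNIV (\<lambda>t. g (t + 1)) (\<lambda>t. G (t + 1))"
      using primitive_on_affine[OF assms(1), of 1 UNIV "-1"] by simp
    then have "primitive_on UNIV g (\<lambda>t. G (t + 1))" by (simp add: assms(2))
    from primitive_on_diff_eq[OF assms(1) this, of 0 t] show ?thesis by (simp add: assms(3))
  qed
  have pos: "G (t + of_nat n) = G t" for n t
  proof (induction n)
    case (Suc n) then show ?case using step[of "t + of_nat n"] by (simp add: add_ac)
  qed simp
  show ?thesis
  proof (cases "k \<ge> 0")
    case True then show ?thesis using pos[of t "nat k"] by simp
  next
    case False then show ?thesis using pos[of "t + of_int k" "nat (- k)"] by simp
  qed
qed

section \<open>Finitely valued Borel functions\<close>

definition simple_fun :: "(real \<Rightarrow> 'b::topological_space) \<Rightarrow> bool" where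
  "simple_fun g \<longleftrightarrow> g \<in> borel_measurable borel \<and> finite (range g)"

text \<open>Finitely many values with measurable fibres allow an arbitrary \<open>h\<close>. This
  covers integrands such as \<open>f (g t)\<close> and, later, arbitrary functions of the endpoints
  of partition intervals.\<close>

lemma simple_fun_comp:
  fixes g :: "real \<Rightarrow> 'b::t1_space"
  assumes "simple_fun g" shows "simple_fun (\<lambda>t. h (g t))"
proof -
  have "(\<lambda>t. h (g t)) -` A \<in> sets borel" for A
  proof -
    have "(\<lambda>t. h (g t)) -` A = (\<Union>y\<in>range g \<inter> h -` A. g -` {y})" by auto
    moreover have "g -` {y} \<in> sets borel" for y
      using assms measurable_sets_borel[of g borel "{y}"] by (auto simp: simple_fun_def)
    ultimately show ?thesis using assms by (auto simp: simple_fun_def intro!: sets.finite_UN)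
  qed
  then have "(\<lambda>t. h (g t)) \<in> borel_measurable borel" by (auto intro!: measurableI)
  moreover have "range (\<lambda>t. h (g t)) = h ` range g" by auto
  ultimately show ?thesis using assms by (auto simp: simple_fun_def)
qed

lemma simple_fun_integrable:
  fixes g :: "real \<Rightarrow> 'b::euclidean_space"
  assumes "simple_fun g" shows "g integrable_on {s..r}"
proof -
  have "bounded (range g)" using assms by (simp add: simple_fun_def finite_imp_bounded)
  then obtain C where C: "\<And>t. norm (g t) \<le> C" by (auto simp: bounded_iff)
  have "g \<in> borel_measurable (lebesgue_on {s..r})"
    using assms by (auto simp: simple_fun_def intro!: measurable_restrict_space1 measurable_completion)
  then show ?thesis
    by (rule measurable_bounded_by_integrable_imp_integrable[where g = "\<lambda>t. C"]) (use C in auto)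
qed

lemma simple_fun_primitive:
  fixes g :: "real \<Rightarrow> 'b::euclidean_space"
  assumes "simple_fun g" obtains G where "primitive_on UNIV g G" "G 0 = 0"
proof -
  define G where "G t = (if 0 \<le> t then integral {0..t} g else - integral {t..0} g)" for t
  have int: "g integrable_on {s..r}" for s r using simple_fun_integrable[OF assms] .
  have "(g has_integral (G r - G s)) {s..r}" if "s \<le> r" for s r
  proof -
    consider "0 \<le> s" | "r < 0" | "s < 0" "0 \<le> r" by linarith
    then have "G r - G s = integral {s..r} g"
    proof cases
      case 1
      then show ?thesis using Henstock_Kurzweil_Integration.integral_combine[OF 1 that int]
        that by (simp add: G_def algebra_simps)
    next
      case 2
      then show ?thesis using Henstock_Kurzweil_Integration.integral_combine[OF that, of 0 g] int
        that by (simp add: G_def algebra_simps)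
    next
      case 3
      then show ?thesis using Henstock_Kurzweil_Integration.integral_combine[of s 0 r g] int
        by (simp add: G_def algebra_simps)
    qed
    then show ?thesis using int by (simp add: has_integral_iff)
  qed
  then have "primitive_on UNIV g G" by (auto simp: primitive_on_def)
  then show ?thesis using that by (simp add: G_def)
qed

section \<open>Indicators whose density is almost constant at every scale\<close>

text \<open>
  The indicator of a set invariant under scaling by \<open>\<rho>\<close>, so that the proportion of \<open>{0..t}\<close> it occupies
  does not depend on the scale of \<open>t\<close>; a value of \<open>\<rho>\<close> near 1 makes this proportion almost constant.
\<close>
definition selfsim :: "real \<Rightarrow> real \<Rightarrow> real \<Rightarrow> real" where
  "selfsim \<rho> \<kappa> t = (if t > 0 \<and> t / \<rho> powr of_int \<lfloor>ln t / ln \<rho>\<rfloor> < \<kappa> then 1 else 0)"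

lemma selfsim_scale:
  assumes "1 < \<rho>" shows "selfsim \<rho> \<kappa> (\<rho> * t) = selfsim \<rho> \<kappa> t"
proof (cases "t > 0")
  case True
  have "\<lfloor>ln (\<rho> * t) / ln \<rho>\<rfloor> = \<lfloor>ln t / ln \<rho>\<rfloor> + 1"
    using assms True by (simp add: ln_mult add_divide_distrib)
  then show ?thesis using assms True by (simp add: selfsim_def powr_add)
next
  case False
  then show ?thesis using assms by (simp add: selfsim_def zero_less_mult_iff)
qed

lemma selfsim_fundamental:
  assumes "1 \<le> t" "t < \<rho>" shows "selfsim \<rho> \<kappa> t = (if t < \<kappa> then 1 else 0)"
proof -
  have "\<lfloor>ln t / ln \<rho>\<rfloor> = 0" using assms by (auto simp: floor_eq_iff)
  then show ?thesis using assms by (simp add: selfsim_def)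
qed

lemma selfsim_simple: "simple_fun (selfsim \<rho> \<kappa>)"
proof -
  have "selfsim \<rho> \<kappa> \<in> borel_measurable borel" unfolding selfsim_def[abs_def] by measurable
  moreover have "finite (range (selfsim \<rho> \<kappa>))"
    by (rule finite_subset[of _ "{0,1}"]) (auto simp: selfsim_def)
  ultimately show ?thesis by (simp add: simple_fun_def)
qed

text \<open>Scale invariance gives \<open>H (\<rho> * t) = \<rho> * H t\<close>, so a bound by a
  multiple of \<open>t\<close> on the single period \<open>{1..\<rho>}\<close> spreads to all
  smaller scales. On that period
  \<open>\<bar>H t\<bar> \<le> t - 1 \<le> \<rho> - 1 = \<epsilon>\<close>.\<close>

lemma selfsim_primitive:
  fixes \<mu> \<epsilon> :: real
  assumes l: "0 \<le> \<mu>" "\<mu> \<le> 1" and e: "0 < \<epsilon>"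
  obtains \<theta> H where "simple_fun \<theta>" "range \<theta> \<subseteq> {0, 1}" "primitive_on UNIV (\<lambda>t. \<theta> t - \<mu>) H"
    "H 0 = 0" "H 1 = 0" "\<forall>t\<in>{0..1}. \<bar>H t\<bar> \<le> \<epsilon> * t"
proof -
  define \<rho> where "\<rho> = 1 + \<epsilon>"
  \<comment> \<open>Chosen so that \<open>{1..<\<kappa>}\<close> fills the proportion
    \<open>\<mu>\<close> of the period \<open>{1..<\<rho>}\<close>.\<close>
  define \<kappa> where "\<kappa> = 1 + \<mu> * (\<rho> - 1)"
  have rho: "1 < \<rho>" using e by (simp add: \<rho>_def)
  have "0 \<le> \<mu> * \<epsilon>" "\<mu> * \<epsilon> \<le> \<epsilon>" using l e by (auto simp: mult_le_cancel_right1)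
  then have kap: "1 \<le> \<kappa>" "\<kappa> \<le> \<rho>" by (auto simp: \<kappa>_def \<rho>_def)
  let ?\<theta> = "selfsim \<rho> \<kappa>"
  obtain G where G: "primitive_on UNIV ?\<theta> G" "G 0 = 0"
    using simple_fun_primitive[OF selfsim_simple] .
  have scale: "G (\<rho> * t) = \<rho> * G t" for t
  proof -
    have "primitive_on UNIV (\<lambda>t. ?\<theta> (t / \<rho>)) (\<lambda>t. \<rho> * G (t / \<rho>))"
      using primitive_on_affine[OF G(1), of \<rho> UNIV 0] rho by simp
    moreover have "?\<theta> (t / \<rho>) = ?\<theta> t" for t using selfsim_scale[OF rho, of \<kappa> "t / \<rho>"] rho by simp
    ultimately have "primitive_on UNIV ?\<theta> (\<lambda>t. \<rho> * G (t / \<rho>))" by simp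
    from primitive_on_diff_eq[OF G(1) this, of 0 "\<rho> * t"] G(2) rho show ?thesis by simp
  qed
  have "primitive_on {1..\<rho>} ?\<theta> (\<lambda>t. min t \<kappa>)"
  proof (rule primitive_on_glue[OF _ _ kap])
    show "primitive_on {1..\<kappa>} ?\<theta> (\<lambda>t. min t \<kappa>)"
      by (rule primitive_on_cong[OF primitive_on_const[of _ "1::real"], where F = "{\<kappa>}" and c = 0])
         (use kap in \<open>auto simp: selfsim_fundamental is_interval_cc\<close>)
    show "primitive_on {\<kappa>..\<rho>} ?\<theta> (\<lambda>t. min t \<kappa>)"
      by (rule primitive_on_cong[OF primitive_on_const[of _ "0::real"], where F = "{\<rho>}" and c = \<kappa>])
         (use kap in \<open>auto simp: selfsim_fundamental is_interval_cc\<close>)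
  qed
  \<comment> \<open>The increment over one period, compared with
    \<open>G \<rho> = \<rho> * G 1\<close>, determines \<open>G 1\<close>.\<close>
  from primitive_on_diff_eq[OF primitive_on_subset[OF G(1)] this, of 1 \<rho>] rho kap
  have "G \<rho> - G 1 = \<mu> * (\<rho> - 1)" by (simp add: \<kappa>_def)
  moreover have "G \<rho> = \<rho> * G 1" using scale[of 1] by simp
  ultimately have "(\<rho> - 1) * G 1 = (\<rho> - 1) * \<mu>" by (simp add: algebra_simps)
  then have G1: "G 1 = \<mu>" using rho by simp
  define H where "H t = G t - \<mu> * t" for t
  have H: "primitive_on UNIV (\<lambda>t. ?\<theta> t - \<mu>) H"
    using primitive_on_add[OF G(1) primitive_on_const[of UNIV "-\<mu>"]]
    by (simp add: H_def[abs_def] mult.commute)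
  have Hs: "H (\<rho> * t) = \<rho> * H t" for t by (simp add: H_def scale algebra_simps)
  \<comment> \<open>\<open>n\<close> bounds the number of multiplications by \<open>\<rho>\<close>
    that carry \<open>t\<close> into the period \<open>{1..\<rho>}\<close>.\<close>
  have bnd: "(1/\<rho>)^n \<le> t \<Longrightarrow> t \<le> \<rho> \<Longrightarrow> \<bar>H t\<bar> \<le> (\<rho> - 1) * t" for n t
  proof (induction n arbitrary: t)
    case 0
    have "norm (H t - H 1) \<le> 1 * (t - 1)"
      by (rule primitive_on_norm_bound[OF H]) (use 0 l in \<open>auto simp: selfsim_def\<close>)
    moreover have "H 1 = 0" by (simp add: H_def G1)
    moreover have "(\<rho> - 1) * 1 \<le> (\<rho> - 1) * t" using 0 rho by (intro mult_left_mono) auto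
    ultimately show ?case using 0 by simp
  next
    case (Suc n)
    show ?case
    proof (cases "1 \<le> t")
      case True
      have "(1/\<rho>)^n \<le> 1" using rho by (intro power_le_one) auto
      then show ?thesis using Suc.IH[of t] Suc.prems True by simp
    next
      case False
      have "(1/\<rho>)^n \<le> \<rho> * t" using Suc.prems(1) rho by (simp add: field_simps)
      moreover have "\<rho> * t \<le> \<rho>" using False rho by simp
      ultimately have "\<bar>\<rho> * H t\<bar> \<le> (\<rho> - 1) * (\<rho> * t)" using Suc.IH[of "\<rho> * t"] Hs by simp
      then have "\<rho> * \<bar>H t\<bar> \<le> \<rho> * ((\<rho> - 1) * t)" using rho by (simp add: abs_mult mult_ac)
      then show ?thesis using rho by simp
    qed
  qed
  show ?thesis
  proof (rule that[OF selfsim_simple _ H])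
    show "range ?\<theta> \<subseteq> {0,1}" by (auto simp: selfsim_def)
    show "H 0 = 0" "H 1 = 0" by (simp_all add: H_def G G1)
    show "\<forall>t\<in>{0..1}. \<bar>H t\<bar> \<le> \<epsilon> * t"
    proof
      fix t :: real assume "t \<in> {0..1}" then have t: "0 \<le> t" "t \<le> 1" by auto
      show "\<bar>H t\<bar> \<le> \<epsilon> * t"
    proof (cases "t = 0")
      case False
      obtain n where "(1/\<rho>)^n < t" using real_arch_pow_inv[of t "1/\<rho>"] t False rho by auto
      then show ?thesis using bnd[of n t] t rho by (simp add: \<rho>_def)
    qed (simp add: H_def G)
    qed
  qed
qed

text \<open>\<open>selfsim_primitive\<close> controls the left end only, so its function is
  compressed into the left half and mirrored in the right half. The two halves of the primitive
  match at 1/2 because \<open>H 1 = 0\<close>.\<close>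

lemma flat_indicator:
  fixes \<mu> \<epsilon> :: real
  assumes l: "0 \<le> \<mu>" "\<mu> \<le> 1" and e: "0 < \<epsilon>"
  obtains \<theta> Q where "simple_fun \<theta>" "range \<theta> \<subseteq> {0, 1}" "primitive_on {0..1} (\<lambda>t. \<theta> t - \<mu>) Q"
    "Q 0 = 0" "Q 1 = 0" "\<forall>t\<in>{0..1}. \<bar>Q t\<bar> \<le> \<epsilon> * min t (1 - t)"
proof -
  obtain \<theta> H where t: "simple_fun \<theta>" "range \<theta> \<subseteq> {0, 1}" and H: "primitive_on UNIV (\<lambda>t. \<theta> t - \<mu>) H"
    "H 0 = 0" "H 1 = 0" "\<forall>t\<in>{0..1}. \<bar>H t\<bar> \<le> \<epsilon> * t"
    using selfsim_primitive[OF l e] .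
  define \<theta>' where "\<theta>' t = (if t \<le> 1/2 then \<theta> (2 * t) else \<theta> (2 * (1 - t)))" for t
  define Q where "Q t = (if t \<le> 1/2 then H (2 * t) / 2 else - (H (2 * (1 - t)) / 2))" for t
  have 1: "primitive_on UNIV (\<lambda>t. \<theta> (2 * t) - \<mu>) (\<lambda>t. H (2 * t) / 2)"
    using primitive_on_affine[OF H(1), of "1/2" UNIV 0] by (simp add: mult.commute)
  have 2: "primitive_on UNIV (\<lambda>t. \<theta> (2 * (1 - t)) - \<mu>) (\<lambda>t. - (H (2 * (1 - t)) / 2))"
    using primitive_on_reflect[OF 1, of UNIV 1] by simp
  have Q: "primitive_on {0..1} (\<lambda>t. \<theta>' t - \<mu>) Q"
  proof (rule primitive_on_glue)
    show "primitive_on {0..1/2} (\<lambda>t. \<theta>' t - \<mu>) Q"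
      by (rule primitive_on_cong[OF primitive_on_subset[OF 1], where F = "{}" and c = 0])
         (auto simp: \<theta>'_def Q_def is_interval_cc)
    show "primitive_on {1/2..1} (\<lambda>t. \<theta>' t - \<mu>) Q"
    proof (rule primitive_on_cong[OF primitive_on_subset[OF 2], where F = "{1/2}" and c = 0])
      show "Q t = - (H (2 * (1 - t)) / 2) + 0" if "t \<in> {1/2..1}" for t
      proof (cases "t = 1/2")
        case True show ?thesis unfolding True Q_def using H(3) by simp
      qed (use that in \<open>auto simp: Q_def\<close>)
    qed (auto simp: \<theta>'_def is_interval_cc)
  qed auto
  have [measurable]: "\<theta> \<in> borel_measurable borel" using t by (simp add: simple_fun_def)
  have "\<theta>' \<in> borel_measurable borel" unfolding \<theta>'_def[abs_def] by measurable
  moreover have r: "range \<theta>' \<subseteq> {0,1}" using t(2) by (auto simp: \<theta>'_def)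
  moreover have "finite (range \<theta>')" by (rule finite_subset[OF r]) simp
  ultimately have "simple_fun \<theta>'" by (simp add: simple_fun_def)
  then show ?thesis
  proof (rule that[OF _ r Q])
    show "Q 0 = 0" "Q 1 = 0" using H by (auto simp: Q_def)
    show "\<forall>t\<in>{0..1}. \<bar>Q t\<bar> \<le> \<epsilon> * min t (1 - t)"
    proof
      fix t :: real assume "t \<in> {0..1}" then have t: "0 \<le> t" "t \<le> 1" by auto
      show "\<bar>Q t\<bar> \<le> \<epsilon> * min t (1 - t)"
    proof (cases "t \<le> 1/2")
      case True
      then show ?thesis using H(4)[rule_format, of "2*t"] t by (simp add: Q_def min_def)
    next
      case False
      then show ?thesis using H(4)[rule_format, of "2*(1-t)"] t by (simp add: Q_def min_def algebra_simps)
    qed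
    qed
  qed
qed

section \<open>Gluing functions with controlled averages\<close>

text \<open>
  The bound on \<open>A\<close> says that averages of \<open>g\<close> over intervals starting or ending at an endpoint of the
  block are \<open>\<epsilon>\<close>-close to \<open>a\<close>, however short the interval. Such blocks can be joined to other functions.
\<close>
definition flat_block :: "'a::euclidean_space set \<Rightarrow> real \<Rightarrow> real \<Rightarrow> 'a \<Rightarrow> (real \<Rightarrow> 'a) \<Rightarrow> (real \<Rightarrow> 'a) \<Rightarrow> bool" where
  "flat_block K \<delta> \<epsilon> a g A \<longleftrightarrow>
     simple_fun g \<and> primitive_on {0..1} (\<lambda>t. g t - a) A \<and> A 0 = 0 \<and> A 1 = 0 \<and>
     (\<forall>t\<in>{0..1}. norm (A t) \<le> \<epsilon> * min t (1 - t)) \<and>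
     (\<forall>s\<in>{0..1}. \<forall>r\<in>{0..1}. s < r \<longrightarrow> \<delta> \<le> infdist (a + (1 / (r - s)) *\<^sub>R (A r - A s)) K)"

definition clamp_to :: "nat \<Rightarrow> real \<Rightarrow> real" where
  "clamp_to N t = max 0 (min (real N) t)"

text \<open>
  Clamping the argument of \<open>P\<close> amounts to considering averages of \<open>N\<close> consecutive copies of \<open>\<phi>\<close> that are
  preceded and followed by the constant value \<open>x\<close>.
\<close>
definition train :: "'a::euclidean_space set \<Rightarrow> real \<Rightarrow> 'a \<Rightarrow> (real \<Rightarrow> 'a) \<Rightarrow> (real \<Rightarrow> 'a) \<Rightarrow> bool" where
  "train K \<delta> x \<phi> P \<longleftrightarrow>
     simple_fun \<phi> \<and> (\<forall>t. \<phi> (t + 1) = \<phi> t) \<and> primitive_on UNIV (\<lambda>t. \<phi> t - x) P \<and> P 0 = 0 \<and> P 1 = 0 \<and>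
     (\<forall>N s r. s < r \<longrightarrow>
        \<delta> \<le> infdist (x + (1 / (r - s)) *\<^sub>R (P (clamp_to N r) - P (clamp_to N s))) K)"

text \<open>The primitive shrinks in proportion to the block, so the same \<open>\<epsilon>\<close>
  serves for blocks of every length.\<close>

lemma flat_block_rescaled:
  assumes "flat_block K \<delta> \<epsilon> a g A" "0 < u" "0 \<le> t" "t \<le> u"
  shows "norm (u *\<^sub>R A (t / u)) \<le> \<epsilon> * min t (u - t)"
proof -
  have "norm (A (t / u)) \<le> \<epsilon> * min (t / u) (1 - t / u)" using assms by (auto simp: flat_block_def)
  then have "u * norm (A (t / u)) \<le> u * (\<epsilon> * min (t / u) (1 - t / u))" using assms(2) by (intro mult_left_mono) auto
  also have "\<dots> = \<epsilon> * (u * min (t / u) (1 - t / u))" by simp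
  also have "u * min (t / u) (1 - t / u) = min t (u - t)"
    using assms(2) by (simp add: min_mult_distrib_left right_diff_distrib)
  finally show ?thesis using assms(2) by simp
qed

lemma infdist_diff_le:
  assumes "\<delta> \<le> infdist x K" "dist x y \<le> \<epsilon>" shows "\<delta> - \<epsilon> \<le> infdist y K"
  using infdist_triangle[of x K y] assms by simp

text \<open>Mixing the values \<open>p\<close> and \<open>q\<close> keeps all averages on the chord,
  hence away from \<open>K\<close>; a flat indicator with density \<open>\<mu>\<close> of the value
  \<open>q\<close> makes the averages at both ends close to \<open>a\<close>.\<close>

lemma chord_block:
  fixes p q :: "'a::euclidean_space"
  assumes pq: "\<And>y. y \<in> closed_segment p q \<Longrightarrow> \<delta> \<le> infdist y K"
    and a: "a \<in> closed_segment p q" and e: "0 < \<epsilon>"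
  obtains g A where "flat_block K \<delta> \<epsilon> a g A" "range g \<subseteq> {p, q}"
proof -
  obtain \<mu> where m: "0 \<le> \<mu>" "\<mu> \<le> 1" and a: "a = p + \<mu> *\<^sub>R (q - p)"
    using a by (auto simp: in_segment algebra_simps)
  \<comment> \<open>Compensates for the length of the chord; the summand 1 covers
    \<open>p = q\<close>.\<close>
  define \<epsilon>' where "\<epsilon>' = \<epsilon> / (norm (q - p) + 1)"
  have e': "0 < \<epsilon>'" using e by (simp add: \<epsilon>'_def add_nonneg_pos)
  have e'': "\<epsilon>' * norm (q - p) \<le> \<epsilon>"
    using mult_left_mono[of "norm (q - p)" "norm (q - p) + 1" \<epsilon>] e
    by (simp add: \<epsilon>'_def pos_divide_le_eq add_nonneg_pos)
  obtain \<theta> Q where t: "simple_fun \<theta>" "range \<theta> \<subseteq> {0, 1}" and Q: "primitive_on {0..1} (\<lambda>t. \<theta> t - \<mu>) Q"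
    and Q0: "Q 0 = 0" "Q 1 = 0" and Qb: "\<forall>t\<in>{0..1}. \<bar>Q t\<bar> \<le> \<epsilon>' * min t (1 - t)"
    using flat_indicator[OF m e'] .
  have t01: "\<theta> t = 0 \<or> \<theta> t = 1" for t using t(2) by (metis insertE rangeI singletonD subsetD)
  define g where "g t = p + \<theta> t *\<^sub>R (q - p)" for t
  define A where "A t = Q t *\<^sub>R (q - p)" for t
  have "primitive_on {0..1} (\<lambda>t. g t - a) A"
    using primitive_on_scaleR_left[OF Q, of "q - p"] by (simp add: g_def[abs_def] A_def[abs_def] a scaleR_diff_left)
  moreover have "simple_fun g" unfolding g_def[abs_def] by (rule simple_fun_comp[OF t(1)])
  moreover have "norm (A t) \<le> \<epsilon> * min t (1 - t)" if t: "t \<in> {0..1}" for t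
  proof -
    have "norm (A t) \<le> (\<epsilon>' * min t (1 - t)) * norm (q - p)"
      using Qb t by (simp add: A_def mult_right_mono)
    also have "\<dots> = (\<epsilon>' * norm (q - p)) * min t (1 - t)" by simp
    also have "\<dots> \<le> \<epsilon> * min t (1 - t)" using e'' t by (intro mult_right_mono) auto
    finally show ?thesis .
  qed
  moreover have "\<delta> \<le> infdist (a + (1 / (r - s)) *\<^sub>R (A r - A s)) K"
    if sr: "s \<in> {0..1}" "r \<in> {0..1}" "s < r" for s r
  proof (rule pq)
    \<comment> \<open>An average of the values 0 and 1 lies in \<open>{0..1}\<close>, so
      \<open>\<mu> + z\<close> below is a parameter on the chord.\<close>
    have b: "- \<mu> \<le> \<theta> t - \<mu>" "\<theta> t - \<mu> \<le> 1 - \<mu>" for t using t01[of t] by auto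
    define z where "z = (Q r - Q s) / (r - s)"
    have "- \<mu> * (r - s) \<le> Q r - Q s" "Q r - Q s \<le> (1 - \<mu>) * (r - s)"
      using primitive_on_bounds[OF Q b sr(1,2)] sr(3) by simp_all
    then have "- \<mu> \<le> z" "z \<le> 1 - \<mu>" using sr(3) by (simp_all add: z_def pos_le_divide_eq pos_divide_le_eq)
    moreover have "a + (1 / (r - s)) *\<^sub>R (A r - A s) = p + (\<mu> + z) *\<^sub>R (q - p)"
      by (simp add: a A_def z_def scaleR_add_left flip: scaleR_diff_left)
    ultimately show "a + (1 / (r - s)) *\<^sub>R (A r - A s) \<in> closed_segment p q"
      unfolding in_segment by (intro exI[of _ "\<mu> + z"]) (simp add: algebra_simps)
  qed
  ultimately have "flat_block K \<delta> \<epsilon> a g A" using Q0 by (simp add: flat_block_def A_def)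
  moreover have "range g \<subseteq> {p, q}" using t01 by (force simp: g_def)
  ultimately show ?thesis by (rule that)
qed

section \<open>Compressed periods between two thin blocks\<close>

definition sandwich :: "real \<Rightarrow> real \<Rightarrow> (real \<Rightarrow> 'b) \<Rightarrow> (real \<Rightarrow> 'b) \<Rightarrow> real \<Rightarrow> 'b" where
  "sandwich \<tau> m w v t =
    (if t < \<tau> then w (t / \<tau>) else if t < 1 - \<tau> then v ((t - \<tau>) / m) else w ((t - (1 - \<tau>)) / \<tau>))"

lemma simple_fun_sandwich:
  assumes "simple_fun w" "simple_fun v" shows "simple_fun (sandwich \<tau> m w v)"
proof -
  have [measurable]: "w \<in> borel_measurable borel" "v \<in> borel_measurable borel"
    using assms by (auto simp: simple_fun_def)
  have "sandwich \<tau> m w v \<in> borel_measurable borel" unfolding sandwich_def[abs_def] by measurable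
  moreover have "finite (range (sandwich \<tau> m w v))"
    by (rule finite_subset[of _ "range w \<union> range v"]) (use assms in \<open>auto simp: simple_fun_def sandwich_def\<close>)
  ultimately show ?thesis by (simp add: simple_fun_def)
qed

text \<open>Each piece starts from the total of the preceding ones. This serves twice: for
  \<open>w - x\<close> and \<open>\<phi> - x\<close>, where the totals vanish, and for
  \<open>f (w t)\<close> and \<open>f (\<phi> t)\<close>, where they add up to the integral.\<close>

lemma sandwich_primitive:
  assumes w: "primitive_on {0..1} w W" "W 0 = 0" and v: "primitive_on UNIV v P" "P 0 = 0"
    and t: "0 < \<tau>" "\<tau> < 1/2" and m: "0 < m" "m * N = 1 - 2 * \<tau>"
  shows "primitive_on {0..1} (sandwich \<tau> m w v)
    (\<lambda>t. if t \<le> \<tau> then \<tau> *\<^sub>R W (t / \<tau>) else if t \<le> 1 - \<tau> then \<tau> *\<^sub>R W 1 + m *\<^sub>R P ((t - \<tau>) / m)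
         else \<tau> *\<^sub>R W 1 + m *\<^sub>R P N + \<tau> *\<^sub>R W ((t - (1 - \<tau>)) / \<tau>))" (is "primitive_on _ _ ?F")
proof (rule primitive_on_glue3[where b = \<tau> and c = "1 - \<tau>"])
  have N: "(1 - \<tau> - \<tau>) / m = N" using m by (simp add: field_simps)
  show "primitive_on {0..\<tau>} (sandwich \<tau> m w v) ?F"
    by (rule primitive_on_cong[OF primitive_on_affine[OF w(1) t(1), of _ 0], where F = "{\<tau>}" and c = 0])
       (use t in \<open>auto simp: sandwich_def is_interval_cc\<close>)
  show "primitive_on {\<tau>..1 - \<tau>} (sandwich \<tau> m w v) ?F"
  proof (rule primitive_on_cong[OF primitive_on_affine[OF v(1) m(1), of _ \<tau>], where F = "{1 - \<tau>}" and c = "\<tau> *\<^sub>R W 1"])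
    show "?F t = m *\<^sub>R P ((t - \<tau>) / m) + \<tau> *\<^sub>R W 1" if "t \<in> {\<tau>..1 - \<tau>}" for t
      by (cases "t = \<tau>") (use that v t in auto)
  qed (use t in \<open>auto simp: sandwich_def is_interval_cc\<close>)
  show "primitive_on {1 - \<tau>..1} (sandwich \<tau> m w v) ?F"
  proof (rule primitive_on_cong[OF primitive_on_affine[OF w(1) t(1), of _ "1 - \<tau>"], where F = "{}" and c = "\<tau> *\<^sub>R W 1 + m *\<^sub>R P N"])
    show "?F s = \<tau> *\<^sub>R W ((s - (1 - \<tau>)) / \<tau>) + (\<tau> *\<^sub>R W 1 + m *\<^sub>R P N)" if "s \<in> {1 - \<tau>..1}" for s
    proof (cases "s = 1 - \<tau>")
      case True
      then show ?thesis using N t w by simp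
    qed (use that t in auto)
  qed (use t in \<open>auto simp: sandwich_def is_interval_cc field_simps\<close>)
qed (use t in auto)

lemma train_P_periodic: "train K \<delta> x \<phi> P \<Longrightarrow> P (t + of_int k) = P t"
  using primitive_on_periodic[of "\<lambda>t. \<phi> t - x" P t k] by (simp add: train_def)

text \<open>Boundedness is what makes rapid repetition flat: after compression by \<open>m\<close>
  the primitive is at most \<open>m * C\<close>.\<close>

lemma train_P_bounded:
  assumes "train K \<delta> x \<phi> P" obtains C where "0 < C" "\<And>t. norm (P t) \<le> C"
proof -
  have "bounded (range (\<lambda>t. \<phi> t - x))" using assms simple_fun_comp[of \<phi> "\<lambda>y. y - x"]
    by (simp add: train_def simple_fun_def finite_imp_bounded)
  then obtain C where C: "\<And>t. norm (\<phi> t - x) \<le> C" by (auto simp: bounded_iff)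
  have C0: "0 \<le> C" using C[of 0] norm_ge_zero order_trans by blast
  have "norm (P t) \<le> C + 1" for t
  proof -
    have "P t = P (frac t)" using train_P_periodic[OF assms, of t "- \<lfloor>t\<rfloor>"] by (simp add: frac_def)
    moreover have "norm (P (frac t) - P 0) \<le> C * (frac t - 0)"
      by (rule primitive_on_norm_bound[of UNIV "\<lambda>t. \<phi> t - x"]) (use assms C in \<open>auto simp: train_def\<close>)
    moreover have "C * frac t \<le> C * 1" using C0 frac_lt_1[of t] by (intro mult_left_mono) auto
    ultimately show ?thesis using assms by (simp add: train_def)
  qed
  then show ?thesis using that[of "C + 1"] C0 by simp
qed

lemma clamp_to_mono: "s \<le> r \<Longrightarrow> clamp_to N s \<le> clamp_to N r"
  by (auto simp: clamp_to_def)

lemma clamp_to_lipschitz: "s \<le> r \<Longrightarrow> clamp_to N r - clamp_to N s \<le> r - s"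
  by (auto simp: clamp_to_def)

text \<open>In the middle the compressed primitive is at most \<open>\<epsilon> * \<tau>\<close>
  while the distance to the ends is at least \<open>\<tau>\<close>; in the end pieces
  \<open>w\<close> is flat already. For averages over subintervals, \<open>A\<close> is compared
  with the primitive obtained when the end pieces are replaced by the constant \<open>x\<close>.
  That is the clamped situation of \<open>train\<close>, and the error per endpoint is at most
  \<open>\<epsilon>\<close> times the length of the interval.\<close>

lemma block_from_train:
  fixes f :: "'a::euclidean_space \<Rightarrow> real"
  assumes tr: "train K \<delta> x \<phi> P" and w: "flat_block K \<delta> \<epsilon> x w W"
    and e: "0 < \<epsilon>" "4 * \<epsilon> \<le> \<delta>" and \<eta>: "0 < \<eta>"
  obtains g A where "flat_block K (\<delta> / 2) \<epsilon> x g A" "range g \<subseteq> range \<phi> \<union> range w"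
    "integral {0..1} (\<lambda>t. f (\<phi> t)) - \<eta> \<le> integral {0..1} (\<lambda>t. f (g t))"
proof -
  have tr': "simple_fun \<phi>" "\<And>t. \<phi> (t + 1) = \<phi> t" "primitive_on UNIV (\<lambda>t. \<phi> t - x) P" "P 0 = 0" "P 1 = 0"
    and good: "\<And>N s r. s < r \<Longrightarrow> \<delta> \<le> infdist (x + (1 / (r - s)) *\<^sub>R (P (clamp_to N r) - P (clamp_to N s))) K"
    using tr by (auto simp: train_def)
  have w': "simple_fun w" "primitive_on {0..1} (\<lambda>t. w t - x) W" "W 0 = 0" "W 1 = 0"
    and Wb: "\<And>t. t \<in> {0..1} \<Longrightarrow> norm (W t) \<le> \<epsilon> * min t (1 - t)"
    and Wgood: "\<And>s r. s \<in> {0..1} \<Longrightarrow> r \<in> {0..1} \<Longrightarrow> s < r \<Longrightarrow> \<delta> \<le> infdist (x + (1 / (r - s)) *\<^sub>R (W r - W s)) K"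
    using w by (auto simp: flat_block_def)
  obtain C where C: "0 < C" "\<And>t. norm (P t) \<le> C" using train_P_bounded[OF tr] by blast
  define I where "I = integral {0..1} (\<lambda>t. f (\<phi> t))"
  define J where "J = integral {0..1} (\<lambda>t. f (w t))"
  \<comment> \<open>The end pieces change the integral by \<open>2 * \<tau> * (J - I)\<close>. The
    second bound keeps this below \<open>\<eta>\<close>, its summand 1 avoids a division by zero,
    and 1/4 leaves room for the middle part.\<close>
  define \<tau> where "\<tau> = min (1/4) (\<eta> / (2 * (\<bar>J - I\<bar> + 1)))"
  have pos: "0 < 2 * (\<bar>J - I\<bar> + 1)" by (rule mult_pos_pos[OF zero_less_numeral add_nonneg_pos[OF abs_ge_zero zero_less_one]])
  then have "0 < \<eta> / (2 * (\<bar>J - I\<bar> + 1))" using \<eta> by (rule divide_pos_pos[rotated])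
  then have t: "0 < \<tau>" "\<tau> < 1/2" by (auto simp: \<tau>_def)
  have loss: "2 * \<tau> * \<bar>J - I\<bar> \<le> \<eta>"
  proof -
    have "\<tau> \<le> \<eta> / (2 * (\<bar>J - I\<bar> + 1))" by (simp add: \<tau>_def)
    then have "\<tau> * (2 * (\<bar>J - I\<bar> + 1)) \<le> \<eta>" using pos by (simp only: pos_le_divide_eq)
    then show ?thesis using t by (simp add: algebra_simps)
  qed
  \<comment> \<open>So many periods that \<open>m * C \<le> \<epsilon> * \<tau>\<close>.\<close>
  obtain N0 :: nat where N0: "C / (\<epsilon> * \<tau>) < real N0" using reals_Archimedean2 by blast
  define N where "N = Suc N0"
  define m where "m = (1 - 2 * \<tau>) / real N"
  have Npos: "0 < real N" by (simp add: N_def)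
  have m: "0 < m" "m * real N = 1 - 2 * \<tau>" using t Npos by (auto simp: m_def)
  have mC: "m * C \<le> \<epsilon> * \<tau>"
  proof -
    have "C / (\<epsilon> * \<tau>) \<le> real N" using N0 by (simp add: N_def)
    then have "C \<le> real N * (\<epsilon> * \<tau>)" using e t by (simp add: pos_divide_le_eq)
    then have "m * C \<le> m * (real N * (\<epsilon> * \<tau>))" using m by (intro mult_left_mono) auto
    also have "\<dots> = (1 - 2 * \<tau>) * (\<epsilon> * \<tau>)" using m by (simp add: mult.assoc[symmetric])
    also have "\<dots> \<le> 1 * (\<epsilon> * \<tau>)" using t e by (intro mult_right_mono) auto
    finally show ?thesis by simp
  qed
  have PN: "P (real N) = 0" using train_P_periodic[OF tr, of 0 "int N"] tr'(4) by simp
  define g where "g = sandwich \<tau> m w \<phi>"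
  define A where "A t = (if t \<le> \<tau> then \<tau> *\<^sub>R W (t / \<tau>) else if t \<le> 1 - \<tau> then m *\<^sub>R P ((t - \<tau>) / m)
         else \<tau> *\<^sub>R W ((t - (1 - \<tau>)) / \<tau>))" for t
  have "primitive_on {0..1} (sandwich \<tau> m (\<lambda>t. w t - x) (\<lambda>t. \<phi> t - x)) A"
    using sandwich_primitive[OF w'(2,3) tr'(3,4) t m] by (simp add: A_def[abs_def] w'(4) PN cong: if_cong)
  moreover have "sandwich \<tau> m (\<lambda>t. w t - x) (\<lambda>t. \<phi> t - x) = (\<lambda>t. g t - x)"
    by (auto simp: sandwich_def g_def)
  ultimately have gA: "primitive_on {0..1} (\<lambda>t. g t - x) A" by simp
  have gs: "simple_fun g" unfolding g_def by (rule simple_fun_sandwich[OF w'(1) tr'(1)])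
  have A01: "A 0 = 0" "A 1 = 0" using t w' by (auto simp: A_def)
  note Wl = flat_block_rescaled[OF w t(1)]
  have flat: "norm (A s) \<le> \<epsilon> * min s (1 - s)" if s: "s \<in> {0..1}" for s
  proof -
    consider "s \<le> \<tau>" | "\<tau> < s" "s \<le> 1 - \<tau>" | "1 - \<tau> < s" by linarith
    then show ?thesis
    proof cases
      case 1
      then have "norm (A s) \<le> \<epsilon> * min s (\<tau> - s)" using Wl[of s] s by (simp add: A_def)
      also have "\<dots> \<le> \<epsilon> * min s (1 - s)" using e t by (intro mult_left_mono) auto
      finally show ?thesis .
    next
      case 2
      then have "norm (A s) \<le> m * C" using C m by (simp add: A_def)
      also have "\<dots> \<le> \<epsilon> * \<tau>" by (rule mC)
      also have "\<dots> \<le> \<epsilon> * min s (1 - s)" using e 2 by (intro mult_left_mono) auto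
      finally show ?thesis .
    next
      case 3
      then have "norm (A s) \<le> \<epsilon> * min (s - (1 - \<tau>)) (\<tau> - (s - (1 - \<tau>)))"
        using Wl[of "s - (1 - \<tau>)"] s t by (simp add: A_def)
      also have "\<dots> \<le> \<epsilon> * min s (1 - s)" using e t 3 by (intro mult_left_mono) auto
      finally show ?thesis .
    qed
  qed
  \<comment> \<open>Primitive of \<open>g - x\<close> after \<open>g\<close> has been replaced by
    \<open>x\<close> on the end pieces.\<close>
  define E where "E t = m *\<^sub>R P (clamp_to N ((t - \<tau>) / m))" for t
  have AE: "A s - E s = (if s \<le> \<tau> then \<tau> *\<^sub>R W (s / \<tau>) else if s \<le> 1 - \<tau> then 0 else \<tau> *\<^sub>R W ((s - (1 - \<tau>)) / \<tau>))"
    if "s \<in> {0..1}" for s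
  proof -
    consider "s \<le> \<tau>" | "\<tau> < s" "s \<le> 1 - \<tau>" | "1 - \<tau> < s" by linarith
    then show ?thesis
    proof cases
      case 1
      then have "(s - \<tau>) / m \<le> 0" using m by (simp add: divide_le_0_iff)
      then have "clamp_to N ((s - \<tau>) / m) = 0" by (simp add: clamp_to_def)
      then show ?thesis using 1 tr'(4) by (simp add: A_def E_def)
    next
      case 2
      then have "0 \<le> (s - \<tau>) / m" "(s - \<tau>) / m \<le> N" using m by (auto simp: pos_divide_le_eq mult.commute)
      then have "clamp_to N ((s - \<tau>) / m) = (s - \<tau>) / m" by (simp add: clamp_to_def)
      then show ?thesis using 2 by (simp add: A_def E_def)
    next
      case 3
      then have "N \<le> (s - \<tau>) / m" using m by (auto simp: pos_le_divide_eq mult.commute)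
      then have "clamp_to N ((s - \<tau>) / m) = N" using Npos by (simp add: clamp_to_def)
      then show ?thesis using 3 PN t by (simp add: A_def E_def)
    qed
  qed
  \<comment> \<open>Here \<open>y\<close> stands for the other endpoint of the interval. Unless both
    endpoints are in the same end piece, the distance from \<open>s\<close> to the inner border of
    its end piece is at most \<open>\<bar>y - s\<bar>\<close>, and flatness of \<open>w\<close> at
    that border gives the bound.\<close>
  have X: "norm (A s - E s) \<le> \<epsilon> * \<bar>y - s\<bar>"
    if "s \<in> {0..1}" "\<not> (s \<le> \<tau> \<and> y \<le> \<tau>)" "\<not> (1 - \<tau> \<le> s \<and> 1 - \<tau> \<le> y)" for s y
  proof -
    consider "s \<le> \<tau>" | "\<tau> < s" "s \<le> 1 - \<tau>" | "1 - \<tau> < s" by linarith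
    then show ?thesis
    proof cases
      case 1
      then have "norm (A s - E s) \<le> \<epsilon> * min s (\<tau> - s)" using Wl[of s] that by (simp add: AE)
      also have "\<dots> \<le> \<epsilon> * \<bar>y - s\<bar>" using e 1 that by (intro mult_left_mono) auto
      finally show ?thesis .
    next
      case 2
      then show ?thesis using e that by (simp add: AE)
    next
      case 3
      then have "norm (A s - E s) \<le> \<epsilon> * min (s - (1 - \<tau>)) (\<tau> - (s - (1 - \<tau>)))"
        using Wl[of "s - (1 - \<tau>)"] that t by (simp add: AE)
      also have "\<dots> \<le> \<epsilon> * \<bar>y - s\<bar>" using e 3 that by (intro mult_left_mono) auto
      finally show ?thesis .
    qed
  qed
  have ggood: "\<delta> / 2 \<le> infdist (x + (1 / (r - s)) *\<^sub>R (A r - A s)) K"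
    if sr: "s \<in> {0..1}" "r \<in> {0..1}" "s < r" for s r
  proof -
    consider "r \<le> \<tau>" | "1 - \<tau> \<le> s" | "\<tau> < r" "s < 1 - \<tau>" by linarith
    then show ?thesis
    proof cases
      case 1
      have "\<delta> \<le> infdist (x + (1 / (r/\<tau> - s/\<tau>)) *\<^sub>R (W (r/\<tau>) - W (s/\<tau>))) K"
        by (rule Wgood) (use sr 1 t in \<open>auto simp: divide_strict_right_mono\<close>)
      moreover have "(1 / (r/\<tau> - s/\<tau>)) *\<^sub>R (W (r/\<tau>) - W (s/\<tau>)) = (1 / (r - s)) *\<^sub>R (A r - A s)"
        using sr 1 t by (simp add: A_def flip: diff_divide_distrib scaleR_diff_right)
      ultimately show ?thesis using e by simp
    next
      case 2
      let ?r = "(r - (1 - \<tau>))/\<tau>" and ?s = "(s - (1 - \<tau>))/\<tau>"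
      have "\<delta> \<le> infdist (x + (1 / (?r - ?s)) *\<^sub>R (W ?r - W ?s)) K"
        by (rule Wgood) (use sr 2 t in \<open>auto simp: divide_strict_right_mono\<close>)
      moreover have "A s = \<tau> *\<^sub>R W ?s" "A r = \<tau> *\<^sub>R W ?r"
      proof -
        show "A s = \<tau> *\<^sub>R W ?s"
        proof (cases "s = 1 - \<tau>")
          case True
          have "(1 - \<tau> - \<tau>) / m = N" using m by (simp add: field_simps)
          then show ?thesis using True t PN w' by (simp add: A_def)
        qed (use 2 t in \<open>simp add: A_def\<close>)
        show "A r = \<tau> *\<^sub>R W ?r" using 2 sr t by (simp add: A_def)
      qed
      then have "(1 / (?r - ?s)) *\<^sub>R (W ?r - W ?s) = (1 / (r - s)) *\<^sub>R (A r - A s)"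
        using sr t by (simp flip: diff_divide_distrib scaleR_diff_right)
      ultimately show ?thesis using e by simp
    next
      case 3
      let ?r = "(r - \<tau>)/m" and ?s = "(s - \<tau>)/m"
      have g: "\<delta> \<le> infdist (x + (1 / (?r - ?s)) *\<^sub>R (P (clamp_to N ?r) - P (clamp_to N ?s))) K"
        by (rule good) (use sr m in \<open>auto simp: divide_strict_right_mono\<close>)
      have eq: "(1 / (?r - ?s)) *\<^sub>R (P (clamp_to N ?r) - P (clamp_to N ?s)) = (1 / (r - s)) *\<^sub>R (E r - E s)"
        using m by (simp add: E_def flip: diff_divide_distrib scaleR_diff_right)
      have "norm (A r - E r) \<le> \<epsilon> * \<bar>s - r\<bar>" "norm (A s - E s) \<le> \<epsilon> * \<bar>r - s\<bar>"
        using X[OF sr(2), of s] X[OF sr(1), of r] 3 by auto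
      \<comment> \<open>The two endpoint errors add up to \<open>2 * \<epsilon>\<close>, which is at
        most \<open>\<delta> / 2\<close> since \<open>4 * \<epsilon> \<le> \<delta>\<close>.\<close>
      then have "norm ((E r - E s) - (A r - A s)) \<le> 2 * \<epsilon> * (r - s)"
        using norm_triangle_ineq4[of "A s - E s" "A r - E r"] sr(3) by (simp add: algebra_simps)
      then have "dist (x + (1 / (r - s)) *\<^sub>R (E r - E s)) (x + (1 / (r - s)) *\<^sub>R (A r - A s)) \<le> 2 * \<epsilon>"
        using sr(3) by (simp add: dist_norm pos_divide_le_eq flip: scaleR_diff_right)
      from infdist_diff_le[OF _ this, of \<delta> K] g eq e show ?thesis by simp
    qed
  qed
  have block: "flat_block K (\<delta> / 2) \<epsilon> x g A"
    unfolding flat_block_def using gs gA A01 flat ggood by simp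
  have rng: "range g \<subseteq> range \<phi> \<union> range w" by (auto simp: g_def sandwich_def)
  obtain Fw where Fw: "primitive_on UNIV (\<lambda>t. f (w t)) Fw" "Fw 0 = 0"
    using simple_fun_primitive[OF simple_fun_comp[OF w'(1), of f]] .
  obtain Fp where Fp: "primitive_on UNIV (\<lambda>t. f (\<phi> t)) Fp" "Fp 0 = 0"
    using simple_fun_primitive[OF simple_fun_comp[OF tr'(1), of f]] .
  have I: "Fp 1 = I" using primitive_onD[OF Fp(1), of 0 1] Fp(2) by (simp add: I_def integral_unique)
  have J: "Fw 1 = J" using primitive_onD[OF Fw(1), of 0 1] Fw(2) by (simp add: J_def integral_unique)
  \<comment> \<open>Subtracting the mean \<open>I\<close> makes the primitive periodic.\<close>
  have FN: "Fp N = N * I"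
  proof -
    have "primitive_on UNIV (\<lambda>t. f (\<phi> t) + (- I)) (\<lambda>t. Fp t + t *\<^sub>R (- I))"
      by (rule primitive_on_add[OF Fp(1) primitive_on_const])
    from primitive_on_periodic[OF this, of 0 "int N"] show ?thesis using tr'(2) I Fp(2) by simp
  qed
  have "integral {0..1} (\<lambda>t. f (g t)) = 2 * \<tau> * J + (1 - 2 * \<tau>) * I"
  proof -
    have *: "sandwich \<tau> m (\<lambda>t. f (w t)) (\<lambda>t. f (\<phi> t)) = (\<lambda>t. f (g t))"
      by (auto simp: sandwich_def g_def)
    have "(\<tau> - 1) / \<tau> \<noteq> 1" "(1 - (1 - \<tau>)) / \<tau> = 1" using t by (auto simp: field_simps)
    then have "((\<lambda>t. f (g t)) has_integral (\<tau> * J + m * (N * I) + \<tau> * J)) {0..1}"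
      using primitive_onD[OF sandwich_primitive[OF primitive_on_subset[OF Fw(1)] Fw(2) Fp t m], of 0 1]
        t I J FN Fw(2) unfolding * by auto
    moreover have "m * (N * I) = (1 - 2 * \<tau>) * I" using m(2) by (simp add: mult.assoc[symmetric])
    ultimately show ?thesis by (simp add: integral_unique)
  qed
  also have "\<dots> = I + 2 * \<tau> * (J - I)" by (simp add: algebra_simps)
  finally have int: "integral {0..1} (\<lambda>t. f (g t)) = I + 2 * \<tau> * (J - I)" .
  have "\<bar>2 * \<tau> * (J - I)\<bar> \<le> \<eta>" using loss t by (simp add: abs_mult)
  then have "I - \<eta> \<le> integral {0..1} (\<lambda>t. f (g t))" unfolding int by linarith
  then show ?thesis using that[OF block rng] by (simp add: I_def)
qed

section \<open>Periodic juxtaposition of two blocks\<close>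

definition juxtapose :: "real \<Rightarrow> (real \<Rightarrow> 'b) \<Rightarrow> (real \<Rightarrow> 'b) \<Rightarrow> real \<Rightarrow> 'b" where
  "juxtapose u g h t = (if t < u then g (t / u) else h ((t - u) / (1 - u)))"

lemma simple_fun_juxtapose:
  assumes "simple_fun g" "simple_fun h" shows "simple_fun (\<lambda>t. juxtapose u g h (frac t))"
proof -
  have [measurable]: "g \<in> borel_measurable borel" "h \<in> borel_measurable borel"
    using assms by (auto simp: simple_fun_def)
  have "(\<lambda>t. juxtapose u g h (frac t)) \<in> borel_measurable borel"
    unfolding juxtapose_def[abs_def] frac_def by measurable
  moreover have "finite (range (\<lambda>t. juxtapose u g h (frac t)))"
    by (rule finite_subset[of _ "range g \<union> range h"]) (use assms in \<open>auto simp: simple_fun_def juxtapose_def\<close>)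
  ultimately show ?thesis by (simp add: simple_fun_def)
qed

lemma juxtapose_primitive:
  assumes g: "primitive_on {0..1} g G" and h: "primitive_on {0..1} h H" "H 0 = 0" and u: "0 < u" "u < 1"
  shows "primitive_on {0..1} (juxtapose u g h)
    (\<lambda>t. if t \<le> u then u *\<^sub>R G (t / u) else u *\<^sub>R G 1 + (1 - u) *\<^sub>R H ((t - u) / (1 - u)))" (is "primitive_on _ _ ?F")
proof (rule primitive_on_glue[where b = u])
  show "primitive_on {0..u} (juxtapose u g h) ?F"
    by (rule primitive_on_cong[OF primitive_on_affine[OF g u(1), of _ 0], where F = "{u}" and c = 0])
       (use u in \<open>auto simp: juxtapose_def is_interval_cc\<close>)
  have u': "0 < 1 - u" using u by simp
  show "primitive_on {u..1} (juxtapose u g h) ?F"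
  proof (rule primitive_on_cong[OF primitive_on_affine[OF h(1) u', of _ u], where F = "{}" and c = "u *\<^sub>R G 1"])
    show "?F t = (1 - u) *\<^sub>R H ((t - u) / (1 - u)) + u *\<^sub>R G 1" if "t \<in> {u..1}" for t
      by (cases "t = u") (use that h u in auto)
  qed (use u in \<open>auto simp: juxtapose_def is_interval_cc\<close>)
qed (use u in auto)

text \<open>The primitive splits into \<open>D\<close>, the deviation of the blocks from their
  means, and \<open>\<theta>\<close>, which records the motion along \<open>b - a\<close>.
  \<open>D\<close> vanishes at every junction and is at most \<open>\<epsilon>\<close> times the
  distance to any junction, so an interval across a junction has an average within
  \<open>\<epsilon>\<close> of the segment. An interval without a junction lies in one rescaled
  block.\<close>

lemma train_from_blocks:
  fixes a b :: "'a::euclidean_space"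
  assumes g: "flat_block K \<delta> \<epsilon> a g A" and h: "flat_block K \<delta> \<epsilon> b h B" and u: "0 < u" "u < 1"
    and ab: "\<And>y. y \<in> closed_segment a b \<Longrightarrow> \<delta> + \<epsilon> \<le> infdist y K" and e: "0 < \<epsilon>"
    and c: "c = u *\<^sub>R a + (1 - u) *\<^sub>R b"
  obtains P where "train K \<delta> c (\<lambda>t. juxtapose u g h (frac t)) P"
proof -
  have gA: "simple_fun g" "primitive_on {0..1} (\<lambda>t. g t - a) A" "A 0 = 0" "A 1 = 0"
    and Ab: "\<And>t. t \<in> {0..1} \<Longrightarrow> norm (A t) \<le> \<epsilon> * min t (1 - t)"
    and Agood: "\<And>s r. s \<in> {0..1} \<Longrightarrow> r \<in> {0..1} \<Longrightarrow> s < r \<Longrightarrow> \<delta> \<le> infdist (a + (1 / (r - s)) *\<^sub>R (A r - A s)) K"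
    using g by (auto simp: flat_block_def)
  have hB: "simple_fun h" "primitive_on {0..1} (\<lambda>t. h t - b) B" "B 0 = 0" "B 1 = 0"
    and Bb: "\<And>t. t \<in> {0..1} \<Longrightarrow> norm (B t) \<le> \<epsilon> * min t (1 - t)"
    and Bgood: "\<And>s r. s \<in> {0..1} \<Longrightarrow> r \<in> {0..1} \<Longrightarrow> s < r \<Longrightarrow> \<delta> \<le> infdist (b + (1 / (r - s)) *\<^sub>R (B r - B s)) K"
    using h by (auto simp: flat_block_def)
  define v where "v = 1 - u"
  have v: "0 < v" "v < 1" "u + v = 1" using u by (auto simp: v_def)
  define D where "D t = (if t \<le> u then u *\<^sub>R A (t / u) else v *\<^sub>R B ((t - u) / v))" for t
  \<comment> \<open>Seen from \<open>c\<close>, the means \<open>a\<close> and \<open>b\<close> lie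
    at \<open>- v\<close> and \<open>u\<close> times \<open>b - a\<close>; \<open>\<theta>\<close>
    is the primitive of this two-valued function.\<close>
  define \<theta> where "\<theta> t = (if t \<le> u then - v * t else - u * (1 - t))" for t
  have D0: "primitive_on {0..1} (juxtapose u (\<lambda>t. g t - a) (\<lambda>t. h t - b)) D"
    using juxtapose_primitive[OF gA(2) hB(2,3) u] by (simp add: D_def[abs_def] v_def gA(4) cong: if_cong)
  have \<theta>0: "primitive_on {0..1} (juxtapose u (\<lambda>_. - v) (\<lambda>_. u)) \<theta>"
  proof (rule primitive_on_cong[OF juxtapose_primitive[OF primitive_on_const primitive_on_const _ u], where F = "{}" and c = 0])
    show "\<theta> t = (if t \<le> u then u *\<^sub>R (t / u) *\<^sub>R - v
          else u *\<^sub>R 1 *\<^sub>R - v + (1 - u) *\<^sub>R ((t - u) / (1 - u)) *\<^sub>R u) + 0" for t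
    proof (cases "t \<le> u")
      case False
      have "(1 - u) *\<^sub>R ((t - u) / (1 - u)) *\<^sub>R u = (t - u) * u" using u by simp
      then show ?thesis using False by (simp add: \<theta>_def v_def algebra_simps)
    qed (use u in \<open>simp add: \<theta>_def\<close>)
  qed (auto simp: is_interval_cc)
  have D1: "D 1 = D 0" "D 0 = 0" "\<theta> 1 = \<theta> 0" "\<theta> 0 = 0"
    using u v gA hB by (auto simp: D_def \<theta>_def v_def)
  note DP = primitive_on_frac[OF D0 D1(1)]
  note \<theta>P = primitive_on_frac[OF \<theta>0 D1(3)]
  define P where "P t = D (frac t) + \<theta> (frac t) *\<^sub>R (b - a)" for t
  define \<phi> where "\<phi> t = juxtapose u g h (frac t)" for t
  have "primitive_on UNIV (\<lambda>t. juxtapose u (\<lambda>t. g t - a) (\<lambda>t. h t - b) (frac t)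
          + juxtapose u (\<lambda>_. - v) (\<lambda>_. u) (frac t) *\<^sub>R (b - a)) P"
    unfolding P_def[abs_def] by (rule primitive_on_add[OF DP primitive_on_scaleR_left[OF \<theta>P]])
  moreover have "juxtapose u (\<lambda>t. g t - a) (\<lambda>t. h t - b) s
          + juxtapose u (\<lambda>_. - v) (\<lambda>_. u) s *\<^sub>R (b - a) = juxtapose u g h s - c" for s
  proof -
    obtain w where w: "b - a = w" by blast
    have "c = a + v *\<^sub>R w" "c = b - u *\<^sub>R w" by (simp_all add: c v_def flip: w) (simp_all add: algebra_simps)
    then show ?thesis unfolding w by (cases "s < u") (simp add: juxtapose_def, simp add: juxtapose_def algebra_simps)
  qed
  ultimately have P: "primitive_on UNIV (\<lambda>t. \<phi> t - c) P" by (simp add: \<phi>_def)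
  have \<theta>b: "- v * (r - s) \<le> \<theta> (frac r) - \<theta> (frac s)" "\<theta> (frac r) - \<theta> (frac s) \<le> u * (r - s)" if "s \<le> r" for s r
    by (rule primitive_on_bounds[where l = "- v" and u = u, OF \<theta>P]; use that u v in \<open>simp add: juxtapose_def\<close>)+
  note Dl = flat_block_rescaled[OF g u(1)]
  note Dr = flat_block_rescaled[OF h v(1)]
  have Db: "norm (D y) \<le> \<epsilon> * z" if y: "0 \<le> y" "y < 1" and z: "y \<le> z \<or> 1 - y \<le> z \<or> \<bar>y - u\<bar> \<le> z" for y z
  proof (cases "y \<le> u")
    case True
    then have "norm (D y) \<le> \<epsilon> * min y (u - y)" using Dl y by (simp add: D_def)
    also have "\<dots> \<le> \<epsilon> * z" using e z True u by (intro mult_left_mono) auto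
    finally show ?thesis .
  next
    case False
    then have "norm (D y) \<le> \<epsilon> * min (y - u) (v - (y - u))" using Dr[of "y - u"] y v by (simp add: D_def)
    also have "\<dots> \<le> \<epsilon> * z" using e z False u v by (intro mult_left_mono) auto
    finally show ?thesis .
  qed
  \<comment> \<open>Junctions are the integers and their translates by \<open>u\<close>. No junction
    is closer to \<open>t\<close> than the nearest one in the closed unit interval from
    \<open>\<lfloor>t\<rfloor>\<close> to \<open>\<lfloor>t\<rfloor> + 1\<close>, which
    \<open>Db\<close> covers.\<close>
  have junction: "norm (D (frac t)) \<le> \<epsilon> * \<bar>t - j\<bar>" if "j \<in> \<int> \<or> j - u \<in> \<int>" for t j
  proof -
    define k where "k = \<lfloor>t\<rfloor>"
    have t: "t = of_int k + frac t" by (simp add: k_def frac_def)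
    have fr: "0 \<le> frac t" "frac t < 1" by (auto simp: frac_lt_1)
    from that show ?thesis
    proof
      assume "j \<in> \<int>"
      then obtain l where l: "j = of_int l" by (auto elim: Ints_cases)
      consider "l \<le> k" | "k + 1 \<le> l" by linarith
      then have "frac t \<le> \<bar>t - j\<bar> \<or> 1 - frac t \<le> \<bar>t - j\<bar>"
      proof cases
        case 1 then have "real_of_int l \<le> of_int k" by simp
        then show ?thesis using t l by linarith
      next
        case 2 then have "real_of_int (k + 1) \<le> of_int l" by (simp only: of_int_le_iff)
        then have "of_int k + 1 \<le> real_of_int l" by simp
        then show ?thesis using t l by linarith
      qed
      then show ?thesis using Db[OF fr] by blast
    next
      assume "j - u \<in> \<int>"
      then obtain l where "j - u = of_int l" by (auto elim: Ints_cases)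
      then have l: "j = of_int l + u" by simp
      consider "l + 1 \<le> k" | "k + 1 \<le> l" | "l = k" by linarith
      then have "frac t \<le> \<bar>t - j\<bar> \<or> 1 - frac t \<le> \<bar>t - j\<bar> \<or> \<bar>frac t - u\<bar> \<le> \<bar>t - j\<bar>"
      proof cases
        case 1 then have "real_of_int (l + 1) \<le> of_int k" by (simp only: of_int_le_iff)
        then have "of_int l + 1 \<le> real_of_int k" by simp
        then show ?thesis using t l u by linarith
      next
        case 2 then have "real_of_int (k + 1) \<le> of_int l" by (simp only: of_int_le_iff)
        then have "of_int k + 1 \<le> real_of_int l" by simp
        then show ?thesis using t l u by linarith
      next
        case 3
        then have "t - j = frac t - u" using t l by linarith
        then show ?thesis by simp
      qed
      then show ?thesis using Db[OF fr] by blast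
    qed
  qed
  have aux: "(1 / d) *\<^sub>R (\<alpha> *\<^sub>R y + (\<beta> * d) *\<^sub>R w) = (\<alpha> / d) *\<^sub>R y + \<beta> *\<^sub>R w"
    if "d \<noteq> 0" for d \<alpha> \<beta> :: real and y w :: 'a
    using that by (simp add: scaleR_add_right)
  have good: "\<delta> \<le> infdist (c + (1 / (r - s)) *\<^sub>R (P (clamp_to N r) - P (clamp_to N s))) K" if sr: "s < r" for N s r
  proof -
    define s' where "s' = clamp_to N s"
    define r' where "r' = clamp_to N r"
    have s'r': "s' \<le> r'" "r' - s' \<le> r - s"
      using clamp_to_mono[of s r N] clamp_to_lipschitz[of s r N] sr by (auto simp: s'_def r'_def)
    show ?thesis
    proof (cases "\<exists>j. (j \<in> \<int> \<or> j - u \<in> \<int>) \<and> s' \<le> j \<and> j \<le> r'")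
      case True
      then obtain j where j: "j \<in> \<int> \<or> j - u \<in> \<int>" "s' \<le> j" "j \<le> r'" by blast
      \<comment> \<open>The quotient is taken over the full length \<open>r - s\<close>. Clamping
        only shortens the interval and \<open>{- v..u}\<close> contains 0, so \<open>z\<close> still
        stays in that range.\<close>
      define z where "z = (\<theta> (frac r') - \<theta> (frac s')) / (r - s)"
      have "u * (r' - s') \<le> u * (r - s)" "v * (r' - s') \<le> v * (r - s)"
        using s'r' u v by (intro mult_left_mono; simp)+
      then have "- v * (r - s) \<le> \<theta> (frac r') - \<theta> (frac s')" "\<theta> (frac r') - \<theta> (frac s') \<le> u * (r - s)"
        using \<theta>b[OF s'r'(1)] by auto
      then have z: "- v \<le> z" "z \<le> u" using sr by (simp_all add: z_def pos_le_divide_eq pos_divide_le_eq)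
      have "c + z *\<^sub>R (b - a) = a + (v + z) *\<^sub>R (b - a)" by (simp add: c v_def algebra_simps)
      then have "c + z *\<^sub>R (b - a) \<in> closed_segment a b"
        unfolding in_segment using z v by (intro exI[of _ "v + z"]) (simp add: algebra_simps)
      note near = ab[OF this]
      have "norm (D (frac r') - D (frac s')) \<le> \<epsilon> * \<bar>r' - j\<bar> + \<epsilon> * \<bar>s' - j\<bar>"
        using norm_triangle_ineq4[of "D (frac r')" "D (frac s')"] junction[OF j(1), of r'] junction[OF j(1), of s'] by linarith
      also have "\<dots> = \<epsilon> * (r' - s')" using j by (simp add: algebra_simps)
      also have "\<dots> \<le> \<epsilon> * (r - s)" using s'r' e by simp
      finally have "dist (c + z *\<^sub>R (b - a)) (c + (1 / (r - s)) *\<^sub>R (P r' - P s')) \<le> \<epsilon>"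
      proof -
        assume *: "norm (D (frac r') - D (frac s')) \<le> \<epsilon> * (r - s)"
        have "P r' - P s' = (D (frac r') - D (frac s')) + (\<theta> (frac r') - \<theta> (frac s')) *\<^sub>R (b - a)"
          by (simp add: P_def scaleR_diff_left)
        then have "(1 / (r - s)) *\<^sub>R (P r' - P s') = (1 / (r - s)) *\<^sub>R (D (frac r') - D (frac s')) + z *\<^sub>R (b - a)"
          by (simp add: z_def scaleR_add_right)
        then have "dist (c + z *\<^sub>R (b - a)) (c + (1 / (r - s)) *\<^sub>R (P r' - P s')) = norm ((1 / (r - s)) *\<^sub>R (D (frac r') - D (frac s')))"
          by (simp add: dist_norm norm_minus_commute)
        also have "\<dots> \<le> \<epsilon>" using * sr by (simp add: pos_divide_le_eq)
        finally show ?thesis .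
      qed
      from infdist_diff_le[OF near this] show ?thesis by (simp add: r'_def s'_def)
    next
      case False
      then have no: "\<And>j. j \<in> \<int> \<or> j - u \<in> \<int> \<Longrightarrow> \<not> (s' \<le> j \<and> j \<le> r')" by blast
      \<comment> \<open>Clamping that moves an endpoint puts it at 0 or \<open>N\<close>, which are
        junctions; so no clamping has happened here.\<close>
      have "s' \<notin> \<int>" "r' \<notin> \<int>" using no[of s'] no[of r'] s'r' by auto
      then have s: "s' = s" and r: "r' = r"
        by (auto simp: s'_def r'_def clamp_to_def max_def min_def split: if_splits)
      define k where "k = \<lfloor>s\<rfloor>"
      have "\<lfloor>r\<rfloor> = k"
      proof -
        have "\<not> s \<le> of_int \<lfloor>r\<rfloor>" using no[of "of_int \<lfloor>r\<rfloor>"] s r by auto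
        then have "\<lfloor>r\<rfloor> \<le> k" unfolding k_def by (simp add: le_floor_iff)
        moreover have "k \<le> \<lfloor>r\<rfloor>" using sr unfolding k_def by (intro floor_mono) auto
        ultimately show ?thesis by simp
      qed
      then have fr: "frac s = s - k" "frac r = r - k" by (simp_all add: frac_def k_def)
      have rng: "0 \<le> frac s" "frac r < 1" "frac s < frac r"
        using fr sr frac_ge_0[of s] frac_lt_1[of r] by - linarith+
      have "\<not> (s \<le> of_int k + u \<and> of_int k + u \<le> r)" using no[of "of_int k + u"] s r by simp
      then consider "frac r < u" | "u < frac s" using fr sr by linarith
      then show ?thesis
      proof cases
        case 1
        let ?s = "frac s / u" and ?r = "frac r / u"
        have g: "\<delta> \<le> infdist (a + (1 / (?r - ?s)) *\<^sub>R (A ?r - A ?s)) K"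
          by (rule Agood) (use rng 1 u in \<open>auto simp: divide_strict_right_mono\<close>)
        have frd: "frac r - frac s = r - s" using fr by simp
        have "\<theta> (frac r) - \<theta> (frac s) = - v * (r - s)"
          using 1 rng unfolding \<theta>_def frd[symmetric] by (simp add: algebra_simps)
        moreover have "D (frac r) - D (frac s) = u *\<^sub>R (A ?r - A ?s)"
          using 1 rng by (simp add: D_def scaleR_diff_right)
        moreover have "P r - P s = (D (frac r) - D (frac s)) + (\<theta> (frac r) - \<theta> (frac s)) *\<^sub>R (b - a)"
          by (simp add: P_def scaleR_diff_left)
        ultimately have "P r - P s = u *\<^sub>R (A ?r - A ?s) + (- v * (r - s)) *\<^sub>R (b - a)" by simp
        then have "(1 / (r - s)) *\<^sub>R (P r - P s) = (u / (r - s)) *\<^sub>R (A ?r - A ?s) - v *\<^sub>R (b - a)"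
          using aux[of "r - s" u "A ?r - A ?s" "- v" "b - a"] sr by simp
        moreover have "1 / (?r - ?s) = u / (r - s)"
          using fr u by (simp flip: diff_divide_distrib)
        moreover have "c = a + v *\<^sub>R (b - a)" by (simp add: c v_def algebra_simps)
        ultimately have "c + (1 / (r - s)) *\<^sub>R (P r - P s) = a + (1 / (?r - ?s)) *\<^sub>R (A ?r - A ?s)" by simp
        then show ?thesis using g s r unfolding s'_def r'_def by simp
      next
        case 2
        let ?s = "(frac s - u) / v" and ?r = "(frac r - u) / v"
        have g: "\<delta> \<le> infdist (b + (1 / (?r - ?s)) *\<^sub>R (B ?r - B ?s)) K"
          by (rule Bgood) (use rng 2 u v in \<open>auto simp: divide_strict_right_mono\<close>)
        have frd: "frac r - frac s = r - s" using fr by simp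
        have "\<theta> (frac r) - \<theta> (frac s) = u * (r - s)"
          using 2 rng unfolding \<theta>_def frd[symmetric] by (simp add: algebra_simps)
        moreover have "D (frac r) - D (frac s) = v *\<^sub>R (B ?r - B ?s)"
          using 2 rng by (simp add: D_def scaleR_diff_right)
        moreover have "P r - P s = (D (frac r) - D (frac s)) + (\<theta> (frac r) - \<theta> (frac s)) *\<^sub>R (b - a)"
          by (simp add: P_def scaleR_diff_left)
        ultimately have "P r - P s = v *\<^sub>R (B ?r - B ?s) + (u * (r - s)) *\<^sub>R (b - a)" by simp
        then have "(1 / (r - s)) *\<^sub>R (P r - P s) = (v / (r - s)) *\<^sub>R (B ?r - B ?s) + u *\<^sub>R (b - a)"
          using aux[of "r - s" v "B ?r - B ?s" u "b - a"] sr by simp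
        moreover have "1 / (?r - ?s) = v / (r - s)"
          using fr v by (simp flip: diff_divide_distrib)
        moreover have "c = b - u *\<^sub>R (b - a)" by (simp add: c algebra_simps)
        ultimately have "c + (1 / (r - s)) *\<^sub>R (P r - P s) = b + (1 / (?r - ?s)) *\<^sub>R (B ?r - B ?s)" by simp
        then show ?thesis using g s r unfolding s'_def r'_def by simp
      qed
    qed
  qed
  have "P 0 = 0" "P 1 = 0" using D1 by (simp_all add: P_def)
  moreover have "\<phi> (t + 1) = \<phi> t" for t by (simp add: \<phi>_def frac_1_eq)
  moreover have "simple_fun \<phi>" unfolding \<phi>_def[abs_def] by (rule simple_fun_juxtapose[OF gA(1) hB(1)])
  ultimately have "train K \<delta> c \<phi> P" using P good by (simp add: train_def)
  then show ?thesis using that by (simp add: \<phi>_def[abs_def])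
qed

lemma integral_juxtapose:
  fixes f :: "'a::t1_space \<Rightarrow> real"
  assumes "simple_fun g" "simple_fun h" "0 < u" "u < 1"
  shows "integral {0..1} (\<lambda>t. f (juxtapose u g h (frac t))) =
    u * integral {0..1} (\<lambda>t. f (g t)) + (1 - u) * integral {0..1} (\<lambda>t. f (h t))"
proof -
  obtain G where G: "primitive_on UNIV (\<lambda>t. f (g t)) G" "G 0 = 0"
    using simple_fun_primitive[OF simple_fun_comp[OF assms(1), of f]] .
  obtain H where H: "primitive_on UNIV (\<lambda>t. f (h t)) H" "H 0 = 0"
    using simple_fun_primitive[OF simple_fun_comp[OF assms(2), of f]] .
  have 1: "G 1 = integral {0..1} (\<lambda>t. f (g t))" "H 1 = integral {0..1} (\<lambda>t. f (h t))"
    using primitive_onD[OF G(1), of 0 1] primitive_onD[OF H(1), of 0 1] G H by (simp_all add: integral_unique)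
  have "(juxtapose u (\<lambda>t. f (g t)) (\<lambda>t. f (h t)) has_integral (u * G 1 + (1 - u) * H 1)) {0..1}"
    using primitive_onD[OF juxtapose_primitive[OF primitive_on_subset[OF G(1)] primitive_on_subset[OF H(1)] H(2) assms(3,4)], of 0 1]
      assms G(2) by simp
  then have "((\<lambda>t. f (juxtapose u g h (frac t))) has_integral (u * G 1 + (1 - u) * H 1)) {0..1}"
  \<comment> \<open>At \<open>t = 1\<close> the fractional part is 0, so this point is
    exempted.\<close>
  proof (rule has_integral_spike_finite[of "{1}", rotated 2])
    fix t :: real assume "t \<in> {0..1} - {1}"
    then have "frac t = t" by (simp add: frac_eq)
    then show "f (juxtapose u g h (frac t)) = juxtapose u (\<lambda>t. f (g t)) (\<lambda>t. f (h t)) t"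
      by (simp add: juxtapose_def)
  qed simp
  then show ?thesis by (simp add: integral_unique 1)
qed

section \<open>Averages over intervals\<close>

lemma interval_endpoints:
  fixes J :: "real set"
  assumes "is_interval J" "bounded J" "interior J \<noteq> {}"
  obtains a b where "a < b" "{a<..<b} \<subseteq> J" "J \<subseteq> {a..b}"
proof -
  obtain c where "c \<in> interior J" using assms(3) by blast
  then obtain d where d: "0 < d" "cball c d \<subseteq> J" by (auto simp: mem_interior_cball)
  then have "c - d \<in> J" "c + d \<in> J" by (auto simp: subset_eq dist_real_def)
  have bb: "bdd_above J" "bdd_below J" using assms(2) by (auto intro: bounded_imp_bdd_above bounded_imp_bdd_below)
  have J: "Inf J \<le> y" "y \<le> Sup J" if "y \<in> J" for y using bb that by (auto intro: cInf_lower cSup_upper)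
  have "Inf J < Sup J" using J(1)[OF \<open>c - d \<in> J\<close>] J(2)[OF \<open>c + d \<in> J\<close>] d by linarith
  moreover have "{Inf J<..<Sup J} \<subseteq> J"
  proof
    fix y assume "y \<in> {Inf J<..<Sup J}"
    then have y: "Inf J < y" "y < Sup J" by auto
    have ne: "J \<noteq> {}" using \<open>c - d \<in> J\<close> by blast
    obtain u where "u \<in> J" "u < y" using y(1) cInf_less_iff[OF ne bb(2)] by blast
    moreover obtain v where "v \<in> J" "y < v" using y(2) less_cSup_iff[OF ne bb(1)] by blast
    ultimately show "y \<in> J" using mem_is_interval_1_I[OF assms(1)] by (meson less_imp_le)
  qed
  moreover have "J \<subseteq> {Inf J..Sup J}" using J by auto
  ultimately show ?thesis by (rule that)
qed

text \<open>\<open>J\<close> and \<open>{a..b}\<close> differ at most in the two endpoints, a null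
  set.\<close>

lemma average_interval:
  fixes \<phi> :: "real \<Rightarrow> 'a::euclidean_space"
  assumes ab: "a < b" "{a<..<b} \<subseteq> J" "J \<subseteq> {a..b}" and \<phi>: "set_integrable lebesgue {a..b} \<phi>"
  shows "average J \<phi> = (1 / (b - a)) *\<^sub>R integral {a..b} \<phi>"
proof -
  have J: "J = {a<..<b} \<union> (J \<inter> {a, b})" using ab by force
  have Jm: "J \<in> sets lebesgue"
  proof (subst J, rule sets.Un)
    show "J \<inter> {a, b} \<in> sets lebesgue" by (intro negligible_imp_sets negligible_finite) auto
  qed simp
  have "y \<in> J" if "y \<in> {a..b}" "y \<noteq> a" "y \<noteq> b" for y
  proof -
    have "y \<in> {a<..<b}" using that by simp
    then show ?thesis using ab(2) by blast
  qed
  then have "J - {a..b} \<union> ({a..b} - J) \<subseteq> {a, b}" using ab(3) by blast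
  then have sym: "negligible (J - {a..b} \<union> ({a..b} - J))"
    by (rule negligible_subset[rotated]) auto
  have "(LINT t:J|lebesgue. \<phi> t) = integral J \<phi>"
    by (rule set_lebesgue_integral_eq_integral(2)[OF set_integrable_subset[OF \<phi> Jm ab(3)]])
  also have "\<dots> = integral {a..b} \<phi>"
    by (rule integral_spike_set; rule negligible_subset[OF sym]) auto
  finally have 1: "(LINT t:J|lebesgue. \<phi> t) = integral {a..b} \<phi>" .
  have "measure lebesgue J = measure lebesgue {a..b}"
    by (rule measure_negligible_symdiff) (use sym in \<open>auto simp: Un_commute\<close>)
  also have "\<dots> = b - a" using ab(1) by simp
  finally show ?thesis by (simp add: average_def 1)
qed

lemma simple_fun_set_integrable:
  fixes g :: "real \<Rightarrow> 'b::euclidean_space"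
  assumes "simple_fun g" "S \<in> lmeasurable" shows "set_integrable lebesgue S g"
proof -
  have "bounded (range g)" using assms by (simp add: simple_fun_def finite_imp_bounded)
  then obtain C where C: "\<And>t. norm (g t) \<le> C" by (auto simp: bounded_iff)
  have m: "g \<in> borel_measurable lebesgue"
    using assms by (auto simp: simple_fun_def intro!: measurable_completion)
  have S: "S \<in> sets lebesgue" "emeasure lebesgue S < \<infinity>" using assms(2) by (auto simp: fmeasurable_def)
  show ?thesis unfolding set_integrable_def
  proof (rule Bochner_Integration.integrable_bound)
    show "integrable lebesgue (\<lambda>t. indicator S t *\<^sub>R C)" using S by (intro integrable_scaleR_left) auto
    show "AE t in lebesgue. norm (indicator S t *\<^sub>R g t) \<le> norm (indicator S t *\<^sub>R C)"
    proof (rule AE_I2)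
      fix t
      have "0 \<le> C" using C[of t] norm_ge_zero order_trans by blast
      then show "norm (indicator S t *\<^sub>R g t) \<le> norm (indicator S t *\<^sub>R C)"
        using C[of t] by (auto simp: indicator_def)
    qed
    show "(\<lambda>t. indicator S t *\<^sub>R g t) \<in> borel_measurable lebesgue"
      using m S by (intro borel_measurable_scaleR borel_measurable_indicator)
  qed
qed

lemma measure_circle: "measure lebesgue circle = 1"
  by simp

lemma lmeasurable_circle: "circle \<in> lmeasurable"
  by (simp add: fmeasurable_def)

lemma ext_average_circle_eq:
  assumes "set_integrable lebesgue circle h"
  shows "ext_average circle h = ereal (integral {0..1} h)"
proof -
  define H where "H t = indicator circle t *\<^sub>R h t" for t
  have H: "integrable lebesgue H" using assms by (simp add: set_integrable_def H_def[abs_def])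
  have pos: "(\<integral>\<^sup>+t\<in>circle. ennreal (h t) \<partial>lebesgue) = (\<integral>\<^sup>+t. ennreal (H t) \<partial>lebesgue)"
    by (intro nn_integral_cong) (auto simp: H_def indicator_def)
  have neg: "(\<integral>\<^sup>+t\<in>circle. ennreal (- h t) \<partial>lebesgue) = (\<integral>\<^sup>+t. ennreal (- H t) \<partial>lebesgue)"
    by (intro nn_integral_cong) (auto simp: H_def indicator_def)
  have fin: "(\<integral>\<^sup>+t. ennreal (H t) \<partial>lebesgue) \<noteq> \<infinity>" "(\<integral>\<^sup>+t. ennreal (- H t) \<partial>lebesgue) \<noteq> \<infinity>"
    using H by (auto simp: real_integrable_def)
  have e: "enn2ereal y = ereal (enn2real y)" if "y \<noteq> \<infinity>" for y
    using that by (cases y) auto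
  have "ext_average circle h = ereal (integral\<^sup>L lebesgue H)"
    unfolding ext_average_def pos neg e[OF fin(1)] e[OF fin(2)] measure_circle
    by (simp add: real_lebesgue_integral_def[OF H])
  also have "integral\<^sup>L lebesgue H = integral circle h"
    using set_lebesgue_integral_eq_integral(2)[OF assms] by (simp add: set_lebesgue_integral_def H_def[abs_def])
  also have "integral circle h = integral {0..1} h"
    by (rule integral_spike_set; rule negligible_subset[of "{1}"]) auto
  finally show ?thesis .
qed

section \<open>Chords of the annular domain\<close>

text \<open>The point is a limit of convex combinations of \<open>p\<close>, with weight tending to
  1, and points ever farther out on the given ray.\<close>

lemma closed_convex_recession:
  fixes C :: "'a::euclidean_space set"
  assumes C: "closed C" "convex C" and z: "\<And>t. 0 \<le> t \<Longrightarrow> z + t *\<^sub>R e \<in> C" and p: "p \<in> C" and t: "0 \<le> t"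
  shows "p + t *\<^sub>R e \<in> C"
proof -
  define y where "y n = (1 - inverse (real (Suc n))) *\<^sub>R p + inverse (real (Suc n)) *\<^sub>R (z + (real (Suc n) * t) *\<^sub>R e)" for n
  have "y n \<in> C" for n
    unfolding y_def by (rule convexD[OF C(2) p]) (use t in \<open>auto intro!: z simp: field_simps simp del: of_nat_Suc\<close>)
  moreover have eq: "y n = (p + t *\<^sub>R e) + inverse (real (Suc n)) *\<^sub>R (z - p)" for n
  proof -
    have "inverse (real (Suc n)) * (real (Suc n) * t) = t" by simp
    then have "inverse (real (Suc n)) *\<^sub>R ((real (Suc n) * t) *\<^sub>R e) = t *\<^sub>R e" by (metis scaleR_scaleR)
    then show ?thesis by (simp add: y_def algebra_simps)
  qed
  have "(\<lambda>n. (p + t *\<^sub>R e) + inverse (real (Suc n)) *\<^sub>R (z - p)) \<longlonglongrightarrow> (p + t *\<^sub>R e) + 0 *\<^sub>R (z - p)"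
    by (intro tendsto_add tendsto_scaleR tendsto_const LIMSEQ_inverse_real_of_nat)
  then have "y \<longlonglongrightarrow> (p + t *\<^sub>R e) + 0 *\<^sub>R (z - p)" by (simp only: eq[abs_def])
  ultimately show ?thesis using closed_sequentially[OF C(1)] by auto
qed

lemma mem_opposite_segment:
  fixes z d :: "'a::real_vector"
  assumes "0 \<le> \<alpha>" "0 \<le> \<gamma>" shows "z \<in> closed_segment (z + \<alpha> *\<^sub>R d) (z - \<gamma> *\<^sub>R d)"
proof (cases "\<alpha> + \<gamma> = 0")
  case True
  then have "\<alpha> = 0" using assms by auto
  then show ?thesis by simp
next
  case False
  then have ne: "0 < \<alpha> + \<gamma>" using assms by auto
  define u where "u = \<alpha> / (\<alpha> + \<gamma>)"
  have "u * (\<alpha> + \<gamma>) = \<alpha>" using ne by (simp add: u_def)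
  then have "(1 - u) * \<alpha> - u * \<gamma> = 0" by (simp add: algebra_simps)
  moreover have "(1 - u) *\<^sub>R (z + \<alpha> *\<^sub>R d) + u *\<^sub>R (z - \<gamma> *\<^sub>R d) = z + ((1 - u) * \<alpha> - u * \<gamma>) *\<^sub>R d"
    by (simp add: algebra_simps)
  ultimately have "z = (1 - u) *\<^sub>R (z + \<alpha> *\<^sub>R d) + u *\<^sub>R (z - \<gamma> *\<^sub>R d)" by simp
  moreover have "0 \<le> u" "u \<le> 1" using assms ne by (auto simp: u_def)
  ultimately show ?thesis unfolding in_segment by blast
qed

locale convex_annulus =
  fixes \<Omega>\<^sub>0 \<Omega>\<^sub>1 :: "'a::euclidean_space set"
  assumes dim: "2 \<le> DIM('a)"
    and ne0: "\<Omega>\<^sub>0 \<noteq> {}" and open0: "open \<Omega>\<^sub>0" and convex0: "convex \<Omega>\<^sub>0" and proper0: "\<Omega>\<^sub>0 \<noteq> UNIV"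
    and ne1: "\<Omega>\<^sub>1 \<noteq> {}" and convex1: "convex \<Omega>\<^sub>1"
    and nested: "closure \<Omega>\<^sub>1 \<subseteq> \<Omega>\<^sub>0"
    and strict: "no_segments (frontier \<Omega>\<^sub>0)"
    and cone: "cone_condition \<Omega>\<^sub>0 \<Omega>\<^sub>1"
begin

abbreviation annulus :: "'a set" where "annulus \<equiv> closure \<Omega>\<^sub>0 - closure \<Omega>\<^sub>1"

lemma convexC: "convex (closure \<Omega>\<^sub>0)" and convexK: "convex (closure \<Omega>\<^sub>1)"
  using convex0 convex1 by (auto intro: convex_closure)

lemma interior_closure0: "interior (closure \<Omega>\<^sub>0) = \<Omega>\<^sub>0"
  using convex_interior_closure[OF convex0] interior_open[OF open0] by simp

lemma frontier0: "frontier \<Omega>\<^sub>0 = closure \<Omega>\<^sub>0 - \<Omega>\<^sub>0"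
  by (metis frontier_def interior_eq open0)

lemma frontier_closure0: "frontier (closure \<Omega>\<^sub>0) = frontier \<Omega>\<^sub>0"
  by (simp only: frontier_def[of "closure \<Omega>\<^sub>0"] interior_closure0 frontier0 closure_closure)

lemma frontier_subset: "frontier \<Omega>\<^sub>0 \<subseteq> annulus"
  using frontier0 nested by auto

text \<open>If a supporting hyperplane at \<open>y\<close> met the closure in a second point, the
  whole segment between the two would lie in the frontier.\<close>

lemma strict_support:
  assumes "y \<in> frontier \<Omega>\<^sub>0"
  obtains \<nu> where "\<nu> \<noteq> 0" "\<forall>w\<in>closure \<Omega>\<^sub>0 - {y}. \<nu> \<bullet> y < \<nu> \<bullet> w"
proof -
  have ri: "rel_interior (closure \<Omega>\<^sub>0) = \<Omega>\<^sub>0"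
    using rel_interior_nonempty_interior[of "closure \<Omega>\<^sub>0"] ne0 by (simp add: interior_closure0)
  have y: "y \<in> closure \<Omega>\<^sub>0" "y \<notin> rel_interior (closure \<Omega>\<^sub>0)" using assms by (auto simp: frontier0 ri)
  obtain \<nu> where \<nu>: "\<nu> \<noteq> 0" and le: "\<And>w. w \<in> closure \<Omega>\<^sub>0 \<Longrightarrow> \<nu> \<bullet> y \<le> \<nu> \<bullet> w"
    and less: "\<And>w. w \<in> rel_interior (closure \<Omega>\<^sub>0) \<Longrightarrow> \<nu> \<bullet> y < \<nu> \<bullet> w"
    using supporting_hyperplane_rel_boundary[OF convexC y] by metis
  have "\<nu> \<bullet> y < \<nu> \<bullet> w" if w: "w \<in> closure \<Omega>\<^sub>0" "w \<noteq> y" for w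
  proof (rule ccontr)
    assume "\<not> ?thesis"
    then have eq: "\<nu> \<bullet> w = \<nu> \<bullet> y" using le[OF w(1)] by simp
    have "closed_segment y w \<subseteq> frontier \<Omega>\<^sub>0"
    proof
      fix s assume s: "s \<in> closed_segment y w"
      then obtain u where "s = (1 - u) *\<^sub>R y + u *\<^sub>R w" by (auto simp: in_segment)
      then have "\<nu> \<bullet> s = (1 - u) * (\<nu> \<bullet> y) + u * (\<nu> \<bullet> w)" by (simp add: inner_add_right)
      then have "\<nu> \<bullet> s = \<nu> \<bullet> y" using eq by (simp add: algebra_simps)
      then have "s \<notin> \<Omega>\<^sub>0" using less[of s] ri by auto
      moreover have "s \<in> closure \<Omega>\<^sub>0" using closed_segment_subset[OF y(1) w(1) convexC] s by blast
      ultimately show "s \<in> frontier \<Omega>\<^sub>0" by (simp add: frontier0)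
    qed
    then show False using strict w(2) unfolding no_segments_def by metis
  qed
  then show ?thesis using that[OF \<nu>] by auto
qed

text \<open>A frontier point is the unique minimizer of a linear functional over the closure, so it
  is interior to no segment; any other point of the annulus has a ball around it in the annulus and
  is the midpoint of a short segment.\<close>

lemma fixed_boundary_annulus: "fixed_boundary annulus = frontier \<Omega>\<^sub>0"
proof
  show "fixed_boundary annulus \<subseteq> frontier \<Omega>\<^sub>0"
  proof
    fix x assume x: "x \<in> fixed_boundary annulus"
    then have xa: "x \<in> annulus" by (simp add: fixed_boundary_def)
    show "x \<in> frontier \<Omega>\<^sub>0"
    proof (rule ccontr)
      assume "x \<notin> frontier \<Omega>\<^sub>0"
      then have "x \<in> \<Omega>\<^sub>0 - closure \<Omega>\<^sub>1" using xa by (simp add: frontier0)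
      moreover have "open (\<Omega>\<^sub>0 - closure \<Omega>\<^sub>1)" using open0 by (simp add: open_Diff)
      ultimately obtain d where d: "0 < d" "cball x d \<subseteq> \<Omega>\<^sub>0 - closure \<Omega>\<^sub>1" by (meson open_contains_cball)
      obtain i :: 'a where i: "i \<in> Basis" using nonempty_Basis by blast
      let ?a = "x - d *\<^sub>R i" and ?b = "x + d *\<^sub>R i"
      have "?a \<in> cball x d" "?b \<in> cball x d" using d i by (auto simp: dist_norm)
      then have "closed_segment ?a ?b \<subseteq> cball x d" by (simp add: closed_segment_subset)
      then have "closed_segment ?a ?b \<subseteq> annulus" using d closure_subset by blast
      moreover have "x \<in> open_segment ?a ?b"
      proof -
        have "x = midpoint ?a ?b" by (simp add: midpoint_def algebra_simps flip: scaleR_2)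
        moreover have eq: "?b - ?a = (2 * d) *\<^sub>R i" by (simp add: algebra_simps flip: scaleR_2)
        have "?b - ?a \<noteq> 0" unfolding eq using d i by auto
        then have "?a \<noteq> ?b" by (metis right_minus_eq)
        ultimately show ?thesis by (metis midpoint_in_open_segment)
      qed
      ultimately show False using x by (auto simp: fixed_boundary_def)
    qed
  qed
  show "frontier \<Omega>\<^sub>0 \<subseteq> fixed_boundary annulus"
  proof
    fix x assume x: "x \<in> frontier \<Omega>\<^sub>0"
    obtain \<nu> where \<nu>: "\<forall>w\<in>closure \<Omega>\<^sub>0 - {x}. \<nu> \<bullet> x < \<nu> \<bullet> w" using strict_support[OF x] by metis
    have False if ab: "closed_segment a b \<subseteq> annulus" "x \<in> open_segment a b" for a b
    proof -
      have "a \<in> closure \<Omega>\<^sub>0 - {x}" "b \<in> closure \<Omega>\<^sub>0 - {x}" using ab ends_in_segment[of a b] by (auto simp: open_segment_def)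
      then have "\<nu> \<bullet> x < \<nu> \<bullet> a" "\<nu> \<bullet> x < \<nu> \<bullet> b" using \<nu> by auto
      moreover obtain u where u: "0 < u" "u < 1" "x = (1 - u) *\<^sub>R a + u *\<^sub>R b" using ab(2) by (auto simp: in_segment)
      ultimately have "(1 - u) * (\<nu> \<bullet> x) + u * (\<nu> \<bullet> x) < (1 - u) * (\<nu> \<bullet> a) + u * (\<nu> \<bullet> b)"
        by (intro add_strict_mono mult_strict_left_mono) auto
      then show False using u(3) by (simp add: inner_add_right algebra_simps)
    qed
    then show "x \<in> fixed_boundary annulus" using x frontier_subset by (auto simp: fixed_boundary_def)
  qed
qed

section \<open>Chords through points of the annulus\<close>

lemma exit_point:
  assumes "z \<in> closure \<Omega>\<^sub>0" "w \<notin> closure \<Omega>\<^sub>0"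
  shows "\<exists>p\<in>frontier \<Omega>\<^sub>0. p \<in> closed_segment z w"
  using connected_Int_frontier[of "closed_segment z w" "closure \<Omega>\<^sub>0"] assms ends_in_segment[of z w]
  unfolding frontier_closure0 by blast

text \<open>A line would make \<open>e\<close> and \<open>- e\<close> recession directions at every
  point, including a frontier point \<open>p\<close>; a strict support at \<open>p\<close> prevents
  \<open>p + e\<close> and \<open>p - e\<close> from both belonging to the closure.\<close>

lemma no_line:
  assumes e: "e \<noteq> 0"
  shows "\<exists>t. z + t *\<^sub>R e \<notin> closure \<Omega>\<^sub>0"
proof (rule ccontr)
  assume "\<not> ?thesis"
  then have l: "z + t *\<^sub>R e \<in> closure \<Omega>\<^sub>0" for t by blast
  have "frontier \<Omega>\<^sub>0 \<noteq> {}" using frontier_eq_empty ne0 proper0 by blast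
  then obtain p where p: "p \<in> frontier \<Omega>\<^sub>0" by blast
  then have pC: "p \<in> closure \<Omega>\<^sub>0" by (simp add: frontier0)
  obtain \<nu> where \<nu>: "\<forall>w\<in>closure \<Omega>\<^sub>0 - {p}. \<nu> \<bullet> p < \<nu> \<bullet> w" using strict_support[OF p] by metis
  have "p + 1 *\<^sub>R e \<in> closure \<Omega>\<^sub>0"
    by (rule closed_convex_recession[OF _ convexC _ pC, of z]) (use l in auto)
  moreover have "p + 1 *\<^sub>R (- e) \<in> closure \<Omega>\<^sub>0"
    by (rule closed_convex_recession[OF _ convexC _ pC, of z]) (use l[of "- t" for t] in auto)
  ultimately have "\<nu> \<bullet> p < \<nu> \<bullet> (p + e)" "\<nu> \<bullet> p < \<nu> \<bullet> (p - e)" using \<nu> e by auto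
  then show False by (simp add: inner_add_right inner_diff_right)
qed

text \<open>Each point of the ray is the midpoint of the interior point \<open>z\<close> and a point
  of the closure twice as far away.\<close>

lemma ray_inside:
  assumes z: "z \<in> \<Omega>\<^sub>0" and C: "\<And>t. 0 \<le> t \<Longrightarrow> z + t *\<^sub>R e \<in> closure \<Omega>\<^sub>0"
  shows "ray z e \<subseteq> \<Omega>\<^sub>0"
proof
  fix y assume "y \<in> ray z e"
  then obtain t where t: "0 \<le> t" "y = z + t *\<^sub>R e" by (auto simp: ray_def)
  have "z \<in> interior \<Omega>\<^sub>0" using z open0 by (simp add: interior_open)
  from in_interior_closure_convex_segment[OF convex0 this C[of "2 * t"]] t open0
  have seg: "open_segment z (z + (2 * t) *\<^sub>R e) \<subseteq> \<Omega>\<^sub>0" by (simp add: interior_open)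
  show "y \<in> \<Omega>\<^sub>0"
  proof (cases "t *\<^sub>R e = 0")
    case True then show ?thesis using z t(2) by (simp del: scaleR_eq_0_iff)
  next
    case False
    have "y = midpoint z (z + (2 * t) *\<^sub>R e)" using t by (simp add: midpoint_def algebra_simps flip: scaleR_2)
    moreover have "z \<noteq> z + (2 * t) *\<^sub>R e" using False by auto
    ultimately show ?thesis using seg midpoint_in_open_segment by blast
  qed
qed

text \<open>
  The chord runs along a hyperplane separating \<open>z\<close> from \<open>closure \<Omega>\<^sub>1\<close>, tilted slightly: a direction with
  negative inner product with \<open>\<nu>\<close> cannot be a recession direction of \<open>\<Omega>\<^sub>0\<close>, for otherwise the cone
  condition would place a ray with this direction inside \<open>\<Omega>\<^sub>1\<close>.
\<close>
lemma chord:
  assumes z: "z \<in> annulus"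
  obtains p q where "p \<in> frontier \<Omega>\<^sub>0" "q \<in> frontier \<Omega>\<^sub>0" "z \<in> closed_segment p q" "closed_segment p q \<subseteq> annulus"
proof (cases "z \<in> \<Omega>\<^sub>0")
  case False
  then have "z \<in> frontier \<Omega>\<^sub>0" using z by (simp add: frontier0)
  then show ?thesis using that[of z z] z by simp
next
  case True
  have zC: "z \<in> closure \<Omega>\<^sub>0" using z by simp
  obtain \<nu> \<beta> where \<nu>: "\<nu> \<bullet> z < \<beta>" "\<forall>k\<in>closure \<Omega>\<^sub>1. \<beta> < \<nu> \<bullet> k"
    using separating_hyperplane_closed_point[OF convexK, of z] z by auto
  have \<nu>0: "\<nu> \<noteq> 0"
  proof
    assume "\<nu> = 0"
    moreover obtain k where "k \<in> \<Omega>\<^sub>1" using ne1 by blast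
    then have "k \<in> closure \<Omega>\<^sub>1" using closure_subset by blast
    ultimately show False using \<nu> by force
  qed
  obtain e0 where e0: "e0 \<noteq> 0" "\<nu> \<bullet> e0 = 0"
    using orthogonal_to_vector_exists[OF dim, of \<nu>] by (auto simp: orthogonal_def)
  obtain t0 where t0: "z + t0 *\<^sub>R e0 \<notin> closure \<Omega>\<^sub>0" using no_line[OF e0(1)] by blast
  have "t0 \<noteq> 0" using t0 zC by auto
  define T where "T = \<bar>t0\<bar>"
  \<comment> \<open>Oriented so that the ray from \<open>z\<close> is outside the closure at the
    positive parameter \<open>T\<close>; by openness of the complement, \<open>T\<close> also works
    for nearby directions.\<close>
  define e where "e = sgn t0 *\<^sub>R e0"
  have T: "0 < T" using \<open>t0 \<noteq> 0\<close> by (simp add: T_def)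
  have eT: "z + T *\<^sub>R e \<notin> closure \<Omega>\<^sub>0" using t0 by (simp add: e_def T_def abs_mult_sgn)
  have \<nu>e: "\<nu> \<bullet> e = 0" using e0 by (simp add: e_def)
  \<comment> \<open>The tilt is so small that the point at parameter \<open>T\<close> is still
    outside the closure and \<open>\<nu>\<close> remains below \<open>\<beta>\<close> up to
    there.\<close>
  obtain s where s: "0 < s" "z + T *\<^sub>R (e + s *\<^sub>R \<nu>) \<notin> closure \<Omega>\<^sub>0" "\<nu> \<bullet> z + T * (s * (\<nu> \<bullet> \<nu>)) < \<beta>"
  proof -
    have "((\<lambda>s. z + T *\<^sub>R (e + s *\<^sub>R \<nu>)) \<longlongrightarrow> z + T *\<^sub>R (e + 0 *\<^sub>R \<nu>)) (at_right 0)"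
      by (intro tendsto_intros)
    then have 1: "\<forall>\<^sub>F s in at_right 0. z + T *\<^sub>R (e + s *\<^sub>R \<nu>) \<in> - closure \<Omega>\<^sub>0"
      by (rule topological_tendstoD) (use eT in auto)
    have "((\<lambda>s. \<nu> \<bullet> z + T * (s * (\<nu> \<bullet> \<nu>))) \<longlongrightarrow> \<nu> \<bullet> z + T * (0 * (\<nu> \<bullet> \<nu>))) (at_right 0)"
      by (intro tendsto_intros)
    then have 2: "\<forall>\<^sub>F s in at_right 0. \<nu> \<bullet> z + T * (s * (\<nu> \<bullet> \<nu>)) < \<beta>"
      by (rule order_tendstoD) (use \<nu> in auto)
    have 3: "\<forall>\<^sub>F s::real in at_right 0. 0 < s" by (simp add: eventually_at_right_less)
    have "\<forall>\<^sub>F s in at_right 0. 0 < s \<and> z + T *\<^sub>R (e + s *\<^sub>R \<nu>) \<notin> closure \<Omega>\<^sub>0 \<and> \<nu> \<bullet> z + T * (s * (\<nu> \<bullet> \<nu>)) < \<beta>"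
      using 1 2 3 by eventually_elim auto
    then show ?thesis using that eventually_happens'[OF trivial_limit_at_right_real] by blast
  qed
  define d where "d = e + s *\<^sub>R \<nu>"
  have \<nu>d: "\<nu> \<bullet> d = s * (\<nu> \<bullet> \<nu>)" by (simp add: d_def inner_add_right \<nu>e)
  have pos: "0 < s * (\<nu> \<bullet> \<nu>)" using s(1) \<nu>0 by simp
  have d0: "d \<noteq> 0" using \<nu>d pos by auto
  obtain p where p: "p \<in> frontier \<Omega>\<^sub>0" "p \<in> closed_segment z (z + T *\<^sub>R d)"
    using exit_point[OF zC, of "z + T *\<^sub>R d"] s(2) by (auto simp: d_def)
  have "\<exists>t\<ge>0. z + t *\<^sub>R (- d) \<notin> closure \<Omega>\<^sub>0"
  proof (rule ccontr)
    assume "\<not> ?thesis"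
    then have "ray z (- d) \<subseteq> \<Omega>\<^sub>0" using ray_inside[OF True] by blast
    then obtain w where w: "(+) w ` ray z (- d) \<subseteq> \<Omega>\<^sub>1"
      using cone[unfolded cone_condition_def, rule_format, of "- d" z] d0 by auto
    have in1: "w + (z + t *\<^sub>R (- d)) \<in> closure \<Omega>\<^sub>1" if "0 \<le> t" for t
    proof -
      have "z + t *\<^sub>R (- d) \<in> ray z (- d)" using that unfolding ray_def by blast
      then show ?thesis using w closure_subset by blast
    qed
    \<comment> \<open>Far enough along the translated ray for \<open>\<nu>\<close> to drop to
      \<open>\<beta>\<close> or below, which is impossible on
      \<open>closure \<Omega>\<^sub>1\<close>.\<close>
    define t where "t = \<bar>\<nu> \<bullet> (w + z) - \<beta>\<bar> / (s * (\<nu> \<bullet> \<nu>))"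
    have "0 \<le> t" using pos by (simp add: t_def)
    from in1[OF this] have "\<beta> < \<nu> \<bullet> (w + (z + t *\<^sub>R (- d)))" using \<nu> by blast
    also have "\<dots> = \<nu> \<bullet> (w + z) - t * (s * (\<nu> \<bullet> \<nu>))" by (simp add: inner_add_right inner_diff_right \<nu>d)
    also have "t * (s * (\<nu> \<bullet> \<nu>)) = \<bar>\<nu> \<bullet> (w + z) - \<beta>\<bar>"
      using pos unfolding t_def by (metis less_irrefl nonzero_eq_divide_eq)
    finally show False by linarith
  qed
  then obtain t1 where t1: "0 \<le> t1" "z + t1 *\<^sub>R (- d) \<notin> closure \<Omega>\<^sub>0" by blast
  obtain q where q: "q \<in> frontier \<Omega>\<^sub>0" "q \<in> closed_segment z (z + t1 *\<^sub>R (- d))"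
    using exit_point[OF zC t1(2)] by blast
  obtain a where a: "0 \<le> a" "a \<le> 1" "p = (1 - a) *\<^sub>R z + a *\<^sub>R (z + T *\<^sub>R d)" using p(2) by (auto simp: in_segment)
  obtain b where b: "0 \<le> b" "b \<le> 1" "q = (1 - b) *\<^sub>R z + b *\<^sub>R (z + t1 *\<^sub>R (- d))" using q(2) by (auto simp: in_segment)
  define \<alpha> where "\<alpha> = a * T"
  define \<gamma> where "\<gamma> = b * t1"
  have pq: "p = z + \<alpha> *\<^sub>R d" "q = z - \<gamma> *\<^sub>R d" using a b by (simp_all add: \<alpha>_def \<gamma>_def algebra_simps)
  have ag: "0 \<le> \<alpha>" "\<alpha> \<le> T" "0 \<le> \<gamma>"
    using a b T t1 mult_right_mono[of a 1 T] by (auto simp: \<alpha>_def \<gamma>_def)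
  have "z \<in> closed_segment p q" unfolding pq by (rule mem_opposite_segment[OF ag(1,3)])
  moreover have "closed_segment p q \<subseteq> annulus"
  proof
    fix y assume y: "y \<in> closed_segment p q"
    have "p \<in> closure \<Omega>\<^sub>0" "q \<in> closure \<Omega>\<^sub>0" using p q by (auto simp: frontier0)
    then have "y \<in> closure \<Omega>\<^sub>0" using closed_segment_subset[OF _ _ convexC] y by blast
    moreover have "\<nu> \<bullet> y < \<beta>"
    proof -
      have "\<alpha> * (s * (\<nu> \<bullet> \<nu>)) \<le> T * (s * (\<nu> \<bullet> \<nu>))" using ag pos by (intro mult_right_mono) auto
      then have "\<nu> \<bullet> p < \<beta>" using s(3) by (simp add: pq inner_add_right \<nu>d)
      moreover have "0 \<le> \<gamma> * (s * (\<nu> \<bullet> \<nu>))" using ag pos by simp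
      then have "\<nu> \<bullet> q < \<beta>" using \<nu>(1) by (simp add: pq inner_diff_right \<nu>d)
      ultimately have "p \<in> {y. \<nu> \<bullet> y < \<beta>}" "q \<in> {y. \<nu> \<bullet> y < \<beta>}" by auto
      from closed_segment_subset[OF this convex_halfspace_lt] y show ?thesis by blast
    qed
    ultimately show "y \<in> annulus" using \<nu>(2) by force
  qed
  ultimately show ?thesis using that p q by blast
qed

text \<open>\<open>\<nu>\<close> is constant along the line, whereas it exceeds
  \<open>\<nu> \<bullet> z\<close> on the part of the sphere inside the closure; hence the line
  cannot cross the sphere before leaving the closure.\<close>

lemma short_chord_exit:
  assumes z: "z \<in> closure \<Omega>\<^sub>0" "z \<in> ball y \<rho>" and h: "\<And>w. w \<in> sphere y \<rho> \<inter> closure \<Omega>\<^sub>0 \<Longrightarrow> \<nu> \<bullet> z < \<nu> \<bullet> w"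
    and e: "e \<noteq> 0" "\<nu> \<bullet> e = 0"
  obtains t where "0 \<le> t" "z + t *\<^sub>R e \<in> frontier \<Omega>\<^sub>0 \<inter> ball y \<rho>"
proof -
  have \<rho>: "0 < \<rho>" using z(2) zero_le_dist[of y z] by (simp del: zero_le_dist)
  have stay: "z + t *\<^sub>R e \<in> ball y \<rho>" if t: "z + t *\<^sub>R e \<in> closure \<Omega>\<^sub>0" for t
  proof (rule ccontr)
    assume "z + t *\<^sub>R e \<notin> ball y \<rho>"
    then have "closed_segment z (z + t *\<^sub>R e) \<inter> frontier (ball y \<rho>) \<noteq> {}"
      using z(2) ends_in_segment[of z "z + t *\<^sub>R e"] by (intro connected_Int_frontier) auto
    then obtain w where w: "w \<in> closed_segment z (z + t *\<^sub>R e)" "w \<in> sphere y \<rho>"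
      unfolding frontier_ball[OF \<rho>, of y] by blast
    then have "w \<in> closure \<Omega>\<^sub>0" using closed_segment_subset[OF z(1) t convexC] by blast
    moreover obtain u where "w = (1 - u) *\<^sub>R z + u *\<^sub>R (z + t *\<^sub>R e)" using w(1) by (auto simp: in_segment)
    then have "\<nu> \<bullet> w = \<nu> \<bullet> z" using e by (simp add: inner_add_right algebra_simps)
    ultimately show False using h[of w] w(2) by auto
  qed
  \<comment> \<open>The diameter of the ball in units of \<open>e\<close>: at this parameter the
    line has left the ball.\<close>
  define T where "T = 2 * \<rho> / norm e"
  have T: "0 \<le> T" using \<rho> by (simp add: T_def)
  have "z + T *\<^sub>R e \<notin> ball y \<rho>"
  proof
    assume "z + T *\<^sub>R e \<in> ball y \<rho>"
    then have "dist z (z + T *\<^sub>R e) < 2 * \<rho>" using z(2) dist_triangle[of z "z + T *\<^sub>R e" y] by (simp add: dist_commute)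
    then show False using \<rho> e by (simp add: dist_norm T_def)
  qed
  then have "z + T *\<^sub>R e \<notin> closure \<Omega>\<^sub>0" using stay by blast
  from exit_point[OF z(1) this] obtain p where p: "p \<in> frontier \<Omega>\<^sub>0" "p \<in> closed_segment z (z + T *\<^sub>R e)" by blast
  then obtain u where u: "0 \<le> u" "u \<le> 1" "p = (1 - u) *\<^sub>R z + u *\<^sub>R (z + T *\<^sub>R e)" by (auto simp: in_segment)
  then have "p = z + (u * T) *\<^sub>R e" by (simp add: algebra_simps)
  moreover have "p \<in> closure \<Omega>\<^sub>0" using p(1) by (simp add: frontier0)
  ultimately show ?thesis using that[of "u * T"] stay[of "u * T"] p(1) u T by simp
qed

text \<open>Strict convexity makes caps small: by compactness the supporting functional exceeds its
  value at \<open>y\<close> by some \<open>h\<close> on the sphere, so a line through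
  \<open>z\<close> parallel to the supporting hyperplane, with \<open>z\<close> close to
  \<open>y\<close>, leaves the closure inside the ball in both directions. This controls locally
  concave majorants near the frontier.\<close>

lemma short_chord:
  assumes y: "y \<in> frontier \<Omega>\<^sub>0" and \<rho>: "0 < \<rho>"
  obtains \<eta> where "0 < \<eta>" "\<forall>z\<in>closure \<Omega>\<^sub>0 \<inter> ball y \<eta>. \<exists>p\<in>frontier \<Omega>\<^sub>0 \<inter> ball y \<rho>. \<exists>q\<in>frontier \<Omega>\<^sub>0 \<inter> ball y \<rho>.
     z \<in> closed_segment p q \<and> closed_segment p q \<subseteq> annulus"
proof -
  obtain \<nu> where \<nu>: "\<forall>w\<in>closure \<Omega>\<^sub>0 - {y}. \<nu> \<bullet> y < \<nu> \<bullet> w" using strict_support[OF y] by metis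
  have "y \<in> - closure \<Omega>\<^sub>1" using y frontier_subset by auto
  then obtain r0 where r0: "0 < r0" "ball y r0 \<subseteq> - closure \<Omega>\<^sub>1"
    using openE[of "- closure \<Omega>\<^sub>1" y] by auto
  define r where "r = min r0 \<rho>"
  have r: "0 < r" "r \<le> \<rho>" "ball y r \<subseteq> - closure \<Omega>\<^sub>1" using r0 \<rho> by (auto simp: r_def)
  define S where "S = sphere y r \<inter> closure \<Omega>\<^sub>0"
  have "compact S" unfolding S_def by (intro compact_Int_closed) auto
  have "\<exists>h>0. \<forall>w\<in>S. \<nu> \<bullet> y + h \<le> \<nu> \<bullet> w"
  proof (cases "S = {}")
    case False
    have "continuous_on S (\<lambda>w. \<nu> \<bullet> w)" by (intro continuous_intros)
    from continuous_attains_inf[OF \<open>compact S\<close> False this]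
    obtain w0 where w0: "w0 \<in> S" "\<forall>w\<in>S. \<nu> \<bullet> w0 \<le> \<nu> \<bullet> w" by blast
    have "w0 \<in> closure \<Omega>\<^sub>0 - {y}" using w0(1) r by (auto simp: S_def)
    then have "0 < \<nu> \<bullet> w0 - \<nu> \<bullet> y" using \<nu> by auto
    then show ?thesis using w0(2) by (intro exI[of _ "\<nu> \<bullet> w0 - \<nu> \<bullet> y"]) auto
  qed (auto intro: exI[of _ 1])
  then obtain h where h: "0 < h" "\<And>w. w \<in> S \<Longrightarrow> \<nu> \<bullet> y + h \<le> \<nu> \<bullet> w" by blast
  obtain e where e: "e \<noteq> 0" "\<nu> \<bullet> e = 0"
    using orthogonal_to_vector_exists[OF dim, of \<nu>] by (auto simp: orthogonal_def)
  \<comment> \<open>By Cauchy-Schwarz, \<open>norm (z - y) < h / (norm \<nu> + 1)\<close> gives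
    \<open>\<nu> \<bullet> z < \<nu> \<bullet> y + h\<close>.\<close>
  define \<eta> where "\<eta> = min r (h / (norm \<nu> + 1))"
  have n1: "0 < norm \<nu> + 1" by (simp add: add_nonneg_pos)
  have "0 < \<eta>" using r h n1 by (simp add: \<eta>_def)
  moreover have "\<exists>p\<in>frontier \<Omega>\<^sub>0 \<inter> ball y \<rho>. \<exists>q\<in>frontier \<Omega>\<^sub>0 \<inter> ball y \<rho>.
     z \<in> closed_segment p q \<and> closed_segment p q \<subseteq> annulus" if z: "z \<in> closure \<Omega>\<^sub>0 \<inter> ball y \<eta>" for z
  proof -
    have zr: "z \<in> closure \<Omega>\<^sub>0" "z \<in> ball y r" using z by (auto simp: \<eta>_def)
    have "\<nu> \<bullet> z - \<nu> \<bullet> y \<le> norm \<nu> * norm (z - y)"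
      using norm_cauchy_schwarz[of \<nu> "z - y"] by (simp add: inner_diff_right)
    also have "\<dots> \<le> (norm \<nu> + 1) * norm (z - y)" by (intro mult_right_mono) auto
    also have "\<dots> < (norm \<nu> + 1) * (h / (norm \<nu> + 1))"
      using z n1 by (intro mult_strict_left_mono) (auto simp: \<eta>_def dist_norm norm_minus_commute)
    also have "\<dots> = h" using n1 by simp
    finally have less: "\<nu> \<bullet> z < \<nu> \<bullet> w" if "w \<in> sphere y r \<inter> closure \<Omega>\<^sub>0" for w
      using h(2)[of w] that by (simp add: S_def)
    obtain t where t: "0 \<le> t" "z + t *\<^sub>R e \<in> frontier \<Omega>\<^sub>0 \<inter> ball y r"
      using short_chord_exit[OF zr less e] by blast
    obtain t' where t': "0 \<le> t'" "z + t' *\<^sub>R (- e) \<in> frontier \<Omega>\<^sub>0 \<inter> ball y r"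
      using short_chord_exit[OF zr less, of "- e"] e by auto
    let ?p = "z + t *\<^sub>R e" and ?q = "z + t' *\<^sub>R (- e)"
    have seg: "z \<in> closed_segment ?p ?q" using mem_opposite_segment[OF t(1) t'(1), of z e] by simp
    have "?p \<in> closure \<Omega>\<^sub>0" "?q \<in> closure \<Omega>\<^sub>0" using t t' by (auto simp: frontier0)
    then have "closed_segment ?p ?q \<subseteq> closure \<Omega>\<^sub>0" by (rule closed_segment_subset[OF _ _ convexC])
    moreover have "closed_segment ?p ?q \<subseteq> ball y r" using t t' by (intro closed_segment_subset) auto
    ultimately have "closed_segment ?p ?q \<subseteq> annulus" using r(3) by blast
    moreover have "?p \<in> frontier \<Omega>\<^sub>0 \<inter> ball y \<rho>" "?q \<in> frontier \<Omega>\<^sub>0 \<inter> ball y \<rho>" using t t' r(2) by auto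
    ultimately show ?thesis using seg by blast
  qed
  ultimately show ?thesis using that by blast
qed

lemma separating_open:
  obtains V where "open V" "closure \<Omega>\<^sub>1 \<subseteq> V" "closure V \<subseteq> \<Omega>\<^sub>0"
proof -
  have "closed (- \<Omega>\<^sub>0)" "closure \<Omega>\<^sub>1 \<inter> - \<Omega>\<^sub>0 = {}" using open0 nested by auto
  then obtain U W where UW: "open U" "open W" "closure \<Omega>\<^sub>1 \<subseteq> U" "- \<Omega>\<^sub>0 \<subseteq> W" "U \<inter> W = {}"
    using separation_normal[of "closure \<Omega>\<^sub>1" "- \<Omega>\<^sub>0"] by (metis closed_closure)
  have "closure U \<subseteq> - W" using UW by (intro closure_minimal) auto
  then show ?thesis using that UW by blast
qed

end

section \<open>The lower bound\<close>

lemma positive_separation: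
  fixes S K :: "'a::euclidean_space set"
  assumes "compact S" "closed K" "K \<noteq> {}" "S \<inter> K = {}"
  obtains \<delta> where "0 < \<delta>" "\<forall>y\<in>S. \<delta> \<le> infdist y K"
proof -
  obtain d where d: "0 < d" "\<And>x y. x \<in> S \<Longrightarrow> y \<in> K \<Longrightarrow> d \<le> dist x y"
    using separate_compact_closed[OF assms(1,2,4)] by metis
  have "d \<le> infdist y K" if "y \<in> S" for y
    unfolding infdist_notempty[OF assms(3)] using d(2)[OF that] assms(3) by (intro cINF_greatest) auto
  then show ?thesis using that d(1) by blast
qed

lemma train_mono: "train K \<delta> x \<phi> P \<Longrightarrow> \<delta>' \<le> \<delta> \<Longrightarrow> train K \<delta>' x \<phi> P"
  unfolding train_def by (meson order_trans)

context convex_annulus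
begin

text \<open>The distance \<open>\<delta>\<close> may depend on the function. It shrinks with each
  concave combination, but each combination involves only two functions.\<close>

definition nice :: "'a \<Rightarrow> (real \<Rightarrow> 'a) \<Rightarrow> bool" where
  "nice x \<phi> \<longleftrightarrow> range \<phi> \<subseteq> frontier \<Omega>\<^sub>0 \<and> (\<exists>\<delta>>0. \<exists>P. train (closure \<Omega>\<^sub>1) \<delta> x \<phi> P)"

lemma niceE:
  assumes "nice x \<phi>"
  obtains \<delta> P where "0 < \<delta>" "train (closure \<Omega>\<^sub>1) \<delta> x \<phi> P" "range \<phi> \<subseteq> frontier \<Omega>\<^sub>0"
  using assms by (auto simp: nice_def)

lemma segment_separation:
  assumes "closed_segment a b \<subseteq> annulus"
  obtains \<delta> where "0 < \<delta>" "\<forall>y\<in>closed_segment a b. \<delta> \<le> infdist y (closure \<Omega>\<^sub>1)"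
  using positive_separation[of "closed_segment a b" "closure \<Omega>\<^sub>1"] assms ne1 by auto

lemma nice_const:
  assumes "p \<in> frontier \<Omega>\<^sub>0" shows "nice p (\<lambda>_. p)"
proof -
  have "closed_segment p p \<subseteq> annulus" using assms frontier_subset by auto
  then obtain \<delta> where "0 < \<delta>" "\<delta> \<le> infdist p (closure \<Omega>\<^sub>1)" using segment_separation[of p p] by auto
  moreover have "primitive_on UNIV (\<lambda>t. p - p) (\<lambda>t. 0)" by (simp add: primitive_on_def)
  ultimately have "train (closure \<Omega>\<^sub>1) \<delta> p (\<lambda>_. p) (\<lambda>_. 0)" by (simp add: train_def simple_fun_def)
  then show ?thesis using assms \<open>0 < \<delta>\<close> by (auto simp: nice_def)
qed

text \<open>\<open>\<delta>\<close> is fixed before \<open>\<delta>'\<close> and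
  \<open>\<epsilon>\<close>, so that the blocks for both endpoints of a segment can be built with
  common parameters; the bound \<open>\<delta>0\<close> lets the two choices be chained.\<close>

lemma nice_block:
  fixes f :: "'a \<Rightarrow> real"
  assumes "nice a \<phi>" "a \<in> annulus" "0 < \<delta>0" "0 < \<eta>"
  obtains \<delta> where "0 < \<delta>" "\<delta> \<le> \<delta>0"
    "\<forall>\<epsilon>>0. \<forall>\<delta>'. 0 < \<delta>' \<and> \<delta>' \<le> \<delta> \<and> 4 * \<epsilon> \<le> \<delta>' \<longrightarrow> (\<exists>g A. flat_block (closure \<Omega>\<^sub>1) (\<delta>' / 2) \<epsilon> a g A \<and>
        range g \<subseteq> frontier \<Omega>\<^sub>0 \<and> integral {0..1} (\<lambda>t. f (\<phi> t)) - \<eta> \<le> integral {0..1} (\<lambda>t. f (g t)))"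
proof -
  obtain \<delta>1 P where 1: "0 < \<delta>1" "train (closure \<Omega>\<^sub>1) \<delta>1 a \<phi> P" "range \<phi> \<subseteq> frontier \<Omega>\<^sub>0"
    using assms(1) by (rule niceE)
  obtain p q where pq: "p \<in> frontier \<Omega>\<^sub>0" "q \<in> frontier \<Omega>\<^sub>0" "a \<in> closed_segment p q" "closed_segment p q \<subseteq> annulus"
    using chord[OF assms(2)] .
  obtain \<delta>2 where 2: "0 < \<delta>2" "\<forall>y\<in>closed_segment p q. \<delta>2 \<le> infdist y (closure \<Omega>\<^sub>1)"
    using segment_separation[OF pq(4)] .
  define \<delta> where "\<delta> = min \<delta>0 (min \<delta>1 \<delta>2)"
  show ?thesis
  proof (rule that[of \<delta>])
    show "\<forall>\<epsilon>>0. \<forall>\<delta>'. 0 < \<delta>' \<and> \<delta>' \<le> \<delta> \<and> 4 * \<epsilon> \<le> \<delta>' \<longrightarrow> (\<exists>g A. flat_block (closure \<Omega>\<^sub>1) (\<delta>' / 2) \<epsilon> a g A \<and>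
        range g \<subseteq> frontier \<Omega>\<^sub>0 \<and> integral {0..1} (\<lambda>t. f (\<phi> t)) - \<eta> \<le> integral {0..1} (\<lambda>t. f (g t)))"
    proof (intro allI impI)
      fix \<epsilon> \<delta>' :: real assume e: "0 < \<epsilon>" and d: "0 < \<delta>' \<and> \<delta>' \<le> \<delta> \<and> 4 * \<epsilon> \<le> \<delta>'"
      have "\<delta>' \<le> infdist y (closure \<Omega>\<^sub>1)" if "y \<in> closed_segment p q" for y
        using 2(2) that d by (force simp: \<delta>_def)
      from chord_block[OF this pq(3) e] obtain w W where
        w: "flat_block (closure \<Omega>\<^sub>1) \<delta>' \<epsilon> a w W" "range w \<subseteq> {p, q}" by blast
      have t: "train (closure \<Omega>\<^sub>1) \<delta>' a \<phi> P" by (rule train_mono[OF 1(2)]) (use d in \<open>auto simp: \<delta>_def\<close>)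
      obtain g A where "flat_block (closure \<Omega>\<^sub>1) (\<delta>' / 2) \<epsilon> a g A" "range g \<subseteq> range \<phi> \<union> range w"
          "integral {0..1} (\<lambda>t. f (\<phi> t)) - \<eta> \<le> integral {0..1} (\<lambda>t. f (g t))"
        using block_from_train[OF t w(1) e _ assms(4)] d by blast
      moreover have "range \<phi> \<union> range w \<subseteq> frontier \<Omega>\<^sub>0" using 1(3) w(2) pq(1,2) by blast
      ultimately show "\<exists>g A. flat_block (closure \<Omega>\<^sub>1) (\<delta>' / 2) \<epsilon> a g A \<and>
        range g \<subseteq> frontier \<Omega>\<^sub>0 \<and> integral {0..1} (\<lambda>t. f (\<phi> t)) - \<eta> \<le> integral {0..1} (\<lambda>t. f (g t))"
        by blast
    qed
  qed (use assms 1 2 in \<open>auto simp: \<delta>_def\<close>)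
qed

lemma nice_concave:
  fixes f :: "'a \<Rightarrow> real"
  assumes a: "nice a \<phi>" and b: "nice b \<psi>" and seg: "closed_segment a b \<subseteq> annulus"
    and u: "0 < u" "u < 1" and \<eta>: "0 < \<eta>"
  obtains \<xi> where "nice (u *\<^sub>R a + (1 - u) *\<^sub>R b) \<xi>"
    "u * integral {0..1} (\<lambda>t. f (\<phi> t)) + (1 - u) * integral {0..1} (\<lambda>t. f (\<psi> t)) - \<eta> \<le> integral {0..1} (\<lambda>t. f (\<xi> t))"
proof -
  have ab: "a \<in> annulus" "b \<in> annulus" using seg by auto
  obtain \<delta>0 where d0: "0 < \<delta>0" "\<forall>y\<in>closed_segment a b. \<delta>0 \<le> infdist y (closure \<Omega>\<^sub>1)"
    using segment_separation[OF seg] .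
  obtain \<delta>a where da: "0 < \<delta>a" "\<delta>a \<le> \<delta>0" "\<forall>\<epsilon>>0. \<forall>\<delta>'. 0 < \<delta>' \<and> \<delta>' \<le> \<delta>a \<and> 4 * \<epsilon> \<le> \<delta>' \<longrightarrow> (\<exists>g A. flat_block (closure \<Omega>\<^sub>1) (\<delta>' / 2) \<epsilon> a g A \<and>
        range g \<subseteq> frontier \<Omega>\<^sub>0 \<and> integral {0..1} (\<lambda>t. f (\<phi> t)) - \<eta> \<le> integral {0..1} (\<lambda>t. f (g t)))"
    using nice_block[OF a ab(1) d0(1) \<eta>] .
  obtain \<delta> where db: "0 < \<delta>" "\<delta> \<le> \<delta>a" "\<forall>\<epsilon>>0. \<forall>\<delta>'. 0 < \<delta>' \<and> \<delta>' \<le> \<delta> \<and> 4 * \<epsilon> \<le> \<delta>' \<longrightarrow> (\<exists>g A. flat_block (closure \<Omega>\<^sub>1) (\<delta>' / 2) \<epsilon> b g A \<and>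
        range g \<subseteq> frontier \<Omega>\<^sub>0 \<and> integral {0..1} (\<lambda>t. f (\<psi> t)) - \<eta> \<le> integral {0..1} (\<lambda>t. f (g t)))"
    using nice_block[OF b ab(2) da(1) \<eta>] .
  \<comment> \<open>With \<open>\<epsilon> = \<delta> / 4\<close> the blocks get
    \<open>4 * \<epsilon> \<le> \<delta>\<close>, and the segment gets
    \<open>\<delta> / 2 + \<epsilon> \<le> \<delta>0\<close>.\<close>
  have e: "0 < \<delta> / 4" "0 < \<delta> \<and> \<delta> \<le> \<delta> \<and> 4 * (\<delta> / 4) \<le> \<delta>" "0 < \<delta> \<and> \<delta> \<le> \<delta>a \<and> 4 * (\<delta> / 4) \<le> \<delta>"
    using db by auto
  obtain g A where g: "flat_block (closure \<Omega>\<^sub>1) (\<delta> / 2) (\<delta> / 4) a g A" "range g \<subseteq> frontier \<Omega>\<^sub>0"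
      and gi: "integral {0..1} (\<lambda>t. f (\<phi> t)) - \<eta> \<le> integral {0..1} (\<lambda>t. f (g t))"
    using da(3)[rule_format, OF e(1) e(3)] by blast
  obtain h B where h: "flat_block (closure \<Omega>\<^sub>1) (\<delta> / 2) (\<delta> / 4) b h B" "range h \<subseteq> frontier \<Omega>\<^sub>0"
      and hi: "integral {0..1} (\<lambda>t. f (\<psi> t)) - \<eta> \<le> integral {0..1} (\<lambda>t. f (h t))"
    using db(3)[rule_format, OF e(1) e(2)] by blast
  have sep: "\<delta> / 2 + \<delta> / 4 \<le> infdist y (closure \<Omega>\<^sub>1)" if "y \<in> closed_segment a b" for y
    using d0(2)[rule_format, OF that] da db by linarith
  obtain P where P: "train (closure \<Omega>\<^sub>1) (\<delta> / 2) (u *\<^sub>R a + (1 - u) *\<^sub>R b) (\<lambda>t. juxtapose u g h (frac t)) P"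
    using train_from_blocks[OF g(1) h(1) u sep e(1) refl] by blast
  have "range (\<lambda>t. juxtapose u g h (frac t)) \<subseteq> frontier \<Omega>\<^sub>0"
    using g(2) h(2) by (auto simp: juxtapose_def)
  then have nice: "nice (u *\<^sub>R a + (1 - u) *\<^sub>R b) (\<lambda>t. juxtapose u g h (frac t))"
    using P db(1) by (auto simp: nice_def intro!: exI[of _ "\<delta> / 2"])
  have s: "simple_fun g" "simple_fun h" using g h by (auto simp: flat_block_def)
  have "u * (integral {0..1} (\<lambda>t. f (\<phi> t)) - \<eta>) + (1 - u) * (integral {0..1} (\<lambda>t. f (\<psi> t)) - \<eta>)
     \<le> u * integral {0..1} (\<lambda>t. f (g t)) + (1 - u) * integral {0..1} (\<lambda>t. f (h t))"
    using gi hi u by (intro add_mono mult_left_mono) auto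
  then show ?thesis using that[OF nice] integral_juxtapose[OF s u, of f] by (simp add: algebra_simps)
qed

lemma nice_exists:
  assumes "y \<in> annulus" obtains \<phi> where "nice y \<phi>"
proof -
  obtain p q where pq: "p \<in> frontier \<Omega>\<^sub>0" "q \<in> frontier \<Omega>\<^sub>0" "y \<in> closed_segment p q" "closed_segment p q \<subseteq> annulus"
    using chord[OF assms] .
  obtain u where u: "0 \<le> u" "u \<le> 1" "y = (1 - u) *\<^sub>R p + u *\<^sub>R q" using pq(3) by (auto simp: in_segment)
  consider "u = 0" | "u = 1" | "0 < 1 - u" "1 - u < 1" using u by force
  then show ?thesis
  proof cases
    case 1 then show ?thesis using that nice_const[OF pq(1)] u by simp
  next
    case 2 then show ?thesis using that nice_const[OF pq(2)] u by simp
  next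
    case 3
    \<comment> \<open>Only existence matters here, so the integrand is taken to be 0.\<close>
    from nice_concave[OF nice_const[OF pq(1)] nice_const[OF pq(2)] pq(4) 3 zero_less_one, of "\<lambda>_. 0"]
    show ?thesis using that u by auto
  qed
qed

text \<open>Periodicity moves any bounded interval into some \<open>{0..N}\<close>, where clamping
  does nothing and \<open>train\<close> keeps the average at distance \<open>\<delta>\<close> from
  \<open>closure \<Omega>\<^sub>1\<close>.\<close>

lemma nice_admissible:
  assumes "nice x \<phi>"
  shows "\<phi> \<in> admissible \<Omega>\<^sub>0 \<Omega>\<^sub>1" "average circle \<phi> = x" "ext_average circle (\<lambda>t. f (\<phi> t)) = ereal (integral {0..1} (\<lambda>t. f (\<phi> t)))"
proof -
  obtain \<delta> P where d: "0 < \<delta>" "train (closure \<Omega>\<^sub>1) \<delta> x \<phi> P" and r: "range \<phi> \<subseteq> frontier \<Omega>\<^sub>0"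
    using assms by (rule niceE)
  have tr: "simple_fun \<phi>" "\<And>t. \<phi> (t + 1) = \<phi> t" "primitive_on UNIV (\<lambda>t. \<phi> t - x) P" "P 0 = 0" "P 1 = 0"
    and good: "\<And>N s r. s < r \<Longrightarrow> \<delta> \<le> infdist (x + (1 / (r - s)) *\<^sub>R (P (clamp_to N r) - P (clamp_to N s))) (closure \<Omega>\<^sub>1)"
    using d(2) by (auto simp: train_def)
  have av: "average J \<phi> = x + (1 / (b - a)) *\<^sub>R (P b - P a)"
    if "a < b" "{a<..<b} \<subseteq> J" "J \<subseteq> {a..b}" for a b J
  proof -
    have "((\<lambda>t. (\<phi> t - x) + x) has_integral (P b - P a + (b *\<^sub>R x - a *\<^sub>R x))) {a..b}"
      using has_integral_add[OF primitive_onD[OF tr(3), of a b] primitive_onD[OF primitive_on_const[of UNIV x], of a b]] that by simp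
    then have "integral {a..b} \<phi> = P b - P a + (b - a) *\<^sub>R x" by (simp add: integral_unique scaleR_diff_left)
    then show ?thesis
      using average_interval[OF that simple_fun_set_integrable[OF tr(1)]] that(1) by (simp add: scaleR_add_right add.commute)
  qed
  show "average circle \<phi> = x" proof -
    have "{0<..<1} \<subseteq> circle" "circle \<subseteq> {0..1}" by auto
    from av[OF zero_less_one this] tr show ?thesis by simp
  qed
  have int: "set_integrable lebesgue circle \<phi>" by (rule simple_fun_set_integrable[OF tr(1) lmeasurable_circle])
  show "ext_average circle (\<lambda>t. f (\<phi> t)) = ereal (integral {0..1} (\<lambda>t. f (\<phi> t)))"
    by (rule ext_average_circle_eq[OF simple_fun_set_integrable[OF simple_fun_comp[OF tr(1)] lmeasurable_circle]])
  obtain V0 where V0: "open V0" "closure \<Omega>\<^sub>1 \<subseteq> V0" "closure V0 \<subseteq> \<Omega>\<^sub>0" using separating_open .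
  \<comment> \<open>The distance condition keeps the averages out of \<open>V\<close>, and
    \<open>V0\<close> keeps \<open>closure V\<close> inside \<open>\<Omega>\<^sub>0\<close>.\<close>
  define V where "V = V0 \<inter> {y. infdist y (closure \<Omega>\<^sub>1) < \<delta>}"
  have "open V" unfolding V_def by (intro open_Int V0 open_Collect_less continuous_intros)
  moreover have "closure \<Omega>\<^sub>1 \<subseteq> V" using V0 d(1) by (auto simp: V_def)
  moreover have "closure V \<subseteq> \<Omega>\<^sub>0" using V0 closure_mono[of V V0] by (auto simp: V_def)
  moreover have "average J \<phi> \<notin> V" if J: "is_interval J" "bounded J" "interior J \<noteq> {}" for J
  proof -
    obtain a b where ab: "a < b" "{a<..<b} \<subseteq> J" "J \<subseteq> {a..b}" using interval_endpoints[OF J] .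
    define k where "k = - \<lfloor>a\<rfloor>"
    define N where "N = nat \<lceil>b + of_int k\<rceil>"
    have a0: "0 \<le> a + of_int k" unfolding k_def by simp
    have bN: "b + of_int k \<le> real N" unfolding N_def by (rule of_nat_ceiling)
    have c: "clamp_to N (a + of_int k) = a + of_int k" "clamp_to N (b + of_int k) = b + of_int k"
      using a0 bN ab(1) by (auto simp: clamp_to_def)
    have "\<delta> \<le> infdist (average J \<phi>) (closure \<Omega>\<^sub>1)"
      using good[of "a + of_int k" "b + of_int k" N] ab(1) av[OF ab]
      unfolding c train_P_periodic[OF d(2)] by simp
    then show ?thesis by (auto simp: V_def)
  qed
  ultimately have "\<exists>V. open V \<and> closure \<Omega>\<^sub>1 \<subseteq> V \<and> closure V \<subseteq> \<Omega>\<^sub>0 \<and>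
      (\<forall>J. is_interval J \<and> bounded J \<and> interior J \<noteq> {} \<longrightarrow> average J \<phi> \<notin> V)" by blast
  then show "\<phi> \<in> admissible \<Omega>\<^sub>0 \<Omega>\<^sub>1" using tr(2) r int by (auto simp: admissible_def)
qed

section \<open>The supremum over nice functions as a locally concave majorant\<close>

definition nice_sup :: "('a \<Rightarrow> real) \<Rightarrow> 'a \<Rightarrow> ereal" where
  "nice_sup f y = (SUP \<phi> \<in> {\<phi>. nice y \<phi>}. ereal (integral {0..1} (\<lambda>t. f (\<phi> t))))"

lemma nice_sup_upper: "nice y \<phi> \<Longrightarrow> ereal (integral {0..1} (\<lambda>t. f (\<phi> t))) \<le> nice_sup f y"
  unfolding nice_sup_def by (rule SUP_upper) simp

lemma nice_sup_not_minf:
  assumes "y \<in> annulus" shows "nice_sup f y \<noteq> - \<infinity>"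
proof -
  obtain \<phi> where "nice y \<phi>" using nice_exists[OF assms] .
  from nice_sup_upper[OF this, of f] show ?thesis by auto
qed

text \<open>The suprema over \<open>\<phi>\<close> and \<open>\<psi>\<close> are taken one after the
  other. If the right-hand side is finite, the first shows that \<open>nice_sup f a\<close> is
  finite, so that real arithmetic applies to the second.\<close>

lemma nice_sup_concave:
  assumes seg: "closed_segment a b \<subseteq> annulus" and uv: "0 < u" "0 < v" "u + v = 1"
  shows "ereal u * nice_sup f a + ereal v * nice_sup f b \<le> nice_sup f (u *\<^sub>R a + v *\<^sub>R b)"
proof -
  define R where "R = nice_sup f (u *\<^sub>R a + v *\<^sub>R b)"
  have v: "v = 1 - u" using uv by simp
  have ab: "a \<in> annulus" "b \<in> annulus" using seg by auto
  have key: "ereal (u * integral {0..1} (\<lambda>t. f (\<phi> t)) + v * integral {0..1} (\<lambda>t. f (\<psi> t))) \<le> R"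
    if n: "nice a \<phi>" "nice b \<psi>" for \<phi> \<psi>
  proof (rule ereal_le_epsilon2)
    fix \<eta> :: real assume "0 < \<eta>"
    from nice_concave[OF n seg uv(1) _ this, of f] uv obtain \<xi> where \<xi>: "nice (u *\<^sub>R a + (1 - u) *\<^sub>R b) \<xi>"
      "u * integral {0..1} (\<lambda>t. f (\<phi> t)) + (1 - u) * integral {0..1} (\<lambda>t. f (\<psi> t)) - \<eta> \<le> integral {0..1} (\<lambda>t. f (\<xi> t))"
      by auto
    have "ereal (integral {0..1} (\<lambda>t. f (\<xi> t))) \<le> R" using nice_sup_upper[OF \<xi>(1), of f] by (simp add: R_def v)
    moreover have "ereal (u * integral {0..1} (\<lambda>t. f (\<phi> t)) + v * integral {0..1} (\<lambda>t. f (\<psi> t)))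
       \<le> ereal (integral {0..1} (\<lambda>t. f (\<xi> t))) + ereal \<eta>" using \<xi>(2) by (simp add: v)
    ultimately show "ereal (u * integral {0..1} (\<lambda>t. f (\<phi> t)) + v * integral {0..1} (\<lambda>t. f (\<psi> t))) \<le> R + ereal \<eta>"
      by (meson add_right_mono order_trans)
  qed
  obtain \<phi>0 \<psi>0 where n0: "nice a \<phi>0" "nice b \<psi>0" using nice_exists ab by metis
  have "R \<noteq> - \<infinity>" using key[OF n0] by auto
  then consider "R = \<infinity>" | R' where "R = ereal R'" by (cases R) auto
  then show ?thesis
  proof cases
    case 1 then show ?thesis by (simp flip: R_def)
  next
    case (2 R')
    have A: "nice_sup f a \<le> ereal ((R' - v * integral {0..1} (\<lambda>t. f (\<psi> t))) / u)" if "nice b \<psi>" for \<psi>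
      unfolding nice_sup_def
    proof (rule SUP_least)
      fix \<phi> assume "\<phi> \<in> {\<phi>. nice a \<phi>}"
      with key[of \<phi> \<psi>] that 2 have "u * integral {0..1} (\<lambda>t. f (\<phi> t)) + v * integral {0..1} (\<lambda>t. f (\<psi> t)) \<le> R'" by simp
      then show "ereal (integral {0..1} (\<lambda>t. f (\<phi> t))) \<le> ereal ((R' - v * integral {0..1} (\<lambda>t. f (\<psi> t))) / u)"
        using uv(1) by (simp add: pos_le_divide_eq algebra_simps)
    qed
    obtain ma where ma: "nice_sup f a = ereal ma"
      using A[OF n0(2)] nice_sup_not_minf[OF ab(1), of f] by (cases "nice_sup f a") auto
    have "nice_sup f b \<le> ereal ((R' - u * ma) / v)"
      unfolding nice_sup_def
    proof (rule SUP_least)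
      fix \<psi> assume "\<psi> \<in> {\<phi>. nice b \<phi>}"
      then have "ma \<le> (R' - v * integral {0..1} (\<lambda>t. f (\<psi> t))) / u" using A[of \<psi>] ma by simp
      then have "ma * u \<le> R' - v * integral {0..1} (\<lambda>t. f (\<psi> t))" using uv(1) by (simp add: pos_le_divide_eq)
      then show "ereal (integral {0..1} (\<lambda>t. f (\<psi> t))) \<le> ereal ((R' - u * ma) / v)"
        using uv(2) by (simp add: pos_le_divide_eq algebra_simps)
    qed
    moreover obtain mb where mb: "nice_sup f b = ereal mb"
      using calculation nice_sup_not_minf[OF ab(2), of f] by (cases "nice_sup f b") auto
    ultimately have "mb * v \<le> R' - u * ma" using uv(2) by (simp add: pos_le_divide_eq)
    then show ?thesis using 2 by (simp add: ma mb R_def algebra_simps)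
  qed
qed

lemma nice_sup_majorant: "nice_sup f \<in> locally_concave_majorants annulus f"
proof -
  have "ereal_concave_on (closed_segment a b) (nice_sup f)" if ab: "closed_segment a b \<subseteq> annulus" for a b
    unfolding ereal_concave_on_def
  proof (intro ballI allI impI)
    fix x y and u v :: real assume xy: "x \<in> closed_segment a b" "y \<in> closed_segment a b" and uv: "0 \<le> u" "0 \<le> v" "u + v = 1"
    have seg: "closed_segment x y \<subseteq> annulus" using xy ab by (meson closed_segment_subset convex_closed_segment order_trans)
    consider "u = 0" | "v = 0" | "0 < u" "0 < v" using uv by force
    then show "ereal u * nice_sup f x + ereal v * nice_sup f y \<le> nice_sup f (u *\<^sub>R x + v *\<^sub>R y)"
    proof cases
      case 1 then show ?thesis using uv by (simp flip: zero_ereal_def one_ereal_def)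
    next
      case 2 then show ?thesis using uv by (simp flip: zero_ereal_def one_ereal_def)
    next
      case 3 then show ?thesis using nice_sup_concave[OF seg 3 uv(3)] by simp
    qed
  qed
  moreover have "ereal (f y) \<le> nice_sup f y" if "y \<in> fixed_boundary annulus" for y
    using nice_sup_upper[OF nice_const, of y f] that by (simp add: fixed_boundary_annulus)
  ultimately show ?thesis
    using nice_sup_not_minf by (auto simp: locally_concave_majorants_def locally_concave_on_def)
qed

text \<open>\<open>nice_sup f\<close> competes in the infimum and is itself a supremum over a
  subclass of the admissible functions.\<close>

lemma minimal_le_bellman:
  "minimal_locally_concave annulus f x \<le> bellman \<Omega>\<^sub>0 \<Omega>\<^sub>1 f x"
proof -
  have "minimal_locally_concave annulus f x \<le> nice_sup f x"
    unfolding minimal_locally_concave_def by (rule INF_lower[OF nice_sup_majorant])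
  also have "\<dots> \<le> bellman \<Omega>\<^sub>0 \<Omega>\<^sub>1 f x"
    unfolding nice_sup_def
  proof (rule SUP_least)
    fix \<phi> assume "\<phi> \<in> {\<phi>. nice x \<phi>}"
    then have n: "nice x \<phi>" by simp
    show "ereal (integral {0..1} (\<lambda>t. f (\<phi> t))) \<le> bellman \<Omega>\<^sub>0 \<Omega>\<^sub>1 f x"
      unfolding bellman_def nice_admissible(3)[OF n, of f, symmetric]
      by (rule SUP_upper) (use nice_admissible[OF n] in simp)
  qed
  finally show ?thesis .
qed

end

section \<open>The upper bound\<close>

definition slope :: "(real \<Rightarrow> 'a::real_vector) \<Rightarrow> real \<Rightarrow> real \<Rightarrow> 'a" where
  "slope F s r = (1 / (r - s)) *\<^sub>R (F r - F s)"

lemma slope_split: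
  assumes "a < m" "m < b"
  shows "slope F a b = (1 - (b - m) / (b - a)) *\<^sub>R slope F a m + ((b - m) / (b - a)) *\<^sub>R slope F m b"
proof -
  have "1 - (b - m) / (b - a) = (m - a) / (b - a)" using assms by (simp add: diff_divide_eq_iff)
  then have 1: "(1 - (b - m) / (b - a)) *\<^sub>R slope F a m = (1 / (b - a)) *\<^sub>R (F m - F a)"
    using assms by (simp add: slope_def)
  have 2: "((b - m) / (b - a)) *\<^sub>R slope F m b = (1 / (b - a)) *\<^sub>R (F b - F m)"
    using assms by (simp add: slope_def)
  show ?thesis unfolding 1 2 by (simp add: slope_def flip: scaleR_add_right)
qed

text \<open>Points with the same parameter on the segments from \<open>x\<close> to \<open>y\<close>
  and from \<open>x\<close> to \<open>z\<close> are at distance at most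
  \<open>norm (y - z)\<close>.\<close>

lemma segment_disjoint_nearby:
  fixes x y :: "'a::euclidean_space"
  assumes "closed_segment x y \<inter> K = {}" "closed K"
  obtains d where "0 < d" "\<forall>z. dist z y < d \<longrightarrow> closed_segment x z \<inter> K = {}"
proof -
  obtain d where d: "0 < d" "\<And>s k. s \<in> closed_segment x y \<Longrightarrow> k \<in> K \<Longrightarrow> d \<le> dist s k"
    using separate_compact_closed[OF compact_segment(1) assms(2,1)] by metis
  have "closed_segment x z \<inter> K = {}" if z: "dist z y < d" for z
  proof (rule ccontr)
    assume "closed_segment x z \<inter> K \<noteq> {}"
    then obtain k where "k \<in> K" "k \<in> closed_segment x z" by blast
    then obtain u where k: "k \<in> K" "0 \<le> u" "u \<le> 1" "k = (1 - u) *\<^sub>R x + u *\<^sub>R z" by (auto simp: in_segment)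
    have "(1 - u) *\<^sub>R x + u *\<^sub>R y \<in> closed_segment x y" using k by (auto simp: in_segment)
    then have "d \<le> dist ((1 - u) *\<^sub>R x + u *\<^sub>R y) k" using d(2) k(1) by blast
    also have "\<dots> = norm (u *\<^sub>R (y - z))" by (simp add: k(4) dist_norm scaleR_diff_right)
    also have "\<dots> \<le> norm (y - z)" using k(2) mult_right_mono[OF k(3) norm_ge_zero, of "y - z"] by simp
    also have "\<dots> < d" using z by (simp add: dist_norm norm_minus_commute)
    finally show False by simp
  qed
  then show ?thesis using that d(1) by blast
qed

text \<open>\<open>k1\<close> and \<open>k2\<close> lie on one line on opposite sides of
  \<open>x\<close>, so \<open>x\<close> is a convex combination of them.\<close>

lemma between_convex:
  assumes K: "convex K" "k1 \<in> K" "k2 \<in> K" and k: "k1 \<in> closed_segment x x1" "k2 \<in> closed_segment x x2"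
    and x: "x = (1 - l) *\<^sub>R x1 + l *\<^sub>R x2" "0 < l" "l < 1"
  shows "x \<in> K"
proof -
  obtain s where s: "0 \<le> s" "s \<le> 1" "k1 = (1 - s) *\<^sub>R x + s *\<^sub>R x1" using k(1) by (auto simp: in_segment)
  obtain t where t: "0 \<le> t" "t \<le> 1" "k2 = (1 - t) *\<^sub>R x + t *\<^sub>R x2" using k(2) by (auto simp: in_segment)
  define w where "w = x1 - x2"
  have 1: "x1 = x + l *\<^sub>R w" "x2 = x - (1 - l) *\<^sub>R w" by (simp_all add: x(1) w_def algebra_simps)
  have k1: "k1 = x + (s * l) *\<^sub>R w" and k2: "k2 = x - (t * (1 - l)) *\<^sub>R w"
    unfolding s(3) t(3) 1 by (simp_all add: algebra_simps)
  define p where "p = s * l"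
  define q where "q = t * (1 - l)"
  have pq: "0 \<le> p" "0 \<le> q" using s t x by (auto simp: p_def q_def)
  show ?thesis
  proof (cases "p + q = 0")
    case True
    then have "p = 0" using pq by auto
    then have "k1 = x" using k1 p_def by (metis add.right_neutral scaleR_zero_left)
    then show ?thesis using K(2) by simp
  next
    case False
    then have ne: "0 < p + q" using pq by auto
    \<comment> \<open>\<open>p\<close> and \<open>q\<close> are the distances of \<open>k1\<close>
      and \<open>k2\<close> from \<open>x\<close> in units of \<open>w\<close>; each point is
      weighted with the distance of the other.\<close>
    have "(q / (p + q)) *\<^sub>R k1 + (p / (p + q)) *\<^sub>R k2 \<in> K"
      using ne pq by (intro convexD[OF K]) (auto simp flip: add_divide_distrib simp: add.commute)
    also have "(q / (p + q)) *\<^sub>R k1 + (p / (p + q)) *\<^sub>R k2 = (q / (p + q) + p / (p + q)) *\<^sub>R x + (q / (p + q) * p - p / (p + q) * q) *\<^sub>R w"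
      unfolding k1 k2 p_def[symmetric] q_def[symmetric] by (simp add: algebra_simps)
    also have "q / (p + q) + p / (p + q) = 1" using ne by (simp add: add.commute flip: add_divide_distrib)
    also have "q / (p + q) * p - p / (p + q) * q = 0" by simp
    also have "1 *\<^sub>R x + 0 *\<^sub>R w = x" by simp
    finally show ?thesis .
  qed
qed

text \<open>
  As \<open>m\<close> increases to \<open>b\<close>, the average over the left part tends to the average over the whole interval, so
  the left segment ceases to meet \<open>K\<close>. Just after the last crossing the right segment does not meet \<open>K\<close>
  either, because by convexity the two segments cannot meet \<open>K\<close> simultaneously.
\<close>
lemma crossing_split:
  fixes F :: "real \<Rightarrow> 'a::euclidean_space"
  assumes F: "continuous_on {a..b} F" and m0: "a < m0" "m0 < b"
    and K: "closed K" "convex K" and x: "slope F a b \<notin> K"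
    and cross: "closed_segment (slope F a b) (slope F a m0) \<inter> K \<noteq> {}"
    and far: "\<And>m. m \<in> {m0..b} \<Longrightarrow> closed_segment (slope F a b) (slope F a m) \<inter> K \<noteq> {} \<Longrightarrow>
      \<delta> \<le> dist (slope F a b) (slope F a m)" and \<delta>: "0 < \<delta>"
  obtains m where "m0 \<le> m" "m < b" "closed_segment (slope F a m) (slope F m b) \<inter> K = {}"
    "\<delta> / 2 \<le> dist (slope F a b) (slope F a m)"
proof -
  define x where "x = slope F a b"
  have cl: "continuous_on {m0..b} (\<lambda>m. slope F a m)"
    unfolding slope_def by (intro continuous_intros continuous_on_subset[OF F]) (use m0 in auto)
  have cr: "continuous_on {a..<b} (\<lambda>m. slope F m b)"
    unfolding slope_def by (intro continuous_intros continuous_on_subset[OF F]) (use m0 in auto)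
  \<comment> \<open>Pairs of a cutting point and a segment parameter whose point lies in
    \<open>K\<close>. The cutting points \<open>L\<close> with a crossing are the projection of this
    compact set, so a last one exists.\<close>
  define S where "S = ({m0..b} \<times> {0..1}) \<inter> (\<lambda>p. (1 - snd p) *\<^sub>R x + snd p *\<^sub>R slope F a (fst p)) -` K"
  define L where "L = {m \<in> {m0..b}. closed_segment x (slope F a m) \<inter> K \<noteq> {}}"
  have "closed S" unfolding S_def
  proof (rule continuous_closed_preimage)
    show "continuous_on ({m0..b} \<times> {0..1::real}) (\<lambda>p. (1 - snd p) *\<^sub>R x + snd p *\<^sub>R slope F a (fst p))"
      by (intro continuous_intros continuous_on_compose2[OF cl]) auto
  qed (auto intro: closed_Times K)
  moreover have "S = ({m0..b} \<times> {0..1}) \<inter> S" by (auto simp: S_def)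
  ultimately have "compact S" by (metis compact_Int_closed compact_Times compact_Icc)
  have "L = fst ` S"
  proof (intro equalityI subsetI)
    fix m assume "m \<in> L"
    then obtain k where "m \<in> {m0..b}" "k \<in> closed_segment x (slope F a m)" "k \<in> K" by (auto simp: L_def)
    then obtain u where "0 \<le> u" "u \<le> 1" "(1 - u) *\<^sub>R x + u *\<^sub>R slope F a m \<in> K" by (auto simp: in_segment)
    then have "(m, u) \<in> S" using \<open>m \<in> {m0..b}\<close> by (simp add: S_def)
    then show "m \<in> fst ` S" by force
  next
    fix m assume "m \<in> fst ` S"
    then obtain u where u: "(m, u) \<in> S" by auto
    then have "(1 - u) *\<^sub>R x + u *\<^sub>R slope F a m \<in> closed_segment x (slope F a m)" by (auto simp: S_def in_segment)
    then show "m \<in> L" using u by (auto simp: S_def L_def)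
  qed
  then have "compact L" using \<open>compact S\<close> by (simp add: compact_continuous_image continuous_on_fst[OF continuous_on_id])
  moreover have "m0 \<in> L" using cross m0 by (auto simp: L_def x_def)
  ultimately obtain \<theta> where th: "\<theta> \<in> L" "\<And>m. m \<in> L \<Longrightarrow> m \<le> \<theta>"
    using compact_attains_sup[of L] by blast
  have "b \<notin> L" using x by (simp add: L_def x_def)
  then have tb: "m0 \<le> \<theta>" "\<theta> < b" using th(1) by (auto simp: L_def order_less_le)
  have at: "a < \<theta>" using tb m0 by simp
  have xs: "x = (1 - (b - m) / (b - a)) *\<^sub>R slope F a m + ((b - m) / (b - a)) *\<^sub>R slope F m b" if "a < m" "m < b" for m
    using slope_split[OF that, of F] by (simp add: x_def)
  have "closed_segment x (slope F \<theta> b) \<inter> K = {}"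
  proof (rule ccontr)
    assume "closed_segment x (slope F \<theta> b) \<inter> K \<noteq> {}"
    then obtain k2 where k2: "k2 \<in> K" "k2 \<in> closed_segment x (slope F \<theta> b)" by blast
    obtain k1 where k1: "k1 \<in> K" "k1 \<in> closed_segment x (slope F a \<theta>)" using th(1) by (auto simp: L_def)
    have "x \<in> K"
      by (rule between_convex[OF K(2) k1(1) k2(1) k1(2) k2(2) xs[OF at tb(2)]]) (use at tb in auto)
    then show False using x by (simp add: x_def)
  qed
  then obtain d where d: "0 < d" "\<forall>z. dist z (slope F \<theta> b) < d \<longrightarrow> closed_segment x z \<inter> K = {}"
    using segment_disjoint_nearby[OF _ K(1)] by metis
  have "\<delta> \<le> dist x (slope F a \<theta>)" using far[of \<theta>] th(1) by (simp add: L_def x_def)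
  \<comment> \<open>Halving leaves room for moving from \<open>\<theta>\<close> to a slightly later
    \<open>m\<close>.\<close>
  then have dx: "\<delta> / 2 < dist x (slope F a \<theta>)" using \<delta> by simp
  have sub: "{\<theta><..<b} \<subseteq> {m0..b}" "{\<theta><..<b} \<subseteq> {a..<b}" using tb at by auto
  have nt: "at \<theta> within {\<theta><..<b} \<noteq> bot" using tb(2) by (simp add: at_within_eq_bot_iff)
  have "((\<lambda>m. slope F m b) \<longlongrightarrow> slope F \<theta> b) (at \<theta> within {\<theta><..<b})"
    using cr at tb by (auto simp: continuous_on_def intro: tendsto_within_subset[OF _ sub(2)])
  then have 1: "\<forall>\<^sub>F m in at \<theta> within {\<theta><..<b}. dist (slope F m b) (slope F \<theta> b) < d"
    using d(1) by (rule tendstoD)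
  have "((\<lambda>m. slope F a m) \<longlongrightarrow> slope F a \<theta>) (at \<theta> within {\<theta><..<b})"
    using cl at tb by (auto simp: continuous_on_def intro: tendsto_within_subset[OF _ sub(1)])
  then have "((\<lambda>m. dist x (slope F a m)) \<longlongrightarrow> dist x (slope F a \<theta>)) (at \<theta> within {\<theta><..<b})"
    by (intro tendsto_dist tendsto_const)
  then have 2: "\<forall>\<^sub>F m in at \<theta> within {\<theta><..<b}. \<delta> / 2 < dist x (slope F a m)"
    using dx by (rule order_tendstoD)
  have 3: "\<forall>\<^sub>F m in at \<theta> within {\<theta><..<b}. m \<in> {\<theta><..<b}" by (simp add: eventually_at_filter)
  have "\<forall>\<^sub>F m in at \<theta> within {\<theta><..<b}. m \<in> {\<theta><..<b} \<and> \<delta> / 2 < dist x (slope F a m) \<and> dist (slope F m b) (slope F \<theta> b) < d"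
    using 1 2 3 by eventually_elim auto
  then obtain m where m: "\<theta> < m" "m < b" "\<delta> / 2 < dist x (slope F a m)" "dist (slope F m b) (slope F \<theta> b) < d"
    using eventually_happens'[OF nt] by fastforce
  have "m \<notin> L" using th(2)[of m] m(1) by auto
  then have left: "closed_segment x (slope F a m) \<inter> K = {}" using m tb by (auto simp: L_def)
  have right: "closed_segment x (slope F m b) \<inter> K = {}" using d(2) m(4) by blast
  have am: "a < m" using at m by simp
  have "x \<in> closed_segment (slope F a m) (slope F m b)"
    using xs[OF am m(2)] am m(2) by (auto simp: in_segment intro!: exI[of _ "(b - m) / (b - a)"])
  then have "closed_segment (slope F a m) (slope F m b) = closed_segment (slope F a m) x \<union> closed_segment x (slope F m b)"
    by (rule Un_closed_segment[symmetric])
  then have "closed_segment (slope F a m) (slope F m b) \<inter> K = {}"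
    using left right by (auto simp: closed_segment_commute)
  then show ?thesis using that[of m] m tb by (simp add: x_def)
qed

text \<open>A cut close to \<open>b\<close> is impossible: there the average over
  \<open>{a..m}\<close> is uniformly close to the one over \<open>{a..b}\<close>, whereas
  \<open>crossing_split\<close> keeps them \<open>\<delta> / 2\<close> apart. The constant
  \<open>\<delta>\<close> is uniform by compactness: averages over intervals of length at least
  \<open>\<eta> / 2\<close> stay in a ball of radius \<open>R\<close>, and the part of
  \<open>K\<close> in this ball has positive distance from the complement of
  \<open>V\<close>.\<close>

lemma uniform_left_split:
  fixes F :: "real \<Rightarrow> 'a::euclidean_space"
  assumes F: "continuous_on {0..1} F" and K: "closed K" "convex K" and V: "open V" "K \<subseteq> V"
    and avoid: "\<And>s r. 0 \<le> s \<Longrightarrow> s < r \<Longrightarrow> r \<le> 1 \<Longrightarrow> slope F s r \<notin> V" and \<eta>: "0 < \<eta>"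
  obtains c where "0 < c" "\<forall>a b. 0 \<le> a \<and> b \<le> 1 \<and> \<eta> \<le> b - a \<and>
      closed_segment (slope F a b) (slope F a ((a + b) / 2)) \<inter> K \<noteq> {} \<longrightarrow>
      (\<exists>m. a + c \<le> m \<and> m \<le> b - c \<and> closed_segment (slope F a m) (slope F m b) \<inter> K = {})"
proof -
  have "bounded (F ` {0..1})" by (intro compact_imp_bounded compact_continuous_image F) auto
  then obtain M where M: "0 < M" "\<And>t. t \<in> {0..1} \<Longrightarrow> norm (F t) \<le> M" by (auto simp: bounded_pos)
  define R where "R = 4 * M / \<eta>"
  have R: "0 < R" using M \<eta> by (simp add: R_def)
  have "compact (K \<inter> cball 0 R)" using K by (simp add: closed_Int_compact)
  moreover have "closed (- V)" "(K \<inter> cball 0 R) \<inter> - V = {}" using V by auto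
  ultimately obtain \<delta> where \<delta>: "0 < \<delta>" "\<And>k y. k \<in> K \<inter> cball 0 R \<Longrightarrow> y \<in> - V \<Longrightarrow> \<delta> \<le> dist k y"
    using separate_compact_closed[of "K \<inter> cball 0 R" "- V"] by metis
  have "uniformly_continuous_on {0..1} F" by (rule compact_uniformly_continuous[OF F]) auto
  then obtain c0 where c0: "0 < c0" "\<And>s t. s \<in> {0..1} \<Longrightarrow> t \<in> {0..1} \<Longrightarrow> dist t s < c0 \<Longrightarrow> dist (F t) (F s) < \<delta> * \<eta> / 8"
    unfolding uniformly_continuous_on_def using \<delta>(1) \<eta> by (metis divide_pos_pos mult_pos_pos zero_less_numeral)
  \<comment> \<open>\<open>\<eta> / 2\<close> serves the left end, since the cut lies to the right
    of the midpoint; the other two bounds keep each of the two error terms in the final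
    contradiction within \<open>\<delta> * \<eta> / 8\<close>.\<close>
  define c where "c = min (\<eta> / 2) (min c0 (\<delta> * \<eta> / (8 * R)))"
  have c: "0 < c" using \<eta> c0(1) \<delta>(1) R by (simp add: c_def)
  have cR: "c * R \<le> \<delta> * \<eta> / 8"
  proof -
    have "c \<le> \<delta> * \<eta> / (8 * R)" by (simp add: c_def)
    then show ?thesis using R by (simp add: field_simps)
  qed
  have "\<exists>m. a + c \<le> m \<and> m \<le> b - c \<and> closed_segment (slope F a m) (slope F m b) \<inter> K = {}"
    if ab: "0 \<le> a" "b \<le> 1" "\<eta> \<le> b - a"
      and cross: "closed_segment (slope F a b) (slope F a ((a + b) / 2)) \<inter> K \<noteq> {}" for a b
  proof -
    define x where "x = slope F a b"
    define m0 where "m0 = (a + b) / 2"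
    have m0: "a < m0" "m0 < b" "\<eta> / 2 \<le> m0 - a" using ab \<eta> by (auto simp: m0_def field_simps)
    have xV: "x \<notin> V" using avoid[of a b] ab \<eta> by (simp add: x_def)
    have bd: "norm (slope F a m) \<le> R" if m: "m \<in> {m0..b}" for m
    proof -
      have "norm (F m - F a) \<le> 2 * M"
        using norm_triangle_ineq4[of "F m" "F a"] M(2)[of m] M(2)[of a] m ab m0 by auto
      then have "norm (slope F a m) \<le> 2 * M / (m - a)"
        using m m0 by (simp add: slope_def divide_right_mono)
      also have "\<dots> \<le> 2 * M / (\<eta> / 2)" using m m0 \<eta> M by (intro divide_left_mono) auto
      finally show ?thesis by (simp add: R_def)
    qed
    have xR: "norm x \<le> R" using bd[of b] m0 by (simp add: x_def)
    have far: "\<delta> \<le> dist (slope F a b) (slope F a m)"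
      if m: "m \<in> {m0..b}" "closed_segment (slope F a b) (slope F a m) \<inter> K \<noteq> {}" for m
    proof -
      obtain k where k: "k \<in> K" "k \<in> closed_segment x (slope F a m)" using m(2) by (auto simp: x_def)
      have "closed_segment x (slope F a m) \<subseteq> cball 0 R" using bd[OF m(1)] xR by (intro closed_segment_subset) auto
      then have "\<delta> \<le> dist k x" using \<delta>(2)[of k x] k xV by auto
      also have "\<dots> \<le> dist x (slope F a m)"
        using segment_bound(1)[OF k(2)] by (simp add: dist_norm norm_minus_commute)
      finally show ?thesis by (simp add: x_def)
    qed
    have contF: "continuous_on {a..b} F" by (rule continuous_on_subset[OF F]) (use ab in auto)
    have "slope F a b \<notin> K" using xV V(2) by (auto simp: x_def)
    from crossing_split[OF contF m0(1,2) K this cross[folded m0_def] far \<delta>(1)]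
    obtain m where m: "m0 \<le> m" "m < b" "closed_segment (slope F a m) (slope F m b) \<inter> K = {}"
      "\<delta> / 2 \<le> dist (slope F a b) (slope F a m)" by blast
    have "m \<le> b - c"
    proof (rule ccontr)
      assume "\<not> m \<le> b - c"
      then have bm: "b - m < c" by simp
      have am: "a < m" using m0 m by simp
      have 1: "(b - a) *\<^sub>R x = F b - F a" using ab \<eta> by (simp add: x_def slope_def)
      have 2: "(m - a) *\<^sub>R slope F a m = F m - F a" using am by (simp add: slope_def)
      have 3: "(b - a) *\<^sub>R (x - y) = (b - a) *\<^sub>R x - (m - a) *\<^sub>R y - (b - m) *\<^sub>R y" for y
        by (simp add: algebra_simps)
      have eq: "(b - a) *\<^sub>R (x - slope F a m) = (F b - F m) - (b - m) *\<^sub>R slope F a m"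
        unfolding 3 1 2 by simp
      have ba: "0 \<le> b - a" using ab \<eta> by simp
      have "\<eta> * (\<delta> / 2) \<le> (b - a) * norm (x - slope F a m)"
        using m(4) ab \<eta> \<delta> by (intro mult_mono) (auto simp: x_def dist_norm)
      also have "\<dots> = norm ((F b - F m) - (b - m) *\<^sub>R slope F a m)"
        unfolding eq[symmetric] using ba by simp
      also have "\<dots> \<le> norm (F b - F m) + (b - m) * norm (slope F a m)"
        using norm_triangle_ineq4[of "F b - F m" "(b - m) *\<^sub>R slope F a m"] m(2) by simp
      also have "\<dots> < \<delta> * \<eta> / 8 + \<delta> * \<eta> / 8"
      proof (rule add_less_le_mono)
        show "norm (F b - F m) < \<delta> * \<eta> / 8"
          using c0(2)[of m b] bm m m0 ab by (simp add: dist_norm c_def)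
        have "(b - m) * norm (slope F a m) \<le> c * R" using bm m bd[of m] R by (intro mult_mono) auto
        then show "(b - m) * norm (slope F a m) \<le> \<delta> * \<eta> / 8" using cR by simp
      qed
      also have "\<dots> = \<eta> * (\<delta> / 4)" by simp
      finally show False using \<eta> \<delta>(1) by simp
    qed
    moreover have "a + c \<le> m" using m(1) m0(3) by (simp add: c_def)
    ultimately show ?thesis using m(3) by blast
  qed
  then show ?thesis using that[OF c] by blast
qed

text \<open>If the segment from the total average to the average over the left half meets
  \<open>K\<close>, \<open>uniform_left_split\<close> applies; if the segment on the right does, it
  applies after time reversal; if neither does, the midpoint is a suitable cut.\<close>

lemma uniform_split:
  fixes F :: "real \<Rightarrow> 'a::euclidean_space"
  assumes F: "continuous_on {0..1} F" and K: "closed K" "convex K" and V: "open V" "K \<subseteq> V"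
    and avoid: "\<And>s r. 0 \<le> s \<Longrightarrow> s < r \<Longrightarrow> r \<le> 1 \<Longrightarrow> slope F s r \<notin> V" and \<eta>: "0 < \<eta>"
  obtains c where "0 < c" "\<forall>a b. 0 \<le> a \<and> b \<le> 1 \<and> \<eta> \<le> b - a \<longrightarrow>
      (\<exists>m. a + c \<le> m \<and> m \<le> b - c \<and> closed_segment (slope F a m) (slope F m b) \<inter> K = {})"
proof -
  \<comment> \<open>A primitive of the time-reversed function.\<close>
  define F' where "F' t = - F (1 - t)" for t
  have slope': "slope F' s r = slope F (1 - r) (1 - s)" for s r by (simp add: slope_def F'_def)
  have F': "continuous_on {0..1} F'"
    unfolding F'_def by (intro continuous_intros continuous_on_compose2[OF F]) auto
  obtain c1 where c1: "0 < c1" "\<forall>a b. 0 \<le> a \<and> b \<le> 1 \<and> \<eta> \<le> b - a \<and>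
      closed_segment (slope F a b) (slope F a ((a + b) / 2)) \<inter> K \<noteq> {} \<longrightarrow>
      (\<exists>m. a + c1 \<le> m \<and> m \<le> b - c1 \<and> closed_segment (slope F a m) (slope F m b) \<inter> K = {})"
    using uniform_left_split[OF F K V avoid \<eta>] by blast
  have avoid': "slope F' s r \<notin> V" if "0 \<le> s" "s < r" "r \<le> 1" for s r
    unfolding slope' by (rule avoid) (use that in auto)
  obtain c2 where c2: "0 < c2" "\<forall>a b. 0 \<le> a \<and> b \<le> 1 \<and> \<eta> \<le> b - a \<and>
      closed_segment (slope F' a b) (slope F' a ((a + b) / 2)) \<inter> K \<noteq> {} \<longrightarrow>
      (\<exists>m. a + c2 \<le> m \<and> m \<le> b - c2 \<and> closed_segment (slope F' a m) (slope F' m b) \<inter> K = {})"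
    using uniform_left_split[OF F' K V avoid' \<eta>] by blast
  define c where "c = min (\<eta> / 2) (min c1 c2)"
  have "\<exists>m. a + c \<le> m \<and> m \<le> b - c \<and> closed_segment (slope F a m) (slope F m b) \<inter> K = {}"
    if ab: "0 \<le> a" "b \<le> 1" "\<eta> \<le> b - a" for a b
  proof -
    define m0 where "m0 = (a + b) / 2"
    have am: "a < m0" "m0 < b" using ab \<eta> by (auto simp: m0_def)
    consider (left) "closed_segment (slope F a b) (slope F a m0) \<inter> K \<noteq> {}"
      | (right) "closed_segment (slope F a b) (slope F m0 b) \<inter> K \<noteq> {}"
      | (none) "closed_segment (slope F a b) (slope F a m0) \<inter> K = {}" "closed_segment (slope F a b) (slope F m0 b) \<inter> K = {}"
      by blast
    then show ?thesis
    proof cases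
      case left
      then obtain m where "a + c1 \<le> m" "m \<le> b - c1" "closed_segment (slope F a m) (slope F m b) \<inter> K = {}"
        using c1(2) ab unfolding m0_def by blast
      then show ?thesis by (intro exI[of _ m]) (auto simp: c_def)
    next
      case right
      have "1 - ((1 - b) + (1 - a)) / 2 = m0" by (simp add: m0_def field_simps)
      then have "closed_segment (slope F' (1 - b) (1 - a)) (slope F' (1 - b) (((1 - b) + (1 - a)) / 2)) \<inter> K \<noteq> {}"
        using right unfolding slope' by simp
      moreover have "0 \<le> 1 - b \<and> 1 - a \<le> 1 \<and> \<eta> \<le> (1 - a) - (1 - b)" using ab by simp
      ultimately obtain m where m: "1 - b + c2 \<le> m" "m \<le> 1 - a - c2"
          "closed_segment (slope F' (1 - b) m) (slope F' m (1 - a)) \<inter> K = {}"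
        using c2(2) by blast
      then have "closed_segment (slope F a (1 - m)) (slope F (1 - m) b) \<inter> K = {}"
        by (simp add: slope' closed_segment_commute)
      then show ?thesis using m by (intro exI[of _ "1 - m"]) (auto simp: c_def)
    next
      case none
      have "slope F a b \<in> closed_segment (slope F a m0) (slope F m0 b)"
        using slope_split[OF am, of F] am by (auto simp: in_segment intro!: exI[of _ "(b - m0) / (b - a)"])
      then have "closed_segment (slope F a m0) (slope F m0 b) = closed_segment (slope F a m0) (slope F a b) \<union> closed_segment (slope F a b) (slope F m0 b)"
        by (rule Un_closed_segment[symmetric])
      then have "closed_segment (slope F a m0) (slope F m0 b) \<inter> K = {}"
        using none by (auto simp: closed_segment_commute)
      moreover have "a + \<eta> / 2 \<le> m0" "m0 \<le> b - \<eta> / 2" using ab by (auto simp: m0_def field_simps)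
      then have "a + c \<le> m0" "m0 \<le> b - c" unfolding c_def by linarith+
      ultimately show ?thesis by blast
    qed
  qed
  moreover have "0 < c" using c1 c2 \<eta> by (simp add: c_def)
  ultimately show ?thesis using that by blast
qed

section \<open>Averages in convex sets and Lebesgue points\<close>

lemma integral_average_in_convex:
  fixes \<phi> :: "real \<Rightarrow> 'a::euclidean_space"
  assumes S: "closed S" "convex S" and ab: "a < b" and \<phi>: "\<phi> integrable_on {a..b}" "\<And>t. t \<in> {a..b} \<Longrightarrow> \<phi> t \<in> S"
  shows "(1 / (b - a)) *\<^sub>R integral {a..b} \<phi> \<in> S"
proof (rule ccontr)
  assume "\<not> ?thesis"
  then obtain \<nu> \<beta> where \<nu>: "\<nu> \<bullet> ((1 / (b - a)) *\<^sub>R integral {a..b} \<phi>) < \<beta>" "\<forall>y\<in>S. \<beta> < \<nu> \<bullet> y"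
    using separating_hyperplane_closed_point[OF S(2,1)] by blast
  have 1: "((\<lambda>t. \<nu> \<bullet> \<phi> t) has_integral \<nu> \<bullet> integral {a..b} \<phi>) {a..b}"
    using has_integral_linear[OF integrable_integral[OF \<phi>(1)] bounded_linear_inner_right[of \<nu>]] by (simp add: o_def)
  have 2: "((\<lambda>t. \<beta>) has_integral (b - a) * \<beta>) {a..b}" using has_integral_const_real[of \<beta> a b] ab by simp
  have "(b - a) * \<beta> \<le> \<nu> \<bullet> integral {a..b} \<phi>"
    by (rule has_integral_le[OF 2 1]) (use \<nu>(2) \<phi>(2) in \<open>auto intro: less_imp_le\<close>)
  moreover have "\<nu> \<bullet> integral {a..b} \<phi> < (b - a) * \<beta>"
    using \<nu>(1) ab by (simp add: pos_divide_less_eq mult.commute)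
  ultimately show False by simp
qed

lemma simple_fun_if:
  assumes "simple_fun g" "simple_fun h" shows "simple_fun (\<lambda>t. if t < m then g t else h t)"
proof -
  have [measurable]: "g \<in> borel_measurable borel" "h \<in> borel_measurable borel"
    using assms by (auto simp: simple_fun_def)
  have "(\<lambda>t. if t < m then g t else h t) \<in> borel_measurable borel" by measurable
  moreover have "finite (range (\<lambda>t. if t < m then g t else h t))"
    by (rule finite_subset[of _ "range g \<union> range h"]) (use assms in \<open>auto simp: simple_fun_def\<close>)
  ultimately show ?thesis by (simp add: simple_fun_def)
qed

lemma simple_fun_lebesgue_measurable: "simple_fun g \<Longrightarrow> g \<in> borel_measurable lebesgue"
  by (auto simp: simple_fun_def intro!: measurable_completion)

lemma integral_interval_slope:
  fixes \<phi> :: "real \<Rightarrow> 'a::euclidean_space"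
  assumes "\<phi> integrable_on {0..1}" "0 \<le> a" "a \<le> b" "b \<le> 1"
  shows "integral {a..b} \<phi> = integral {0..b} \<phi> - integral {0..a} \<phi>"
proof -
  have "\<phi> integrable_on {0..b}" by (rule integrable_on_subinterval[OF assms(1)]) (use assms in auto)
  from Henstock_Kurzweil_Integration.integral_combine[OF assms(2,3) this] show ?thesis by (simp add: algebra_simps)
qed

text \<open>One-sided differentiation is applied to \<open>\<phi>\<close> and to its reflection. An
  interval containing \<open>t\<close> is split at \<open>t\<close> and the two errors are weighted
  with the lengths of the parts, which covers off-centre intervals.\<close>

lemma lebesgue_points:
  fixes \<phi> :: "real \<Rightarrow> 'a::euclidean_space"
  assumes \<phi>: "\<phi> integrable_on {0..1}"
  obtains N where "negligible N" "\<forall>t\<in>{0<..<1} - N. \<forall>e>0. \<exists>d>0. \<forall>a b.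
     0 \<le> a \<and> a \<le> t \<and> t < b \<and> b \<le> 1 \<and> b - a < d \<longrightarrow> dist (slope (\<lambda>t. integral {0..t} \<phi>) a b) (\<phi> t) < e"
proof -
  define F where "F t = integral {0..t} \<phi>" for t
  define f0 where "f0 t = (if t \<in> {0..1} then \<phi> t else 0)" for t
  define f1 where "f1 t = f0 (- t)" for t
  have "f0 integrable_on UNIV" using \<phi> unfolding f0_def by (simp only: integrable_restrict_UNIV)
  then have f0: "f0 integrable_on cbox a b" for a b by (rule integrable_on_subcbox) auto
  have f1: "f1 integrable_on cbox a b" for a b
    using f0[of "-b" "-a"] Henstock_Kurzweil_Integration.integrable_reflect_real[where f = f0 and a = "-b" and b = "-a"] by (simp add: f1_def[abs_def])
  obtain N1 where N1: "negligible N1" "\<And>x e. \<lbrakk>x \<notin> N1; 0 < e\<rbrakk> \<Longrightarrow>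
     \<exists>d>0. \<forall>h. 0 < h \<and> h < d \<longrightarrow> norm (integral (cbox x (x + h *\<^sub>R One)) f0 /\<^sub>R h ^ DIM(real) - f0 x) < e"
    using integrable_ccontinuous_explicit[of f0] f0 by blast
  obtain N2 where N2: "negligible N2" "\<And>x e. \<lbrakk>x \<notin> N2; 0 < e\<rbrakk> \<Longrightarrow>
     \<exists>d>0. \<forall>h. 0 < h \<and> h < d \<longrightarrow> norm (integral (cbox x (x + h *\<^sub>R One)) f1 /\<^sub>R h ^ DIM(real) - f1 x) < e"
    using integrable_ccontinuous_explicit[of f1] f1 by blast
  have f0int: "integral {a..b} f0 = F b - F a" if "0 \<le> a" "a \<le> b" "b \<le> 1" for a b
  proof -
    have "integral {a..b} f0 = integral {a..b} \<phi>"
      by (rule Henstock_Kurzweil_Integration.integral_cong) (use that in \<open>auto simp: f0_def\<close>)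
    then show ?thesis using integral_interval_slope[OF \<phi> that] by (simp add: F_def)
  qed
  have "negligible (uminus ` N2)" using N2(1)
    by (intro negligible_differentiable_image_negligible) (auto intro!: derivative_intros)
  then have "negligible (N1 \<union> uminus ` N2)" using N1(1) by (rule negligible_Un[rotated])
  moreover have "\<exists>d>0. \<forall>a b. 0 \<le> a \<and> a \<le> t \<and> t < b \<and> b \<le> 1 \<and> b - a < d \<longrightarrow> dist (slope F a b) (\<phi> t) < e"
    if t: "t \<in> {0<..<1} - (N1 \<union> uminus ` N2)" and e: "0 < e" for t e
  proof -
    have t01: "0 < t" "t < 1" using t by auto
    have tN: "t \<notin> N1" "- t \<notin> N2" using t by force+
    have f0t: "f0 t = \<phi> t" using t01 by (simp add: f0_def)
    have e2: "0 < e / 2" using e by simp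
    obtain d1 where d1: "0 < d1" "\<And>h. 0 < h \<Longrightarrow> h < d1 \<Longrightarrow> norm (integral {t..t + h} f0 /\<^sub>R h - \<phi> t) < e / 2"
      using N1(2)[OF tN(1) e2] f0t by auto
    obtain d2 where d2: "0 < d2" "\<And>h. 0 < h \<Longrightarrow> h < d2 \<Longrightarrow> norm (integral {- t..- t + h} f1 /\<^sub>R h - \<phi> t) < e / 2"
      using N2(2)[OF tN(2) e2] f0t by (auto simp: f1_def)
    have right: "norm (F b - F t - (b - t) *\<^sub>R \<phi> t) \<le> e / 2 * (b - t)" if b: "t < b" "b \<le> 1" "b - t < d1" for b
    proof -
      have "norm ((F b - F t) /\<^sub>R (b - t) - \<phi> t) \<le> e / 2"
        using d1(2)[of "b - t"] f0int[of t b] b t01 by simp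
      then have "(b - t) * norm ((F b - F t) /\<^sub>R (b - t) - \<phi> t) \<le> (b - t) * (e / 2)"
        using b by (intro mult_left_mono) auto
      moreover have "F b - F t - (b - t) *\<^sub>R \<phi> t = (b - t) *\<^sub>R ((F b - F t) /\<^sub>R (b - t) - \<phi> t)"
        using b by (simp add: scaleR_diff_right)
      ultimately show ?thesis using b by (simp add: mult.commute)
    qed
    have left: "norm (F t - F a - (t - a) *\<^sub>R \<phi> t) \<le> e / 2 * (t - a)" if a: "a \<le> t" "0 \<le> a" "t - a < d2" for a
    proof (cases "a = t")
      case False
      then have at: "a < t" using a by simp
      have "integral {- t..- a} f1 = integral {a..t} f0"
        using integral_reflect_real[where f = f0 and a = a and b = t] by (simp add: f1_def[abs_def])
      then have "norm ((F t - F a) /\<^sub>R (t - a) - \<phi> t) \<le> e / 2"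
        using d2(2)[of "t - a"] f0int[of a t] a at t01 by simp
      then have "(t - a) * norm ((F t - F a) /\<^sub>R (t - a) - \<phi> t) \<le> (t - a) * (e / 2)"
        using at by (intro mult_left_mono) auto
      moreover have "F t - F a - (t - a) *\<^sub>R \<phi> t = (t - a) *\<^sub>R ((F t - F a) /\<^sub>R (t - a) - \<phi> t)"
        using at by (simp add: scaleR_diff_right)
      ultimately show ?thesis using at by (simp add: mult.commute)
    qed simp
    show ?thesis
    proof (intro exI[of _ "min d1 d2"] conjI allI impI)
      fix a b assume ab: "0 \<le> a \<and> a \<le> t \<and> t < b \<and> b \<le> 1 \<and> b - a < min d1 d2"
      define y where "y = (F b - F t - (b - t) *\<^sub>R \<phi> t) + (F t - F a - (t - a) *\<^sub>R \<phi> t)"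
      have "norm y \<le> e / 2 * (b - t) + e / 2 * (t - a)"
        unfolding y_def using right[of b] left[of a] ab by (intro order_trans[OF norm_triangle_ineq] add_mono) auto
      also have "\<dots> = e / 2 * (b - a)" by (simp add: algebra_simps add_divide_distrib diff_divide_distrib)
      finally have "norm y \<le> e / 2 * (b - a)" .
      moreover have "slope F a b - \<phi> t = (1 / (b - a)) *\<^sub>R y"
      proof -
        have "y = (F b - F a) - (b - a) *\<^sub>R \<phi> t" by (simp add: y_def algebra_simps)
        then show ?thesis using ab by (simp add: slope_def scaleR_diff_right)
      qed
      ultimately have "dist (slope F a b) (\<phi> t) \<le> e / 2" using ab by (simp add: dist_norm pos_divide_le_eq)
      then show "dist (slope F a b) (\<phi> t) < e" using e by simp
    qed (use d1 d2 in auto)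
  qed
  ultimately show ?thesis using that unfolding F_def by blast
qed

section \<open>Concavity summed over fine partitions\<close>

lemma shifted_concave:
  fixes ga gb gc :: ereal
  assumes uv: "0 \<le> u" "0 \<le> v" "u + v = 1" and m: "ereal m \<le> ga" "ereal m \<le> gb"
    and c: "ereal u * ga + ereal v * gb \<le> gc"
  shows "ennreal u * e2ennreal (ga - ereal m) + ennreal v * e2ennreal (gb - ereal m) \<le> e2ennreal (gc - ereal m)"
proof -
  consider "u = 0" | "v = 0" | "0 < u" "0 < v" using uv by force
  then show ?thesis
  proof cases
    case 1
    then have "gb \<le> gc" using c uv by (simp flip: zero_ereal_def one_ereal_def)
    then show ?thesis using 1 uv by (simp add: e2ennreal_mono ereal_minus_mono)
  next
    case 2
    then have "ga \<le> gc" using c uv by (simp flip: zero_ereal_def one_ereal_def)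
    then show ?thesis using 2 uv by (simp add: e2ennreal_mono ereal_minus_mono)
  next
    case 3
    show ?thesis
    proof (cases "gc = \<infinity>")
      case False
      \<comment> \<open>With both weights positive, an infinite value on the left would force
        \<open>gc\<close> to be infinite.\<close>
      have "ga \<noteq> \<infinity>" "gb \<noteq> \<infinity>" using c 3 m False by auto
      then obtain a b where ab: "ga = ereal a" "gb = ereal b" using m by (cases ga; cases gb) auto
      then obtain k where k: "gc = ereal k" using c False by (cases gc) auto
      have "u * (a - m) + v * (b - m) = u * a + v * b - (u + v) * m" by (simp add: algebra_simps)
      then have "u * (a - m) + v * (b - m) \<le> k - m" using c uv(3) by (simp add: ab k)
      then show ?thesis using m uv by (simp add: ab k ennreal_leI flip: ennreal_mult ennreal_plus)
    qed (simp add: top_greatest)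
  qed
qed

text \<open>\<open>h t\<close> holds the endpoints of the partition interval containing
  \<open>t\<close>, so the integral is the sum of the lengths times the values of
  \<open>\<Gamma>\<close> at the averages. Each cut yields parts shorter by at least
  \<open>c\<close>, hence the induction on the number \<open>n\<close> of steps of size
  \<open>c\<close> by which the length may exceed \<open>\<eta>\<close>.\<close>

lemma fine_partition:
  fixes F :: "real \<Rightarrow> 'a::euclidean_space" and \<Gamma> :: "'a \<Rightarrow> ennreal"
  assumes conc: "\<And>y z u v. closed_segment y z \<subseteq> X \<Longrightarrow> 0 \<le> u \<Longrightarrow> 0 \<le> v \<Longrightarrow> u + v = 1 \<Longrightarrow>
      ennreal u * \<Gamma> y + ennreal v * \<Gamma> z \<le> \<Gamma> (u *\<^sub>R y + v *\<^sub>R z)"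
    and c: "0 < c" and split: "\<And>a b. 0 \<le> a \<Longrightarrow> b \<le> 1 \<Longrightarrow> \<eta> \<le> b - a \<Longrightarrow>
      \<exists>m. a + c \<le> m \<and> m \<le> b - c \<and> closed_segment (slope F a m) (slope F m b) \<subseteq> X"
    and ab: "0 \<le> a" "a < b" "b \<le> 1" "b - a \<le> \<eta> + real n * c"
  shows "\<exists>h. simple_fun h \<and> (\<forall>t\<in>{a..<b}. a \<le> fst (h t) \<and> fst (h t) \<le> t \<and> t < snd (h t) \<and> snd (h t) \<le> b \<and> snd (h t) - fst (h t) \<le> \<eta>) \<and>
     (\<integral>\<^sup>+t\<in>{a..<b}. \<Gamma> (slope F (fst (h t)) (snd (h t))) \<partial>lebesgue) \<le> ennreal (b - a) * \<Gamma> (slope F a b)"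
  using ab
proof (induction n arbitrary: a b)
  case 0
  have "simple_fun (\<lambda>t::real. (a, b))" by (simp add: simple_fun_def)
  moreover have "(\<integral>\<^sup>+t\<in>{a..<b}. \<Gamma> (slope F a b) \<partial>lebesgue) = ennreal (b - a) * \<Gamma> (slope F a b)"
    using 0 by (simp add: nn_integral_cmult_indicator) (simp add: mult.commute)
  ultimately show ?case using 0 by (intro exI[of _ "\<lambda>t. (a, b)"]) auto
next
  case (Suc n)
  show ?case
  proof (cases "b - a \<le> \<eta> + real n * c")
    case True
    then show ?thesis using Suc by blast
  next
    case False
    have "0 \<le> real n * c" using c by simp
    then have "\<eta> \<le> b - a" using False by linarith
    from split[OF Suc.prems(1,3) this] obtain m where m: "a + c \<le> m" "m \<le> b - c"
      "closed_segment (slope F a m) (slope F m b) \<subseteq> X" by blast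
    have am: "a < m" "m < b" using m c by auto
    have "b - a \<le> \<eta> + real n * c + c" using Suc.prems by (simp add: algebra_simps)
    then have len: "m - a \<le> \<eta> + real n * c" "b - m \<le> \<eta> + real n * c" using m by auto
    obtain h1 where h1: "simple_fun h1" "\<forall>t\<in>{a..<m}. a \<le> fst (h1 t) \<and> fst (h1 t) \<le> t \<and> t < snd (h1 t) \<and> snd (h1 t) \<le> m \<and> snd (h1 t) - fst (h1 t) \<le> \<eta>"
      "(\<integral>\<^sup>+t\<in>{a..<m}. \<Gamma> (slope F (fst (h1 t)) (snd (h1 t))) \<partial>lebesgue) \<le> ennreal (m - a) * \<Gamma> (slope F a m)"
      using Suc.IH[of a m] Suc.prems am len by auto
    obtain h2 where h2: "simple_fun h2" "\<forall>t\<in>{m..<b}. m \<le> fst (h2 t) \<and> fst (h2 t) \<le> t \<and> t < snd (h2 t) \<and> snd (h2 t) \<le> b \<and> snd (h2 t) - fst (h2 t) \<le> \<eta>"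
      "(\<integral>\<^sup>+t\<in>{m..<b}. \<Gamma> (slope F (fst (h2 t)) (snd (h2 t))) \<partial>lebesgue) \<le> ennreal (b - m) * \<Gamma> (slope F m b)"
      using Suc.IH[of m b] Suc.prems am len by auto
    define h where "h t = (if t < m then h1 t else h2 t)" for t
    have "simple_fun h" unfolding h_def[abs_def] by (rule simple_fun_if[OF h1(1) h2(1)])
    moreover have "a \<le> fst (h t) \<and> fst (h t) \<le> t \<and> t < snd (h t) \<and> snd (h t) \<le> b \<and> snd (h t) - fst (h t) \<le> \<eta>" if "t \<in> {a..<b}" for t
    proof (cases "t < m")
      case True
      then have "t \<in> {a..<m}" using that by auto
      from h1(2)[rule_format, OF this] show ?thesis using True am by (simp add: h_def)
    next
      case False
      then have "t \<in> {m..<b}" using that by auto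
      from h2(2)[rule_format, OF this] show ?thesis using False am by (simp add: h_def)
    qed
    moreover have "(\<integral>\<^sup>+t\<in>{a..<b}. \<Gamma> (slope F (fst (h t)) (snd (h t))) \<partial>lebesgue) \<le> ennreal (b - a) * \<Gamma> (slope F a b)"
    proof -
      let ?k = "\<lambda>h t. \<Gamma> (slope F (fst (h t)) (snd (h t)))"
      have meas: "?k h1 \<in> borel_measurable lebesgue" "?k h2 \<in> borel_measurable lebesgue"
        using simple_fun_lebesgue_measurable[OF simple_fun_comp[OF h1(1), of "\<lambda>p. \<Gamma> (slope F (fst p) (snd p))"]]
          simple_fun_lebesgue_measurable[OF simple_fun_comp[OF h2(1), of "\<lambda>p. \<Gamma> (slope F (fst p) (snd p))"]] by auto
      have "(\<integral>\<^sup>+t\<in>{a..<b}. ?k h t \<partial>lebesgue) = (\<integral>\<^sup>+t. ?k h1 t * indicator {a..<m} t + ?k h2 t * indicator {m..<b} t \<partial>lebesgue)"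
        by (intro nn_integral_cong) (use am in \<open>auto simp: h_def indicator_def\<close>)
      also have "\<dots> = (\<integral>\<^sup>+t\<in>{a..<m}. ?k h1 t \<partial>lebesgue) + (\<integral>\<^sup>+t\<in>{m..<b}. ?k h2 t \<partial>lebesgue)"
        by (intro nn_integral_add borel_measurable_times_ennreal meas borel_measurable_indicator) auto
      also have "\<dots> \<le> ennreal (m - a) * \<Gamma> (slope F a m) + ennreal (b - m) * \<Gamma> (slope F m b)"
        by (intro add_mono h1(3) h2(3))
      also have "\<dots> = ennreal (b - a) * (ennreal (1 - (b - m) / (b - a)) * \<Gamma> (slope F a m) + ennreal ((b - m) / (b - a)) * \<Gamma> (slope F m b))"
      proof -
        have "1 - (b - m) / (b - a) = (m - a) / (b - a)" using am by (simp add: diff_divide_eq_iff)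
        then have "ennreal (b - a) * ennreal (1 - (b - m) / (b - a)) = ennreal (m - a)"
          using am by (simp flip: ennreal_mult)
        moreover have "ennreal (b - a) * ennreal ((b - m) / (b - a)) = ennreal (b - m)"
          using am by (simp flip: ennreal_mult)
        ultimately show ?thesis by (simp add: distrib_left flip: mult.assoc)
      qed
      also have "\<dots> \<le> ennreal (b - a) * \<Gamma> (slope F a b)"
        unfolding slope_split[OF am, of F] by (intro mult_left_mono conc m(3)) (use am in auto)
      finally show ?thesis .
    qed
    ultimately show ?thesis by blast
  qed
qed

section \<open>Boundary behaviour of locally concave majorants\<close>

context convex_annulus
begin

lemma segment_lower_bound:
  assumes lc: "locally_concave_on annulus G" and seg: "closed_segment p q \<subseteq> annulus"
    and pq: "ereal e \<le> G p" "ereal e \<le> G q" and z: "z \<in> closed_segment p q"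
  shows "ereal e \<le> G z"
proof -
  obtain u where u: "0 \<le> u" "u \<le> 1" "z = (1 - u) *\<^sub>R p + u *\<^sub>R q" using z by (auto simp: in_segment)
  have "ereal_concave_on (closed_segment p q) G" using lc seg by (auto simp: locally_concave_on_def)
  then have "ereal (1 - u) * G p + ereal u * G q \<le> G z"
    using u unfolding ereal_concave_on_def by auto
  moreover have "ereal (1 - u) * ereal e + ereal u * ereal e \<le> ereal (1 - u) * G p + ereal u * G q"
    using u pq by (intro add_mono ereal_mult_left_mono) auto
  moreover have "ereal (1 - u) * ereal e + ereal u * ereal e = ereal e" by (simp add: algebra_simps)
  ultimately show ?thesis by simp
qed

text \<open>A chord through \<open>z\<close> carries the lower bound for \<open>f\<close> from its
  endpoints to \<open>z\<close>.\<close>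

lemma majorant_lower_bound:
  assumes G: "G \<in> locally_concave_majorants annulus f" and m: "\<And>y. y \<in> frontier \<Omega>\<^sub>0 \<Longrightarrow> m \<le> f y" and z: "z \<in> annulus"
  shows "ereal m \<le> G z"
proof -
  obtain p q where pq: "p \<in> frontier \<Omega>\<^sub>0" "q \<in> frontier \<Omega>\<^sub>0" "z \<in> closed_segment p q" "closed_segment p q \<subseteq> annulus"
    using chord[OF z] .
  have fb: "ereal m \<le> G y" if "y \<in> frontier \<Omega>\<^sub>0" for y
  proof -
    have "ereal m \<le> ereal (f y)" using m that by simp
    also have "\<dots> \<le> G y" using G that by (simp add: locally_concave_majorants_def fixed_boundary_annulus)
    finally show ?thesis .
  qed
  show ?thesis
    by (rule segment_lower_bound[OF _ pq(4) fb[OF pq(1)] fb[OF pq(2)] pq(3)])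
       (use G in \<open>simp add: locally_concave_majorants_def\<close>)
qed

text \<open>Points near \<open>y\<close> lie on chords with both endpoints near \<open>y\<close>,
  where lower semicontinuity keeps \<open>f\<close> above \<open>e\<close>.\<close>

lemma majorant_lower_semicontinuous:
  assumes G: "G \<in> locally_concave_majorants annulus f" and f: "lower_semicontinuous_on (frontier \<Omega>\<^sub>0) f"
    and y: "y \<in> frontier \<Omega>\<^sub>0" and e: "e < f y"
  obtains \<eta> where "0 < \<eta>" "\<forall>z\<in>annulus. dist z y < \<eta> \<longrightarrow> ereal e \<le> G z"
proof -
  have "\<forall>\<^sub>F w in at y within frontier \<Omega>\<^sub>0. e < f w" using f y e by (auto simp: lower_semicontinuous_on_def)
  then obtain \<rho> where \<rho>: "0 < \<rho>" "\<And>w. w \<in> frontier \<Omega>\<^sub>0 \<Longrightarrow> w \<noteq> y \<Longrightarrow> dist w y < \<rho> \<Longrightarrow> e < f w"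
    by (auto simp: eventually_at)
  have fb: "ereal e \<le> G w" if w: "w \<in> frontier \<Omega>\<^sub>0 \<inter> ball y \<rho>" for w
  proof -
    have "e \<le> f w" using \<rho>(2)[of w] w e by (cases "w = y") (auto simp: dist_commute)
    then have "ereal e \<le> ereal (f w)" by simp
    also have "\<dots> \<le> G w" using G w by (simp add: locally_concave_majorants_def fixed_boundary_annulus)
    finally show ?thesis .
  qed
  obtain \<eta> where \<eta>: "0 < \<eta>" "\<forall>z\<in>closure \<Omega>\<^sub>0 \<inter> ball y \<eta>. \<exists>p\<in>frontier \<Omega>\<^sub>0 \<inter> ball y \<rho>. \<exists>q\<in>frontier \<Omega>\<^sub>0 \<inter> ball y \<rho>.
     z \<in> closed_segment p q \<and> closed_segment p q \<subseteq> annulus"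
    using short_chord[OF y \<rho>(1)] .
  have "ereal e \<le> G z" if z: "z \<in> annulus" "dist z y < \<eta>" for z
  proof -
    have "z \<in> closure \<Omega>\<^sub>0 \<inter> ball y \<eta>" using z by (auto simp: dist_commute)
    then obtain p q where pq: "p \<in> frontier \<Omega>\<^sub>0 \<inter> ball y \<rho>" "q \<in> frontier \<Omega>\<^sub>0 \<inter> ball y \<rho>"
      "z \<in> closed_segment p q" "closed_segment p q \<subseteq> annulus" using \<eta>(2) by blast
    show ?thesis
      by (rule segment_lower_bound[OF _ pq(4) fb[OF pq(1)] fb[OF pq(2)] pq(3)])
         (use G in \<open>simp add: locally_concave_majorants_def\<close>)
  qed
  then show ?thesis using that \<eta>(1) by blast
qed

end

text \<open>The identity \<open>ennreal (h t) + ennreal (- m) = ennreal (h t - m) + ennreal (- h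
  t)\<close> is integrated; it relates both parts of \<open>h\<close> to the shifted function
  without subtracting infinite quantities. The negative part has integral at most
  \<open>- m\<close>, hence finite.\<close>

lemma ext_average_shift:
  fixes h :: "real \<Rightarrow> real"
  assumes meas: "(\<lambda>t. indicator circle t * h t) \<in> borel_measurable lebesgue"
    and m: "m \<le> 0" "\<And>t. m \<le> h t"
    and le: "(\<integral>\<^sup>+t\<in>circle. ennreal (h t - m) \<partial>lebesgue) \<le> e2ennreal (g - ereal m)" and g: "ereal m \<le> g"
  shows "ext_average circle h \<le> g"
proof -
  let ?I = "\<lambda>k::real \<Rightarrow> real. \<integral>\<^sup>+t\<in>circle. ennreal (k t) \<partial>lebesgue"
  have mk: "(\<lambda>t. ennreal (k (h t)) * indicator circle t) \<in> borel_measurable lebesgue"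
    if k: "k \<in> borel_measurable borel" for k :: "real \<Rightarrow> real"
  proof -
    have "(\<lambda>t. ennreal (k (indicator circle t * h t)) * indicator circle t) \<in> borel_measurable lebesgue"
      by (intro borel_measurable_times_ennreal measurable_compose[OF measurable_compose[OF meas k] measurable_ennreal] borel_measurable_indicator) auto
    moreover have "(\<lambda>t. ennreal (k (indicator circle t * h t)) * indicator circle t) = (\<lambda>t. ennreal (k (h t)) * indicator circle t)"
      by (auto simp: indicator_def)
    ultimately show ?thesis by simp
  qed
  have c1: "(\<integral>\<^sup>+t\<in>circle. ennreal (- m) \<partial>lebesgue) = ennreal (- m)"
    by (simp add: nn_integral_cmult_indicator)
  have pt: "ennreal (h t) + ennreal (- m) = ennreal (h t - m) + ennreal (- h t)" for t
  proof (cases "0 \<le> h t")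
    case True
    then show ?thesis using m by (simp add: ennreal_neg flip: ennreal_plus)
  next
    case False
    then show ?thesis using m(1) m(2)[of t] by (simp add: ennreal_neg flip: ennreal_plus)
  qed
  have "?I h + (\<integral>\<^sup>+t\<in>circle. ennreal (- m) \<partial>lebesgue) = (\<integral>\<^sup>+t. ennreal (h t) * indicator circle t + ennreal (- m) * indicator circle t \<partial>lebesgue)"
    by (intro nn_integral_add[symmetric] mk[of "\<lambda>y. y"] borel_measurable_times_ennreal borel_measurable_indicator) auto
  also have "\<dots> = (\<integral>\<^sup>+t. ennreal (h t - m) * indicator circle t + ennreal (- h t) * indicator circle t \<partial>lebesgue)"
    by (intro nn_integral_cong) (simp add: pt flip: distrib_right)
  also have "\<dots> = ?I (\<lambda>t. h t - m) + ?I (\<lambda>t. - h t)"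
    by (intro nn_integral_add mk[of "\<lambda>y. y - m"] mk[of uminus]) auto
  finally have eq: "?I h + ennreal (- m) = ?I (\<lambda>t. h t - m) + ?I (\<lambda>t. - h t)" by (simp only: c1)
  have "?I (\<lambda>t. - h t) \<le> (\<integral>\<^sup>+t\<in>circle. ennreal (- m) \<partial>lebesgue)"
    by (intro nn_integral_mono mult_right_mono ennreal_leI) (use m in auto)
  then have "?I (\<lambda>t. - h t) \<le> ennreal (- m)" by (simp only: c1)
  then obtain b where b: "0 \<le> b" "?I (\<lambda>t. - h t) = ennreal b"
    by (cases "?I (\<lambda>t. - h t)") (auto simp: top_unique)
  have "ext_average circle h = enn2ereal (?I h) - enn2ereal (?I (\<lambda>t. - h t))"
    unfolding ext_average_def measure_circle by (simp add: divide_ereal_def flip: one_ereal_def)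
  also have "\<dots> \<le> g"
  proof (cases "g = \<infinity>")
    case False
    then obtain r where r: "g = ereal r" using g by (cases g) auto
    have "?I (\<lambda>t. h t - m) \<le> ennreal (r - m)" using le by (simp add: r)
    then obtain j where j: "0 \<le> j" "?I (\<lambda>t. h t - m) = ennreal j" "j \<le> r - m"
      using g by (cases "?I (\<lambda>t. h t - m)") (auto simp: top_unique r)
    have fin: "?I h + ennreal (- m) = ennreal (j + b)" unfolding eq j(2) b(2) using j b by simp
    then obtain a where a: "0 \<le> a" "?I h = ennreal a" by (cases "?I h") auto
    have "a - m = j + b" using fin a m j b by (simp flip: ennreal_plus)
    then show ?thesis using j a b by (simp add: r)
  qed simp
  finally show ?thesis .
qed

context convex_annulus
begin

text \<open>By lower semicontinuity, the set where \<open>f\<close> exceeds \<open>e\<close> is the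
  trace on the frontier of an open set \<open>W\<close>, whose preimage is measurable.\<close>

lemma composition_measurable:
  assumes f: "lower_semicontinuous_on (frontier \<Omega>\<^sub>0) f" and \<phi>: "set_integrable lebesgue circle \<phi>" "\<And>t. \<phi> t \<in> frontier \<Omega>\<^sub>0"
  shows "(\<lambda>t. indicator circle t * f (\<phi> t) :: real) \<in> borel_measurable lebesgue"
proof (subst borel_measurable_iff_greater, intro allI)
  fix e :: real
  have ex: "\<exists>U. open U \<and> y \<in> U \<and> (\<forall>w\<in>U \<inter> frontier \<Omega>\<^sub>0. e < f w)" if y: "y \<in> frontier \<Omega>\<^sub>0" "e < f y" for y
  proof -
    have "\<forall>\<^sub>F w in at y within frontier \<Omega>\<^sub>0. e < f w" using f y by (auto simp: lower_semicontinuous_on_def)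
    then obtain U where U: "open U" "y \<in> U" "\<forall>w\<in>U. w \<noteq> y \<longrightarrow> w \<in> frontier \<Omega>\<^sub>0 \<longrightarrow> e < f w"
      unfolding eventually_at_topological by blast
    have "\<forall>w\<in>U \<inter> frontier \<Omega>\<^sub>0. e < f w"
    proof
      fix w assume "w \<in> U \<inter> frontier \<Omega>\<^sub>0"
      then show "e < f w" using U(3) y(2) by (cases "w = y") auto
    qed
    then show ?thesis using U(1,2) by blast
  qed
  define W where "W = \<Union>{U. open U \<and> (\<forall>w\<in>U \<inter> frontier \<Omega>\<^sub>0. e < f w)}"
  have W: "open W" unfolding W_def by (intro open_Union) auto
  have Wf: "w \<in> W \<longleftrightarrow> e < f w" if "w \<in> frontier \<Omega>\<^sub>0" for w
  proof
    assume "w \<in> W" then show "e < f w" using that unfolding W_def by blast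
  next
    assume "e < f w" from ex[OF that this] show "w \<in> W" unfolding W_def by blast
  qed
  define \<psi> where "\<psi> t = indicator circle t *\<^sub>R \<phi> t" for t
  have "\<psi> \<in> borel_measurable lebesgue"
    using \<phi>(1) unfolding set_integrable_def \<psi>_def[abs_def] by (rule borel_measurable_integrable)
  then have "\<psi> -` W \<inter> space lebesgue \<in> sets lebesgue" by (rule measurable_sets) (use W in auto)
  then have 1: "circle \<inter> \<psi> -` W \<in> sets lebesgue" by (auto intro: sets.Int)
  \<comment> \<open>Outside the circle the product is 0, which exceeds \<open>e\<close> exactly when
    \<open>e < 0\<close>.\<close>
  have 2: "(if e < 0 then - circle else {}) \<in> sets lebesgue" by (auto simp: Compl_eq_Diff_UNIV)
  have "{t \<in> space lebesgue. e < indicator circle t * f (\<phi> t)} = (circle \<inter> \<psi> -` W) \<union> (if e < 0 then - circle else {})"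
  proof (rule set_eqI)
    fix t :: real
    show "t \<in> {t \<in> space lebesgue. e < indicator circle t * f (\<phi> t)} \<longleftrightarrow> t \<in> (circle \<inter> \<psi> -` W) \<union> (if e < 0 then - circle else {})"
    proof (cases "t \<in> circle")
      case True
      then have "\<psi> t = \<phi> t" "indicator circle t = (1::real)" by (simp_all add: \<psi>_def)
      then show ?thesis using True Wf[OF \<phi>(2)[of t]] by simp
    next
      case False
      then have "indicator circle t = (0::real)" by (rule indicator_simps(2))
      then show ?thesis using False by (cases "e < 0") (simp_all del: atLeastLessThan_iff)
    qed
  qed
  then show "{t \<in> space lebesgue. e < indicator circle t * f (\<phi> t)} \<in> sets lebesgue"
    by (rule ssubst) (rule sets.Un[OF 1 2])
qed

lemma bellman_le_majorant:
  assumes f: "lower_semicontinuous_on (frontier \<Omega>\<^sub>0) f" "bdd_below (f ` frontier \<Omega>\<^sub>0)"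
    and G: "G \<in> locally_concave_majorants annulus f" and \<phi>: "\<phi> \<in> admissible \<Omega>\<^sub>0 \<Omega>\<^sub>1"
  shows "ext_average circle (\<lambda>t. f (\<phi> t)) \<le> G (average circle \<phi>)"
proof -
  obtain V where fr: "\<And>t. \<phi> t \<in> frontier \<Omega>\<^sub>0" and int: "set_integrable lebesgue circle \<phi>"
    and V: "open V" "closure \<Omega>\<^sub>1 \<subseteq> V"
      "\<And>J. is_interval J \<Longrightarrow> bounded J \<Longrightarrow> interior J \<noteq> {} \<Longrightarrow> average J \<phi> \<notin> V"
    using \<phi> by (auto simp: admissible_def)
  obtain m0 where m0: "\<And>y. y \<in> frontier \<Omega>\<^sub>0 \<Longrightarrow> m0 \<le> f y" using f(2) by (auto simp: bdd_below_def)
  \<comment> \<open>Taken nonpositive for the sake of \<open>ext_average_shift\<close>.\<close>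
  define m where "m = min m0 0"
  have m: "m \<le> 0" "\<And>y. y \<in> frontier \<Omega>\<^sub>0 \<Longrightarrow> m \<le> f y" using m0 by (auto simp: m_def intro: min.coboundedI1)
  have Gm: "ereal m \<le> G z" if "z \<in> annulus" for z by (rule majorant_lower_bound[OF G m(2) that])
  have "set_integrable lebesgue ({0..<1} \<union> {1}) \<phi>"
  proof (rule absolutely_integrable_Un[OF int])
    show "set_integrable lebesgue {1} \<phi>"
      by (rule absolutely_integrable_negligible) auto
  qed
  moreover have "{0..<1} \<union> {1} = {0..1::real}" by auto
  ultimately have int01: "set_integrable lebesgue {0..1} \<phi>" by simp
  then have hk: "\<phi> integrable_on {0..1}" by (rule set_lebesgue_integral_eq_integral)
  define F where "F t = integral {0..t} \<phi>" for t
  have av: "average J \<phi> = slope F s r" if "0 \<le> s" "s < r" "r \<le> 1" "{s<..<r} \<subseteq> J" "J \<subseteq> {s..r}" for J s r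
  proof -
    have "set_integrable lebesgue {s..r} \<phi>" by (rule set_integrable_subset[OF int01]) (use that in auto)
    from average_interval[OF that(2,4,5) this] show ?thesis
      using integral_interval_slope[OF hk, of s r] that by (simp add: slope_def F_def)
  qed
  have sl: "slope F s r \<notin> V" "slope F s r \<in> closure \<Omega>\<^sub>0" if "0 \<le> s" "s < r" "r \<le> 1" for s r
  proof -
    have "average {s..r} \<phi> \<notin> V" by (rule V(3)) (use that in \<open>auto simp: is_interval_cc\<close>)
    moreover have "{s<..<r} \<subseteq> {s..r}" by auto
    ultimately show "slope F s r \<notin> V" using av[OF that, of "{s..r}"] by auto
    have "\<phi> integrable_on {s..r}" by (rule integrable_on_subinterval[OF hk]) (use that in auto)
    then have "(1 / (r - s)) *\<^sub>R integral {s..r} \<phi> \<in> closure \<Omega>\<^sub>0"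
      by (rule integral_average_in_convex[OF closed_closure convexC that(2)]) (use fr in \<open>auto simp: frontier0\<close>)
    then show "slope F s r \<in> closure \<Omega>\<^sub>0"
      using integral_interval_slope[OF hk, of s r] that by (simp add: slope_def F_def)
  qed
  have slA: "slope F s r \<in> annulus" if "0 \<le> s" "s < r" "r \<le> 1" for s r
    using sl[OF that] V(2) by blast
  have contF: "continuous_on {0..1} F" unfolding F_def by (rule indefinite_integral_continuous_1[OF hk])
  \<comment> \<open>On the annulus \<open>G\<close> is at least \<open>m\<close>, so
    \<open>e2ennreal\<close> truncates nothing there.\<close>
  define \<Gamma> where "\<Gamma> z = e2ennreal (G z - ereal m)" for z
  have conc: "ennreal u * \<Gamma> y + ennreal v * \<Gamma> z \<le> \<Gamma> (u *\<^sub>R y + v *\<^sub>R z)"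
    if seg: "closed_segment y z \<subseteq> annulus" and uv: "0 \<le> u" "0 \<le> v" "u + v = 1" for y z u v
    unfolding \<Gamma>_def
  proof (rule shifted_concave[OF uv])
    show "ereal m \<le> G y" "ereal m \<le> G z" using seg by (auto intro: Gm)
    have "ereal_concave_on (closed_segment y z) G"
      using G seg by (auto simp: locally_concave_majorants_def locally_concave_on_def)
    then show "ereal u * G y + ereal v * G z \<le> G (u *\<^sub>R y + v *\<^sub>R z)"
      using uv unfolding ereal_concave_on_def by auto
  qed
  have part: "\<exists>h. simple_fun h \<and> (\<forall>t\<in>{0..<1}. 0 \<le> fst (h t) \<and> fst (h t) \<le> t \<and> t < snd (h t) \<and> snd (h t) \<le> 1 \<and> snd (h t) - fst (h t) \<le> \<eta>) \<and>
     (\<integral>\<^sup>+t\<in>{0..<1}. \<Gamma> (slope F (fst (h t)) (snd (h t))) \<partial>lebesgue) \<le> ennreal (1 - 0) * \<Gamma> (slope F 0 1)" if \<eta>: "0 < \<eta>" for \<eta>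
  proof -
    obtain c where c: "0 < c" "\<forall>a b. 0 \<le> a \<and> b \<le> 1 \<and> \<eta> \<le> b - a \<longrightarrow>
      (\<exists>m. a + c \<le> m \<and> m \<le> b - c \<and> closed_segment (slope F a m) (slope F m b) \<inter> closure \<Omega>\<^sub>1 = {})"
      using uniform_split[OF contF closed_closure convexK V(1,2) sl(1) \<eta>] by blast
    have split: "\<exists>m. a + c \<le> m \<and> m \<le> b - c \<and> closed_segment (slope F a m) (slope F m b) \<subseteq> annulus"
      if ab: "0 \<le> a" "b \<le> 1" "\<eta> \<le> b - a" for a b
    proof -
      obtain m where m: "a + c \<le> m" "m \<le> b - c" "closed_segment (slope F a m) (slope F m b) \<inter> closure \<Omega>\<^sub>1 = {}"
        using c(2) ab by blast
      have "slope F a m \<in> closure \<Omega>\<^sub>0" "slope F m b \<in> closure \<Omega>\<^sub>0"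
        using m(1,2) ab c(1) by (intro sl(2); simp)+
      then have "closed_segment (slope F a m) (slope F m b) \<subseteq> closure \<Omega>\<^sub>0" by (rule closed_segment_subset[OF _ _ convexC])
      then show ?thesis using m by blast
    qed
    \<comment> \<open>Large enough for the whole interval \<open>{0..1}\<close> to satisfy the
      length condition of \<open>fine_partition\<close>.\<close>
    obtain n where "1 / c < real n" using reals_Archimedean2 by blast
    then have "1 \<le> real n * c" using c(1) by (simp add: pos_divide_less_eq)
    then have n: "1 - 0 \<le> \<eta> + real n * c" using \<eta> by simp
    show ?thesis
      by (rule fine_partition[OF conc c(1) split _ _ _ n]) auto
  qed
  \<comment> \<open>A partition of mesh at most 1/(k + 1) along which concavity has been
    summed.\<close>
  define refining where "refining k h \<longleftrightarrow> simple_fun h \<and> (\<forall>t\<in>{0..<1}. 0 \<le> fst (h t) \<and> fst (h t) \<le> t \<and> t < snd (h t) \<and> snd (h t) \<le> 1 \<and> snd (h t) - fst (h t) \<le> inverse (real (Suc k))) \<and>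
     (\<integral>\<^sup>+t\<in>{0..<1}. \<Gamma> (slope F (fst (h t)) (snd (h t))) \<partial>lebesgue) \<le> ennreal (1 - 0) * \<Gamma> (slope F 0 1)" for k h
  have "\<forall>k. \<exists>h. refining k h" unfolding refining_def by (intro allI part) simp
  then obtain h where "\<And>k. refining k (h k)" by metis
  note hk = this[unfolded refining_def]
  define z where "z k t = slope F (fst (h k t)) (snd (h k t))" for k t
  have hb: "0 \<le> fst (h k t)" "fst (h k t) \<le> t" "t < snd (h k t)" "snd (h k t) \<le> 1" "snd (h k t) - fst (h k t) \<le> inverse (real (Suc k))"
    if "t \<in> circle" for k t using hk[of k] that by auto
  have zA: "z k t \<in> annulus" if "t \<in> circle" for k t
    unfolding z_def by (rule slA) (use hb[OF that, of k] in auto)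
  have zint: "(\<integral>\<^sup>+t. \<Gamma> (z k t) * indicator circle t \<partial>lebesgue) \<le> \<Gamma> (slope F 0 1)" for k
    using hk[of k] by (simp add: z_def)
  have zm: "(\<lambda>t. \<Gamma> (z k t) * indicator circle t) \<in> borel_measurable lebesgue" for k
  proof -
    have "simple_fun (h k)" using hk[of k] by blast
    from simple_fun_lebesgue_measurable[OF simple_fun_comp[OF this, of "\<lambda>p. \<Gamma> (slope F (fst p) (snd p))"]]
    show ?thesis unfolding z_def by (intro borel_measurable_times_ennreal borel_measurable_indicator) auto
  qed
  obtain N where N: "negligible N" "\<forall>t\<in>{0<..<1} - N. \<forall>e>0. \<exists>d>0. \<forall>a b.
     0 \<le> a \<and> a \<le> t \<and> t < b \<and> b \<le> 1 \<and> b - a < d \<longrightarrow> dist (slope F a b) (\<phi> t) < e"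
    using lebesgue_points[OF \<open>\<phi> integrable_on {0..1}\<close>] unfolding F_def by blast
  \<comment> \<open>At a Lebesgue point the averages \<open>z k t\<close> tend to
    \<open>\<phi> t\<close>, and the lower semicontinuity of \<open>G\<close> at the frontier bounds
    the limit from below.\<close>
  have lim: "ennreal (f (\<phi> t) - m) \<le> liminf (\<lambda>k. \<Gamma> (z k t))" if t: "t \<in> {0<..<1} - N" for t
  proof (rule ennreal_le_epsilon)
    fix e :: real assume e: "0 < e"
    obtain \<eta> where \<eta>: "0 < \<eta>" "\<forall>z\<in>annulus. dist z (\<phi> t) < \<eta> \<longrightarrow> ereal (f (\<phi> t) - e) \<le> G z"
      using majorant_lower_semicontinuous[OF G f(1) fr[of t], of "f (\<phi> t) - e"] e by auto
    obtain d where d: "0 < d" "\<forall>a b. 0 \<le> a \<and> a \<le> t \<and> t < b \<and> b \<le> 1 \<and> b - a < d \<longrightarrow> dist (slope F a b) (\<phi> t) < \<eta>"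
      using N(2) t \<eta>(1) by meson
    have tc: "t \<in> circle" using t by auto
    have "\<forall>\<^sub>F k in sequentially. inverse (real (Suc k)) < d"
      using LIMSEQ_inverse_real_of_nat d(1) by (rule order_tendstoD(2))
    then have "\<forall>\<^sub>F k in sequentially. ennreal (f (\<phi> t) - e - m) \<le> \<Gamma> (z k t)"
    proof eventually_elim
      case (elim k)
      have "dist (z k t) (\<phi> t) < \<eta>" unfolding z_def using d(2) hb[OF tc, of k] elim by auto
      then have "ereal (f (\<phi> t) - e) \<le> G (z k t)" using \<eta>(2) zA[OF tc] by blast
      then have "ereal (f (\<phi> t) - e) - ereal m \<le> G (z k t) - ereal m" by (intro ereal_minus_mono) auto
      then have "e2ennreal (ereal (f (\<phi> t) - e - m)) \<le> \<Gamma> (z k t)" unfolding \<Gamma>_def by (intro e2ennreal_mono) simp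
      then show ?case by simp
    qed
    then have "ennreal (f (\<phi> t) - e - m) \<le> liminf (\<lambda>k. \<Gamma> (z k t))" by (rule Liminf_bounded)
    then have "ennreal (f (\<phi> t) - e - m) + ennreal e \<le> liminf (\<lambda>k. \<Gamma> (z k t)) + ennreal e" by (rule add_right_mono)
    moreover have "ennreal (f (\<phi> t) - m) \<le> ennreal (f (\<phi> t) - e - m) + ennreal e"
    proof (cases "0 \<le> f (\<phi> t) - e - m")
      case True then show ?thesis using e by (simp flip: ennreal_plus)
    next
      case False then show ?thesis using e by (simp add: ennreal_neg ennreal_leI)
    qed
    ultimately show "ennreal (f (\<phi> t) - m) \<le> liminf (\<lambda>k. \<Gamma> (z k t)) + ennreal e" by (rule order_trans[rotated])
  qed
  have "(\<integral>\<^sup>+t\<in>circle. ennreal (f (\<phi> t) - m) \<partial>lebesgue) \<le> (\<integral>\<^sup>+t. liminf (\<lambda>k. \<Gamma> (z k t) * indicator circle t) \<partial>lebesgue)"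
  proof (rule nn_integral_mono_AE)
    \<comment> \<open>\<open>lim\<close> concerns the open interval, so 0 joins the exceptional
      set.\<close>
    have "negligible (insert 0 N)" using N(1) by simp
    then have "AE t in lebesgue. t \<notin> insert 0 N"
      unfolding negligible_iff_null_sets by (rule AE_not_in)
    then show "AE t in lebesgue. ennreal (f (\<phi> t) - m) * indicator circle t \<le> liminf (\<lambda>k. \<Gamma> (z k t) * indicator circle t)"
    proof eventually_elim
      case (elim t)
      show ?case
      proof (cases "t \<in> circle")
        case True
        then have "t \<in> {0<..<1} - N" using elim by auto
        from lim[OF this] show ?thesis using True by simp
      qed simp
    qed
  qed
  also have "\<dots> \<le> liminf (\<lambda>k. \<integral>\<^sup>+t. \<Gamma> (z k t) * indicator circle t \<partial>lebesgue)"
    by (rule nn_integral_liminf) (rule zm)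
  also have "\<dots> \<le> liminf (\<lambda>k. \<Gamma> (slope F 0 1))" by (intro Liminf_mono always_eventually allI zint)
  also have "\<dots> = \<Gamma> (slope F 0 1)" by (simp add: Liminf_const)
  finally have main: "(\<integral>\<^sup>+t\<in>circle. ennreal (f (\<phi> t) - m) \<partial>lebesgue) \<le> e2ennreal (G (slope F 0 1) - ereal m)"
    by (simp add: \<Gamma>_def)
  have "ext_average circle (\<lambda>t. f (\<phi> t)) \<le> G (slope F 0 1)"
    by (rule ext_average_shift[OF composition_measurable[OF f(1) int fr] m(1) m(2)[OF fr] main Gm])
       (rule slA; simp)
  moreover have "slope F 0 1 = average circle \<phi>" by (rule av[symmetric]) auto
  ultimately show ?thesis by simp
qed

lemma bellman_le_minimal:
  assumes f: "lower_semicontinuous_on (frontier \<Omega>\<^sub>0) f" "bdd_below (f ` frontier \<Omega>\<^sub>0)"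
  shows "bellman \<Omega>\<^sub>0 \<Omega>\<^sub>1 f x \<le> minimal_locally_concave annulus f x"
  unfolding bellman_def minimal_locally_concave_def
proof (intro SUP_least INF_greatest)
  fix \<phi> G assume "\<phi> \<in> {\<phi> \<in> admissible \<Omega>\<^sub>0 \<Omega>\<^sub>1. average circle \<phi> = x}" "G \<in> locally_concave_majorants annulus f"
  then show "ext_average circle (\<lambda>t. f (\<phi> t)) \<le> G x" using bellman_le_majorant[OF f] by blast
qed

end

section \<open>The main theorem\<close>

theorem theorem5p3:
  fixes \<Omega>\<^sub>0 \<Omega>\<^sub>1 \<Omega>_star :: "'a::euclidean_space set" and f :: "'a \<Rightarrow> real" and x :: 'a
  assumes "2 \<le> DIM('a)"
    and "\<Omega>\<^sub>0 \<noteq> {}" "open \<Omega>\<^sub>0" "convex \<Omega>\<^sub>0" "\<Omega>\<^sub>0 \<noteq> UNIV"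
    and "\<Omega>\<^sub>1 \<noteq> {}" "open \<Omega>\<^sub>1" "convex \<Omega>\<^sub>1"
    and "closure \<Omega>\<^sub>1 \<subseteq> \<Omega>\<^sub>0"
    and "no_segments (frontier \<Omega>\<^sub>0)" "no_segments (frontier \<Omega>\<^sub>1)"
    and "cone_condition \<Omega>\<^sub>0 \<Omega>\<^sub>1"
    and "locally_bounded_on (frontier \<Omega>\<^sub>0) f"
    and "lower_semicontinuous_on (frontier \<Omega>\<^sub>0) f"
    and "bdd_below (f ` frontier \<Omega>\<^sub>0)"
    and "\<Omega>_star = closure \<Omega>\<^sub>0 - closure \<Omega>\<^sub>1"
    and "x \<in> \<Omega>_star"
  shows "bellman \<Omega>\<^sub>0 \<Omega>\<^sub>1 f x = minimal_locally_concave \<Omega>_star f x"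
proof -
  interpret convex_annulus \<Omega>\<^sub>0 \<Omega>\<^sub>1
    using assms by unfold_locales auto
  show ?thesis
    using bellman_le_minimal[of f x] minimal_le_bellman[of f x] assms by simp
qed

end
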